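(* Let $P$ and $Q$ be finite posets and let $Q' \subseteq Q$ be a subposet. For all $i$ and all multidegrees $\mathbf{a} \in \mathbb{N}^{P \times Q'} \subseteq \mathbb{N}^{P \times Q}$ the following holds: \[ \beta_{i,\mathbf{a}}^{S_{P,Q}}(\mathbb{K}[P,Q]) = \beta_{i,\mathbf{a}}^{S_{P,Q'}}(\mathbb{K}[P,Q']). \] In particular, \[ \beta_{i,j}^{S_{P,Q}}(\mathbb{K}[P,Q]) \geq \beta_{i,j}^{S_{P,Q'}}(\mathbb{K}[P,Q']) \] for all $i$ and $j$. Moreover, $\operatorname{reg} \mathbb{K}[P,Q]\geq \operatorname{reg}\mathbb{K}[P,Q']$ and $\operatorname{pdim} \mathbb{K}[P,Q]\geq \operatorname{pdim} \mathbb{K}[P,Q']$.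
   Context: All posets are finite and nonempty; subposets carry the induced order; $\mathbb{K}$ is an arbitrary field. $\operatorname{Hom}(P,Q)$ is the set of order-preserving maps $P\to Q$. $S_{P,Q}=\mathbb{K}[x_{p,q} : p\in P, q\in Q]$, $u_\phi=\prod_{p\in P}x_{p,\phi(p)}$, $L(P,Q)=(u_\phi : \phi\in \operatorname{Hom}(P,Q))\subseteq S_{P,Q}$ and $\mathbb{K}[P,Q]=S_{P,Q}/L(P,Q)$. $S_{P,Q}$ carries the fine grading by $\mathbb{N}^{P\times Q}$; $\mathbb{N}^{P\times Q'}$ is embedded in $\mathbb{N}^{P\times Q}$ by extending with zeros. $\beta^S_{i,\mathbf{a}}(R)=\dim_{\mathbb K}\operatorname{Tor}_i^{S}(R,\mathbb{K})_{\mathbf{a}}$ are the multigraded Betti numbers, $\beta^S_{i,j}(R)$ is the sum of $\beta^S_{i,\mathbf{a}}(R)$ over all $\mathbf{a}$ of total degree $j$, $\operatorname{reg} R=\max\{j-i : \beta^S_{i,j}(R)\ne0\}$, and $\operatorname{pdim} R$ is the projective dimension (each over the respective polynomial ring). *)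

theory Defs
  imports
    "HOL-Algebra.QuotRing"
    "HOL-Algebra.Module"
    "HOL-Library.Poly_Mapping"
    "HOL-Library.Function_Algebras"
    "HOL-Library.FuncSet"
    "HOL-Library.Extended_Nat"
begin

section \<open>Polynomial rings and multidegrees\<close>

text \<open>
  Multidegrees are exponent vectors with finite support. The polynomial ring in the variables
  \<open>x\<^sub>v\<close>, \<open>v \<in> X\<close>, is the subring of the polynomials over all variables of type \<open>'v\<close> in which only
  variables from \<open>X\<close> occur. For \<open>Y \<subseteq> X\<close> both \<open>S\<^sub>Y \<subseteq> S\<^sub>X\<close> and the embedding of
  \<open>\<nat>\<^sup>Y\<close> into \<open>\<nat>\<^sup>X\<close> by extension with zeros are then literal inclusions.
\<close>

type_synonym 'v multideg = "'v \<Rightarrow>\<^sub>0 nat"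
type_synonym ('v, 'k) mpoly = "'v multideg \<Rightarrow>\<^sub>0 'k"

definition multidegs :: "'v set \<Rightarrow> 'v multideg set" where
  "multidegs X = {a. Poly_Mapping.keys a \<subseteq> X}"

definition total_degree :: "'v multideg \<Rightarrow> nat" where
  "total_degree a = (\<Sum>v\<in>Poly_Mapping.keys a. Poly_Mapping.lookup a v)"

definition mpoly_ring :: "'v set \<Rightarrow> ('v, 'k::field) mpoly ring" where
  "mpoly_ring X =
    \<lparr>carrier = {f. Poly_Mapping.keys f \<subseteq> multidegs X},
     monoid.mult = (*), one = 1, zero = 0, add = (+)\<rparr>"

definition mpoly_component :: "'v set \<Rightarrow> 'v multideg \<Rightarrow> ('v, 'k::field) mpoly set" where
  "mpoly_component X a = {f \<in> carrier (mpoly_ring X). Poly_Mapping.keys f \<subseteq> {a}}"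

definition Var :: "'v \<Rightarrow> ('v, 'k::field) mpoly" where
  "Var v = Poly_Mapping.single (Poly_Mapping.single v 1) 1"

definition Const :: "'k::field \<Rightarrow> ('v, 'k) mpoly" where
  "Const c = Poly_Mapping.single 0 c"

text \<open>The graded maximal ideal; the field is regarded as the \<open>S\<^sub>X\<close>-module \<open>S\<^sub>X / irrelevant_ideal X\<close>.\<close>

definition irrelevant_ideal :: "'v set \<Rightarrow> ('v, 'k::field) mpoly set" where
  "irrelevant_ideal X = genideal (mpoly_ring X) (Var ` X)"

section \<open>Modules, resolutions and projective dimension\<close>

definition mod_hom ::
    "('a, 'x) ring_scheme \<Rightarrow> ('a, 'b) module \<Rightarrow> ('a, 'c) module \<Rightarrow> ('b \<Rightarrow> 'c) set" where
  "mod_hom R M N = {h \<in> carrier M \<rightarrow> carrier N.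
     (\<forall>x\<in>carrier M. \<forall>y\<in>carrier M. h (x \<oplus>\<^bsub>M\<^esub> y) = h x \<oplus>\<^bsub>N\<^esub> h y) \<and>
     (\<forall>a\<in>carrier R. \<forall>x\<in>carrier M. h (a \<odot>\<^bsub>M\<^esub> x) = a \<odot>\<^bsub>N\<^esub> h x)}"

definition quot_module :: "'a ring \<Rightarrow> 'a set \<Rightarrow> ('a, 'a set) module" where
  "quot_module R I =
    \<lparr>carrier = carrier (R Quot I), monoid.mult = monoid.mult (R Quot I), one = one (R Quot I),
     zero = zero (R Quot I), add = add (R Quot I),
     smult = (\<lambda>s x. (I +>\<^bsub>R\<^esub> s) \<otimes>\<^bsub>R Quot I\<^esub> x)\<rparr>"

text \<open>\<open>ideal_smult R I M\<close> is the submodule \<open>I M\<close> of \<open>M\<close>.\<close>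

definition ideal_smult :: "'a ring \<Rightarrow> 'a set \<Rightarrow> ('a, 'b) module \<Rightarrow> 'b set" where
  "ideal_smult R I M =
     \<Inter>{N. submodule N R M \<and> (\<forall>a\<in>I. \<forall>x\<in>carrier M. a \<odot>\<^bsub>M\<^esub> x \<in> N)}"

text \<open>The free module of rank \<open>r\<close>; elements are sequences that vanish from position \<open>r\<close> on.
  The ring operations of the record are irrelevant for modules.\<close>

definition free_module :: "'a ring \<Rightarrow> nat \<Rightarrow> ('a, nat \<Rightarrow> 'a) module" where
  "free_module R r =
    \<lparr>carrier = {f. (\<forall>k<r. f k \<in> carrier R) \<and> (\<forall>k\<ge>r. f k = \<zero>\<^bsub>R\<^esub>)},
     monoid.mult = undefined, one = undefined,
     zero = (\<lambda>k. \<zero>\<^bsub>R\<^esub>), add = (\<lambda>f g k. f k \<oplus>\<^bsub>R\<^esub> g k),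
     smult = (\<lambda>a f k. a \<otimes>\<^bsub>R\<^esub> f k)\<rparr>"

text \<open>
  \<open>resolution R M F d e\<close> says that
  \<open>\<dots> \<rightarrow> F 2 \<rightarrow> F 1 \<rightarrow> F 0 \<rightarrow> M \<rightarrow> 0\<close> is an exact sequence of \<open>R\<close>-modules, where
  \<open>d i\<close> maps \<open>F (i + 1)\<close> to \<open>F i\<close> and \<open>e\<close> is the augmentation.
\<close>

definition resolution ::
    "'a ring \<Rightarrow> ('a, 'm) module \<Rightarrow> (nat \<Rightarrow> ('a, 'b) module) \<Rightarrow> (nat \<Rightarrow> 'b \<Rightarrow> 'b) \<Rightarrow> ('b \<Rightarrow> 'm) \<Rightarrow> bool"
  where
  "resolution R M F d e \<longleftrightarrow>
     (\<forall>i. Module.module R (F i)) \<and>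
     e \<in> mod_hom R (F 0) M \<and>
     (\<forall>i. d i \<in> mod_hom R (F (Suc i)) (F i)) \<and>
     e ` carrier (F 0) = carrier M \<and>
     d 0 ` carrier (F 1) = {x \<in> carrier (F 0). e x = \<zero>\<^bsub>M\<^esub>} \<and>
     (\<forall>i. d (Suc i) ` carrier (F (Suc (Suc i))) =
            {x \<in> carrier (F (Suc i)). d i x = \<zero>\<^bsub>F i\<^esub>})"

text \<open>
  Projectivity by the lifting property. The test modules have their carriers in the same type as
  \<open>M\<close>. Below this type is \<open>nat \<Rightarrow> 'a\<close> for an infinite ring with elements of type \<open>'a\<close>; up to
  isomorphism it contains a free module mapping onto \<open>M\<close>, so this is the usual notion.
\<close>

definition projective_module :: "'a ring \<Rightarrow> ('a, 'b) module \<Rightarrow> bool" where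
  "projective_module R M \<longleftrightarrow> Module.module R M \<and>
     (\<forall>(N :: ('a, 'b) module) (N' :: ('a, 'b) module) g f.
        Module.module R N \<and> Module.module R N' \<and>
        g \<in> mod_hom R N N' \<and> g ` carrier N = carrier N' \<and> f \<in> mod_hom R M N' \<longrightarrow>
        (\<exists>h\<in>mod_hom R M N. \<forall>x\<in>carrier M. g (h x) = f x))"

definition has_projective_resolution_of_length_le :: "'a ring \<Rightarrow> ('a, 'm) module \<Rightarrow> nat \<Rightarrow> bool" where
  "has_projective_resolution_of_length_le R M n \<longleftrightarrow>
     (\<exists>(F :: nat \<Rightarrow> ('a, nat \<Rightarrow> 'a) module) d e.
        resolution R M F d e \<and> (\<forall>i. projective_module R (F i)) \<and>
        (\<forall>i>n. carrier (F i) = {\<zero>\<^bsub>F i\<^esub>}))"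

definition projective_dimension :: "'a ring \<Rightarrow> ('a, 'm) module \<Rightarrow> enat" where
  "projective_dimension R M = Inf {enat n |n. has_projective_resolution_of_length_le R M n}"

section \<open>Multigraded Betti numbers\<close>

text \<open>
  A list \<open>D = [b\<^sub>1, \<dots>, b\<^sub>r]\<close> of multidegrees represents the multigraded free module
  \<open>S(-b\<^sub>1) \<oplus> \<dots> \<oplus> S(-b\<^sub>r)\<close>, whose \<open>k\<close>-th basis element has degree \<open>b\<^sub>k\<close>.
\<close>

abbreviation shifted_free :: "'v set \<Rightarrow> 'v multideg list \<Rightarrow>
    (('v, 'k::field) mpoly, nat \<Rightarrow> ('v, 'k) mpoly) module" where
  "shifted_free X D \<equiv> free_module (mpoly_ring X) (length D)"

definition shifted_free_component :: "'v set \<Rightarrow> 'v multideg list \<Rightarrow> 'v multideg \<Rightarrow>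
    (nat \<Rightarrow> ('v, 'k::field) mpoly) set" where
  "shifted_free_component X D a =
     {f \<in> carrier (shifted_free X D). \<forall>k<length D. \<forall>m\<in>Poly_Mapping.keys (f k). m + D ! k = a}"

text \<open>
  In the following a multigraded module is a module \<open>M\<close> together with the family \<open>G\<close> of its
  graded components.
\<close>

definition graded_free_resolution ::
    "'v set \<Rightarrow> (('v, 'k::field) mpoly, 'm) module \<Rightarrow> ('v multideg \<Rightarrow> 'm set) \<Rightarrow>
     (nat \<Rightarrow> 'v multideg list) \<Rightarrow>
     (nat \<Rightarrow> (nat \<Rightarrow> ('v, 'k) mpoly) \<Rightarrow> (nat \<Rightarrow> ('v, 'k) mpoly)) \<Rightarrow>
     ((nat \<Rightarrow> ('v, 'k) mpoly) \<Rightarrow> 'm) \<Rightarrow> bool" where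
  "graded_free_resolution X M G D d e \<longleftrightarrow>
     (\<forall>i. set (D i) \<subseteq> multidegs X) \<and>
     resolution (mpoly_ring X) M (\<lambda>i. shifted_free X (D i)) d e \<and>
     (\<forall>a. e ` shifted_free_component X (D 0) a \<subseteq> G a) \<and>
     (\<forall>i a. d i ` shifted_free_component X (D (Suc i)) a \<subseteq> shifted_free_component X (D i) a)"

text \<open>
  For a multigraded free resolution \<open>F\<close> of \<open>M\<close>, and \<open>\<mm>\<close> the graded maximal ideal, the complex
  \<open>F \<otimes> \<bbbK> = F \<otimes> S/\<mm>\<close> is \<open>F/\<mm>F\<close>. Hence \<open>Tor\<^sub>i(M, \<bbbK>)\<^sub>a = H\<^sub>i(F/\<mm>F)\<^sub>a\<close> is the quotient of
  the two vector spaces below, of which the second is contained in the first.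
\<close>

definition tor_cycles where
  "tor_cycles X D d i a =
     {f \<in> shifted_free_component X (D i) a.
        case i of 0 \<Rightarrow> True
        | Suc j \<Rightarrow> d j f \<in> ideal_smult (mpoly_ring X) (irrelevant_ideal X) (shifted_free X (D j))}"

definition tor_boundaries where
  "tor_boundaries X D d i a =
     {f \<in> shifted_free_component X (D i) a.
        \<exists>g\<in>carrier (shifted_free X (D (Suc i))).
        \<exists>h\<in>ideal_smult (mpoly_ring X) (irrelevant_ideal X) (shifted_free X (D i)).
          f = d i g \<oplus>\<^bsub>shifted_free X (D i)\<^esub> h}"

definition kscale :: "'k::field \<Rightarrow> (nat \<Rightarrow> ('v, 'k) mpoly) \<Rightarrow> (nat \<Rightarrow> ('v, 'k) mpoly)" where
  "kscale c f = (\<lambda>k. Const c * f k)"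

definition tor_dim ::
    "'v set \<Rightarrow> (nat \<Rightarrow> 'v multideg list) \<Rightarrow>
     (nat \<Rightarrow> (nat \<Rightarrow> ('v, 'k::field) mpoly) \<Rightarrow> (nat \<Rightarrow> ('v, 'k) mpoly)) \<Rightarrow>
     nat \<Rightarrow> 'v multideg \<Rightarrow> nat" where
  "tor_dim X D d i a =
     vector_space.dim kscale (tor_cycles X D d i a) - vector_space.dim kscale (tor_boundaries X D d i a)"

text \<open>Tor does not depend on the chosen resolution; the Betti number is the common value.\<close>

definition multigraded_betti ::
    "'v set \<Rightarrow> (('v, 'k::field) mpoly, 'm) module \<Rightarrow> ('v multideg \<Rightarrow> 'm set) \<Rightarrow>
     nat \<Rightarrow> 'v multideg \<Rightarrow> nat" where
  "multigraded_betti X M G i a =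
     (THE n. \<exists>D d e. graded_free_resolution X M G D d e \<and> n = tor_dim X D d i a)"

definition graded_betti ::
    "'v set \<Rightarrow> (('v, 'k::field) mpoly, 'm) module \<Rightarrow> ('v multideg \<Rightarrow> 'm set) \<Rightarrow>
     nat \<Rightarrow> nat \<Rightarrow> nat" where
  "graded_betti X M G i j =
     (\<Sum>a | a \<in> multidegs X \<and> total_degree a = j. multigraded_betti X M G i a)"

definition regularity ::
    "'v set \<Rightarrow> (('v, 'k::field) mpoly, 'm) module \<Rightarrow> ('v multideg \<Rightarrow> 'm set) \<Rightarrow> int" where
  "regularity X M G = Max {int j - int i |i j. graded_betti X M G i j \<noteq> 0}"

section \<open>The rings associated with a pair of posets\<close>

text \<open>
  A poset is a subset of an ordered type, with the induced order. The parameter of type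
  \<open>'k itself\<close> only serves to name the coefficient field.
\<close>

definition poset_hom :: "'p::order set \<Rightarrow> 'q::order set \<Rightarrow> ('p \<Rightarrow> 'q) set" where
  "poset_hom P Q = {\<phi> \<in> P \<rightarrow>\<^sub>E Q. mono_on P \<phi>}"

definition hom_ideal :: "'k::field itself \<Rightarrow> 'p::order set \<Rightarrow> 'q::order set \<Rightarrow> ('p \<times> 'q, 'k) mpoly set"
  where
  "hom_ideal K P Q =
     genideal (mpoly_ring (P \<times> Q)) ((\<lambda>\<phi>. \<Prod>p\<in>P. Var (p, \<phi> p)) ` poset_hom P Q)"

definition hom_quotient :: "'k::field itself \<Rightarrow> 'p::order set \<Rightarrow> 'q::order set \<Rightarrow>
    (('p \<times> 'q, 'k) mpoly, ('p \<times> 'q, 'k) mpoly set) module" where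
  "hom_quotient K P Q = quot_module (mpoly_ring (P \<times> Q)) (hom_ideal K P Q)"

definition hom_quotient_component :: "'k::field itself \<Rightarrow> 'p::order set \<Rightarrow> 'q::order set \<Rightarrow>
    ('p \<times> 'q) multideg \<Rightarrow> ('p \<times> 'q, 'k) mpoly set set" where
  "hom_quotient_component K P Q a =
     (\<lambda>f. hom_ideal K P Q +>\<^bsub>mpoly_ring (P \<times> Q)\<^esub> f) ` mpoly_component (P \<times> Q) a"

definition hom_multigraded_betti where
  "hom_multigraded_betti K P Q =
     multigraded_betti (P \<times> Q) (hom_quotient K P Q) (hom_quotient_component K P Q)"

definition hom_graded_betti where
  "hom_graded_betti K P Q =
     graded_betti (P \<times> Q) (hom_quotient K P Q) (hom_quotient_component K P Q)"

definition hom_reg where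
  "hom_reg K P Q = regularity (P \<times> Q) (hom_quotient K P Q) (hom_quotient_component K P Q)"

definition hom_pdim where
  "hom_pdim K P Q = projective_dimension (mpoly_ring (P \<times> Q)) (hom_quotient K P Q)"

section \<open>Basic facts\<close>

lemma multidegs_add: "a \<in> multidegs X \<Longrightarrow> b \<in> multidegs X \<Longrightarrow> a + b \<in> multidegs X"
  unfolding multidegs_def using Poly_Mapping.keys_add[of a b] by blast

lemma mpoly_ring_cring: "cring (mpoly_ring X :: ('v, 'k::field) mpoly ring)"
proof (rule cringI)
  let ?S = "mpoly_ring X :: ('v, 'k) mpoly ring"
  have add: "f + g \<in> carrier ?S" if "f \<in> carrier ?S" "g \<in> carrier ?S" for f g
    using that Poly_Mapping.keys_add[of f g] by (auto simp: mpoly_ring_def)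
  have mult: "f * g \<in> carrier ?S" if "f \<in> carrier ?S" "g \<in> carrier ?S" for f g
    using that Poly_Mapping.keys_mult[of f g] multidegs_add[of _ X]
    by (fastforce simp: mpoly_ring_def)
  show "abelian_group ?S"
  proof (rule abelian_groupI)
    fix f assume "f \<in> carrier ?S"
    then have "- f \<in> carrier ?S"
      by (auto simp: mpoly_ring_def Poly_Mapping.in_keys_iff)
    then show "\<exists>g\<in>carrier ?S. g \<oplus>\<^bsub>?S\<^esub> f = \<zero>\<^bsub>?S\<^esub>"
      by (intro bexI[of _ "- f"]) (simp_all add: mpoly_ring_def)
  qed (use add in \<open>auto simp: mpoly_ring_def add_ac\<close>)
  show "Group.comm_monoid ?S"
    by (rule comm_monoidI)
      (use mult in \<open>auto simp: mpoly_ring_def multidegs_def mult_ac\<close>)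
  show "\<And>x y z. (x \<oplus>\<^bsub>?S\<^esub> y) \<otimes>\<^bsub>?S\<^esub> z = x \<otimes>\<^bsub>?S\<^esub> z \<oplus>\<^bsub>?S\<^esub> y \<otimes>\<^bsub>?S\<^esub> z"
    by (simp add: mpoly_ring_def distrib_right)
qed

lemma kscale_vector_space: "vector_space (kscale :: 'k::field \<Rightarrow> (nat \<Rightarrow> ('v, 'k) mpoly) \<Rightarrow> _)"
proof
  have *: "Const (b + c) = (Const b + Const c :: ('v, 'k) mpoly)"
    "Const (b * c) = (Const b * Const c :: ('v, 'k) mpoly)" "Const 1 = (1 :: ('v, 'k) mpoly)"
    for b c :: 'k
    by (simp_all add: Const_def Poly_Mapping.single_add Poly_Mapping.mult_single)
  fix b c :: 'k and f g :: "nat \<Rightarrow> ('v, 'k) mpoly"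
  show "kscale b (f + g) = kscale b f + kscale b g"
    "kscale (b + c) f = kscale b f + kscale c f"
    "kscale b (kscale c f) = kscale (b * c) f" "kscale 1 f = f"
    by (auto simp: kscale_def * algebra_simps fun_eq_iff)
qed

lemma free_module_module:
  assumes "cring R"
  shows "Module.module R (free_module R r)"
proof -
  interpret cring R by fact
  let ?F = "free_module R r"
  have *: "f k \<in> carrier R" if "f \<in> carrier ?F" for f k
    using that by (cases "k < r") (auto simp: free_module_def)
  have ops: "f \<oplus>\<^bsub>?F\<^esub> g = (\<lambda>k. f k \<oplus>\<^bsub>R\<^esub> g k)" "\<zero>\<^bsub>?F\<^esub> = (\<lambda>k. \<zero>\<^bsub>R\<^esub>)"
    "a \<odot>\<^bsub>?F\<^esub> f = (\<lambda>k. a \<otimes>\<^bsub>R\<^esub> f k)" for a f g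
    by (simp_all add: free_module_def)
  have closed: "f \<oplus>\<^bsub>?F\<^esub> g \<in> carrier ?F" "\<zero>\<^bsub>?F\<^esub> \<in> carrier ?F" "(\<lambda>k. \<ominus>\<^bsub>R\<^esub> f k) \<in> carrier ?F"
    if "f \<in> carrier ?F" "g \<in> carrier ?F" for f g
    using that by (simp_all add: free_module_def)
  have smult: "a \<odot>\<^bsub>?F\<^esub> f \<in> carrier ?F" if "a \<in> carrier R" "f \<in> carrier ?F" for a f
    using that by (simp add: free_module_def)
  have "abelian_group ?F"
  proof (rule abelian_groupI)
    show "\<zero>\<^bsub>?F\<^esub> \<in> carrier ?F"
      by (simp add: free_module_def)
    fix f assume f: "f \<in> carrier ?F"
    show "\<zero>\<^bsub>?F\<^esub> \<oplus>\<^bsub>?F\<^esub> f = f"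
      using *[OF f] by (simp add: ops)
    show "\<exists>g\<in>carrier ?F. g \<oplus>\<^bsub>?F\<^esub> f = \<zero>\<^bsub>?F\<^esub>"
      using closed(3)[OF f f] *[OF f] by (intro bexI[of _ "\<lambda>k. \<ominus>\<^bsub>R\<^esub> f k"]) (simp_all add: ops l_neg)
    fix g assume g: "g \<in> carrier ?F"
    show "f \<oplus>\<^bsub>?F\<^esub> g \<in> carrier ?F" by (rule closed(1)[OF f g])
    show "f \<oplus>\<^bsub>?F\<^esub> g = g \<oplus>\<^bsub>?F\<^esub> f"
      using *[OF f] *[OF g] by (simp add: ops a_comm)
    fix h assume h: "h \<in> carrier ?F"
    show "(f \<oplus>\<^bsub>?F\<^esub> g) \<oplus>\<^bsub>?F\<^esub> h = f \<oplus>\<^bsub>?F\<^esub> (g \<oplus>\<^bsub>?F\<^esub> h)"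
      using *[OF f] *[OF g] *[OF h] by (simp add: ops a_assoc)
  qed
  then show ?thesis
    by (rule moduleI[OF is_cring])
      (use * smult in \<open>simp_all add: ops l_distr r_distr m_assoc\<close>)
qed

lemma quot_module_module:
  assumes "cring R" "ideal I R"
  shows "Module.module R (quot_module R I)"
proof -
  interpret cring R by fact
  interpret ideal I R by fact
  interpret Q: cring "R Quot I" by (rule quotient_is_cring) fact
  interpret H: ring_hom_ring R "R Quot I" "(+>\<^bsub>R\<^esub>) I" by (rule rcos_ring_hom_ring)
  have ag: "abelian_group (quot_module R I)"
    by (rule abelian_groupI)
      (use Q.a_assoc Q.a_comm Q.l_neg in \<open>auto simp: quot_module_def intro: Q.add.l_inv_ex\<close>)
  show ?thesis
    by (rule moduleI)
      (use ag H.hom_closed in \<open>auto simp: quot_module_def is_cring Q.l_distr Q.r_distr Q.m_assoc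
         H.hom_add H.hom_mult H.hom_one\<close>)
qed

end

theory Submission
  imports Defs
begin

text \<open>
  All multigraded components of \<open>\<bbbK>[P,Q]\<close> in degrees supported on \<open>P \<times> Q'\<close> are those of
  \<open>\<bbbK>[P,Q']\<close>, because a generator \<open>u\<^sub>\<phi>\<close> divides a monomial in the variables of \<open>P \<times> Q'\<close> only if
  \<open>\<phi>\<close> maps into \<open>Q'\<close>. Hence the part in these degrees of a multigraded free resolution over
  \<open>S\<^bsub>P,Q\<^esub>\<close> is a multigraded free resolution over \<open>S\<^bsub>P,Q'\<^esub>\<close>, with the same Tor in these degrees. The
  Betti numbers are well defined since any two multigraded free resolutions are homotopy equivalent,
  and the finite Taylor resolution provides one.

  For the projective dimension no minimal resolution is needed: a projective resolution of length
  \<open>n\<close>, not necessarily graded, yields a map \<open>h\<close> from the \<open>n\<close>-th to the \<open>(n+1)\<close>-st module of a graded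
  free resolution with \<open>d h d = d\<close>. The degree-preserving part of \<open>h\<close> has the same property and
  restricts to \<open>S\<^bsub>P,Q'\<^esub>\<close>, where it splits off the syzygies and truncates the resolution after \<open>n\<close> steps.
\<close>

text \<open>Two definitions shape the proof. A Betti number is the common value over all multigraded
  free resolutions, so independence of the resolution must be known before any particular one can be
  used. The projective dimension ranges over ungraded projective resolutions, so Betti numbers would
  reach it only through minimal resolutions. Restriction to \<open>Q'\<close> is a literal
  inclusion: bases are ordered so that the elements whose degree is supported on
  \<open>P \<times> Q'\<close> come first, and the same functions then act as differentials over
  both polynomial rings. The Taylor resolution is explicit over every field, its basis degrees are
  lcms of generators, and it has finitely many basis elements in total. The last point makes the
  maximum in the regularity one over a finite set; that set is nonempty because \<open>P\<close> is
  nonempty, so that no generator is 1 and the Betti number in position 0 and degree 0 does not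
  vanish. The identity \<open>d h d = d\<close> is linear in \<open>h\<close> and the differentials
  preserve degrees, so it can be compared degree by degree; this is why the degree-preserving part
  of \<open>h\<close> inherits it.\<close>

lemma (in abelian_group) minus_self [simp]: "x \<in> carrier G \<Longrightarrow> x \<ominus> x = \<zero>"
  by (simp add: a_minus_def r_neg)

section \<open>Homomorphisms of modules and their images\<close>

lemma mod_homI:
  assumes "\<And>x. x \<in> carrier M \<Longrightarrow> h x \<in> carrier N"
    and "\<And>x y. x \<in> carrier M \<Longrightarrow> y \<in> carrier M \<Longrightarrow> h (x \<oplus>\<^bsub>M\<^esub> y) = h x \<oplus>\<^bsub>N\<^esub> h y"
    and "\<And>a x. a \<in> carrier R \<Longrightarrow> x \<in> carrier M \<Longrightarrow> h (a \<odot>\<^bsub>M\<^esub> x) = a \<odot>\<^bsub>N\<^esub> h x"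
  shows "h \<in> mod_hom R M N"
  using assms by (auto simp: mod_hom_def)

lemma mod_homD:
  assumes "h \<in> mod_hom R M N"
  shows "x \<in> carrier M \<Longrightarrow> h x \<in> carrier N"
    and "x \<in> carrier M \<Longrightarrow> y \<in> carrier M \<Longrightarrow> h (x \<oplus>\<^bsub>M\<^esub> y) = h x \<oplus>\<^bsub>N\<^esub> h y"
    and "a \<in> carrier R \<Longrightarrow> x \<in> carrier M \<Longrightarrow> h (a \<odot>\<^bsub>M\<^esub> x) = a \<odot>\<^bsub>N\<^esub> h x"
  using assms by (auto simp: mod_hom_def)

lemma mod_hom_id: "(\<lambda>x. x) \<in> mod_hom R M M"
  by (auto simp: mod_hom_def)

lemma mod_hom_comp:
  assumes "f \<in> mod_hom R M N" "g \<in> mod_hom R N L"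
  shows "(\<lambda>x. g (f x)) \<in> mod_hom R M L"
  using mod_homD[OF assms(1)] mod_homD[OF assms(2)] by (intro mod_homI) simp_all

lemma mod_hom_zero:
  assumes "f \<in> mod_hom R M N" "Module.module R M" "Module.module R N"
  shows "f \<zero>\<^bsub>M\<^esub> = \<zero>\<^bsub>N\<^esub>"
proof -
  interpret M: Module.module R M by fact
  interpret N: Module.module R N by fact
  have "f (\<zero>\<^bsub>R\<^esub> \<odot>\<^bsub>M\<^esub> \<zero>\<^bsub>M\<^esub>) = \<zero>\<^bsub>R\<^esub> \<odot>\<^bsub>N\<^esub> f \<zero>\<^bsub>M\<^esub>"
    by (rule mod_homD(3)[OF assms(1)]) auto
  then show ?thesis using mod_homD(1)[OF assms(1)] by simp
qed

lemma mod_hom_minus: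
  assumes f: "f \<in> mod_hom R M N" and "Module.module R M" "Module.module R N"
    and x: "x \<in> carrier M" and y: "y \<in> carrier M"
  shows "f (x \<ominus>\<^bsub>M\<^esub> y) = f x \<ominus>\<^bsub>N\<^esub> f y"
proof -
  interpret M: Module.module R M by fact
  interpret N: Module.module R N by fact
  have "f (\<ominus>\<^bsub>M\<^esub> y) \<oplus>\<^bsub>N\<^esub> f y = \<zero>\<^bsub>N\<^esub>"
    using mod_homD(2)[OF f, of "\<ominus>\<^bsub>M\<^esub> y" y] y mod_hom_zero[OF assms(1-3)] by (simp add: M.l_neg)
  then have "f (\<ominus>\<^bsub>M\<^esub> y) = \<ominus>\<^bsub>N\<^esub> f y"
    using mod_homD(1)[OF f] y by (simp add: N.minus_equality)
  then show ?thesis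
    using mod_homD[OF f] x y by (simp add: a_minus_def)
qed

lemma mod_hom_diff:
  assumes f: "f \<in> mod_hom R M N" and g: "g \<in> mod_hom R M N" and "Module.module R N"
  shows "(\<lambda>x. f x \<ominus>\<^bsub>N\<^esub> g x) \<in> mod_hom R M N"
proof -
  interpret N: Module.module R N by fact
  show ?thesis
  proof (rule mod_homI)
    fix x assume x: "x \<in> carrier M"
    note fx = mod_homD[OF f] mod_homD[OF g]
    show "f x \<ominus>\<^bsub>N\<^esub> g x \<in> carrier N" using x fx by simp
    { fix y assume y: "y \<in> carrier M"
      show "f (x \<oplus>\<^bsub>M\<^esub> y) \<ominus>\<^bsub>N\<^esub> g (x \<oplus>\<^bsub>M\<^esub> y) = f x \<ominus>\<^bsub>N\<^esub> g x \<oplus>\<^bsub>N\<^esub> (f y \<ominus>\<^bsub>N\<^esub> g y)"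
        using x y fx by (simp add: a_minus_def N.minus_add N.a_ac) }
    { fix a assume a: "a \<in> carrier R"
      show "f (a \<odot>\<^bsub>M\<^esub> x) \<ominus>\<^bsub>N\<^esub> g (a \<odot>\<^bsub>M\<^esub> x) = a \<odot>\<^bsub>N\<^esub> (f x \<ominus>\<^bsub>N\<^esub> g x)"
        using a x fx by (simp add: a_minus_def N.smult_r_distr N.smult_r_minus) }
  qed
qed

text \<open>Projectivity is tested on surjections only. Shrinking the carrier of the target to the
  image makes any homomorphism surjective without leaving the type of the test modules.\<close>

lemma image_module:
  assumes g: "g \<in> mod_hom R M N" and "Module.module R M" "Module.module R N"
  shows "Module.module R (N\<lparr>carrier := g ` carrier M\<rparr>)"
proof -
  interpret M: Module.module R M by fact
  interpret N: Module.module R N by fact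
  have "submodule (g ` carrier M) R N"
  proof (rule N.submoduleI)
    show "g ` carrier M \<subseteq> carrier N" using mod_homD(1)[OF g] by auto
    show "\<zero>\<^bsub>N\<^esub> \<in> g ` carrier M"
      using mod_hom_zero[OF assms] by (metis M.zero_closed imageI)
    show "\<ominus>\<^bsub>N\<^esub> a \<in> g ` carrier M" if a: "a \<in> g ` carrier M" for a
    proof -
      obtain x where x: "x \<in> carrier M" "a = g x" using a by auto
      have "g (\<zero>\<^bsub>M\<^esub> \<ominus>\<^bsub>M\<^esub> x) = \<zero>\<^bsub>N\<^esub> \<ominus>\<^bsub>N\<^esub> a"
        using mod_hom_minus[OF assms] x mod_hom_zero[OF assms] by simp
      also have "\<dots> = \<ominus>\<^bsub>N\<^esub> a" using mod_homD(1)[OF g] x by (simp add: a_minus_def)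
      finally show ?thesis using x by (metis M.minus_closed M.zero_closed imageI)
    qed
    show "a \<oplus>\<^bsub>N\<^esub> b \<in> g ` carrier M" if "a \<in> g ` carrier M" "b \<in> g ` carrier M" for a b
      using that mod_homD(2)[OF g, symmetric] by auto
    show "a \<odot>\<^bsub>N\<^esub> x \<in> g ` carrier M" if "a \<in> carrier R" "x \<in> g ` carrier M" for a x
      using that mod_homD(3)[OF g, symmetric] by auto
  qed
  then show ?thesis by (rule submodule.submodule_is_module) fact
qed

section \<open>Comparison of resolutions\<close>

text \<open>
  The components \<open>A a\<close> of a module are arbitrary subsets. Multigraded modules and, with
  \<open>A a\<close> the whole carrier, ungraded modules are thus treated at once.
\<close>

definition ghom where
  "ghom R M A N B = {h \<in> mod_hom R M N. \<forall>a. h ` A a \<subseteq> B a}"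

lemma ghom_comp:
  "f \<in> ghom R M A N B \<Longrightarrow> g \<in> ghom R N B L C \<Longrightarrow> (\<lambda>x. g (f x)) \<in> ghom R M A L C"
  unfolding ghom_def by (blast intro: mod_hom_comp)

lemma ghomD:
  assumes "h \<in> ghom R M A N B"
  shows "h \<in> mod_hom R M N" and "x \<in> A a \<Longrightarrow> h x \<in> B a"
  using assms unfolding ghom_def by auto

text \<open>Projectivity relative to one fixed module \<open>N\<close> with components
  \<open>B\<close>, for maps \<open>g\<close> that need not be surjective: it suffices that
  \<open>f\<close> lands in the image of \<open>g\<close>, degree by degree. The target
  \<open>N'\<close> carries no grading of its own; the sets of values of \<open>g\<close> on
  \<open>B a\<close> take its place.\<close>

definition gproj ::
  "'a ring \<Rightarrow> ('a, 'b) module \<Rightarrow> ('g \<Rightarrow> 'b set) \<Rightarrow> ('a, 'b) module \<Rightarrow> ('g \<Rightarrow> 'b set) \<Rightarrow> bool" where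
  "gproj R F A N B \<longleftrightarrow>
     (\<forall>(N' :: ('a, 'b) module) f g. Module.module R N' \<and> f \<in> mod_hom R F N' \<and> g \<in> mod_hom R N N' \<and>
        f ` carrier F \<subseteq> g ` carrier N \<and> (\<forall>a. f ` A a \<subseteq> g ` B a) \<longrightarrow>
        (\<exists>h\<in>ghom R F A N B. \<forall>x\<in>carrier F. g (h x) = f x))"

lemma gprojD:
  fixes N N' :: "('a, 'b) module"
  assumes "gproj R F A N B" "Module.module R N'" "f \<in> mod_hom R F N'" "g \<in> mod_hom R N N'"
    and "\<And>x. x \<in> carrier F \<Longrightarrow> \<exists>y\<in>carrier N. g y = f x"
    and "\<And>a x. x \<in> A a \<Longrightarrow> \<exists>y\<in>B a. g y = f x"
  obtains h where "h \<in> ghom R F A N B" "\<And>x. x \<in> carrier F \<Longrightarrow> g (h x) = f x"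
proof -
  have "f ` carrier F \<subseteq> g ` carrier N" "\<forall>a. f ` A a \<subseteq> g ` B a"
    using assms(5,6) by (force simp: image_iff)+
  then have "\<exists>h\<in>ghom R F A N B. \<forall>x\<in>carrier F. g (h x) = f x"
    using assms(1)[unfolded gproj_def, rule_format, of N' f g] assms(2-4) by blast
  then show ?thesis using that by blast
qed

lemma projective_imp_gproj:
  fixes F N :: "('a, 'b) module"
  assumes "projective_module R F" and N: "Module.module R N"
  shows "gproj R F (\<lambda>_. carrier F) N (\<lambda>_. carrier N)"
  unfolding gproj_def
proof (intro allI impI, elim conjE)
  fix N' :: "('a, 'b) module" and f g
  assume N': "Module.module R N'" and f: "f \<in> mod_hom R F N'" and g: "g \<in> mod_hom R N N'"
    and sub: "f ` carrier F \<subseteq> g ` carrier N"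
  let ?N' = "N'\<lparr>carrier := g ` carrier N\<rparr>"
  have "Module.module R ?N'" by (rule image_module) fact+
  moreover have "g \<in> mod_hom R N ?N'" "f \<in> mod_hom R F ?N'"
    using f g sub unfolding mod_hom_def by auto
  moreover have "g ` carrier N = carrier ?N'" by simp
  ultimately have "\<exists>h\<in>mod_hom R F N. \<forall>x\<in>carrier F. g (h x) = f x"
    using assms(1)[unfolded projective_module_def, THEN conjunct2, rule_format, of N ?N' g f] N
    by blast
  then show "\<exists>h\<in>ghom R F (\<lambda>_. carrier F) N (\<lambda>_. carrier N). \<forall>x\<in>carrier F. g (h x) = f x"
    unfolding ghom_def mod_hom_def by auto
qed

text \<open>An augmented resolution, the resolved module being in position \<open>0\<close>.\<close>

locale gresolution =
  fixes R :: "'a ring" and C :: "nat \<Rightarrow> ('a, 'b) module" and A :: "nat \<Rightarrow> 'g \<Rightarrow> 'b set"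
    and \<delta> :: "nat \<Rightarrow> 'b \<Rightarrow> 'b"
  assumes modul: "Module.module R (C i)"
    and A_carrier: "A i a \<subseteq> carrier (C i)"
    and A_minus: "x \<in> A (Suc i) a \<Longrightarrow> y \<in> A (Suc i) a \<Longrightarrow> x \<ominus>\<^bsub>C (Suc i)\<^esub> y \<in> A (Suc i) a"
    and \<delta>_ghom: "\<delta> i \<in> ghom R (C (Suc i)) (A (Suc i)) (C i) (A i)"
    and \<delta>\<delta>: "x \<in> carrier (C (Suc (Suc i))) \<Longrightarrow> \<delta> i (\<delta> (Suc i) x) = \<zero>\<^bsub>C i\<^esub>"
    and surj: "x \<in> carrier (C 0) \<Longrightarrow> \<exists>y\<in>carrier (C 1). \<delta> 0 y = x"
    and gsurj: "x \<in> A 0 a \<Longrightarrow> \<exists>y\<in>A 1 a. \<delta> 0 y = x"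
    and exact: "x \<in> carrier (C (Suc i)) \<Longrightarrow> \<delta> i x = \<zero>\<^bsub>C i\<^esub> \<Longrightarrow>
      \<exists>y\<in>carrier (C (Suc (Suc i))). \<delta> (Suc i) y = x"
    and gexact: "x \<in> A (Suc i) a \<Longrightarrow> \<delta> i x = \<zero>\<^bsub>C i\<^esub> \<Longrightarrow> \<exists>y\<in>A (Suc (Suc i)) a. \<delta> (Suc i) y = x"
begin

lemmas \<delta>_hom = ghomD(1)[OF \<delta>_ghom]

text \<open>The values of \<open>f\<close> lie in the image of \<open>\<delta> i\<close>: for
  \<open>i = 0\<close> because the augmentation is onto, otherwise because \<open>f\<close> is
  killed by the preceding differential and the complex is exact. The guard
  \<open>i \<noteq> 0\<close> keeps the predecessor from degenerating to 0.\<close>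

lemma lift_exists:
  assumes F: "Module.module R F" and B: "\<And>a. B a \<subseteq> carrier F"
    and p: "gproj R F B (C (Suc i)) (A (Suc i))" and f: "f \<in> ghom R F B (C i) (A i)"
    and 0: "i \<noteq> 0 \<Longrightarrow> \<forall>x\<in>carrier F. \<delta> (i - 1) (f x) = \<zero>\<^bsub>C (i - 1)\<^esub>"
  obtains h where "h \<in> ghom R F B (C (Suc i)) (A (Suc i))" "\<And>x. x \<in> carrier F \<Longrightarrow> \<delta> i (h x) = f x"
proof -
  have 1: "\<exists>y\<in>carrier (C (Suc i)). \<delta> i y = f x" if x: "x \<in> carrier F" for x
  proof (cases i)
    case 0
    then show ?thesis using surj[of "f x"] mod_homD(1)[OF ghomD(1)[OF f] x] by auto
  next
    case (Suc j)
    then show ?thesis using exact[of "f x" j] 0 x mod_homD(1)[OF ghomD(1)[OF f] x] by auto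
  qed
  have 2: "\<exists>y\<in>A (Suc i) a. \<delta> i y = f x" if x: "x \<in> B a" for x a
  proof (cases i)
    case 0
    then show ?thesis using gsurj[of "f x"] ghomD(2)[OF f, of x a, OF x] by auto
  next
    case (Suc j)
    then show ?thesis using gexact[of "f x" j] 0 x ghomD(2)[OF f, of x a, OF x] B[of a] by auto
  qed
  show ?thesis
    by (rule gprojD[OF p modul ghomD(1)[OF f] \<delta>_hom 1 2]) (use that in auto)
qed

end

text \<open>The classical lifting of the identity of the resolved module, one position after the
  other. Both complexes carry that module in position 0, hence the equations there; only the source
  has to be projective relative to the target.\<close>

lemma comparison:
  fixes C C' :: "nat \<Rightarrow> ('a, 'b) module"
  assumes "gresolution R C A \<delta>" "gresolution R C' A' \<delta>'"
    and 0: "C 0 = C' 0" "A 0 = A' 0"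
    and p: "\<And>i. gproj R (C (Suc i)) (A (Suc i)) (C' (Suc i)) (A' (Suc i))"
  obtains \<alpha> where "\<alpha> 0 = (\<lambda>x. x)" "\<And>i. \<alpha> i \<in> ghom R (C i) (A i) (C' i) (A' i)"
    "\<And>i x. x \<in> carrier (C (Suc i)) \<Longrightarrow> \<delta>' i (\<alpha> (Suc i) x) = \<alpha> i (\<delta> i x)"
proof -
  interpret C: gresolution R C A \<delta> by fact
  interpret C': gresolution R C' A' \<delta>' by fact
  \<comment> \<open>Besides what is claimed of \<open>\<alpha> i\<close>, the invariant says that
    \<open>\<alpha> i\<close> followed by the differential kills boundaries; this is the condition
    under which the next lift exists.\<close>
  let ?P = "\<lambda>i \<alpha>. \<alpha> \<in> ghom R (C i) (A i) (C' i) (A' i) \<and> (i = 0 \<longrightarrow> \<alpha> = (\<lambda>x. x)) \<and>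
    (i \<noteq> 0 \<longrightarrow> (\<forall>x\<in>carrier (C (Suc i)). \<delta>' (i - 1) (\<alpha> (\<delta> i x)) = \<zero>\<^bsub>C' (i - 1)\<^esub>))"
  let ?Q = "\<lambda>i \<alpha> \<beta>. \<forall>x\<in>carrier (C (Suc i)). \<delta>' i (\<beta> x) = \<alpha> (\<delta> i x)"
  have base: "?P 0 (\<lambda>x. x)"
    using 0 by (auto simp: ghom_def mod_hom_id)
  have step: "\<exists>\<beta>. ?P (Suc i) \<beta> \<and> ?Q i \<alpha> \<beta>" if P: "?P i \<alpha>" for i \<alpha>
  proof -
    have f: "(\<lambda>x. \<alpha> (\<delta> i x)) \<in> ghom R (C (Suc i)) (A (Suc i)) (C' i) (A' i)"
      using ghom_comp[OF C.\<delta>_ghom] P by blast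
    obtain \<beta> where b: "\<beta> \<in> ghom R (C (Suc i)) (A (Suc i)) (C' (Suc i)) (A' (Suc i))"
      "\<And>x. x \<in> carrier (C (Suc i)) \<Longrightarrow> \<delta>' i (\<beta> x) = \<alpha> (\<delta> i x)"
      by (rule C'.lift_exists[OF C.modul C.A_carrier p f]) (use P that in auto)
    have "\<delta>' i (\<beta> (\<delta> (Suc i) x)) = \<zero>\<^bsub>C' i\<^esub>" if x: "x \<in> carrier (C (Suc (Suc i)))" for x
      using b(2)[OF mod_homD(1)[OF C.\<delta>_hom x]] C.\<delta>\<delta>[OF x]
        mod_hom_zero[OF ghomD(1) C.modul C'.modul] P by metis
    then show ?thesis using b by auto
  qed
  have "\<exists>\<alpha>. \<forall>i. ?P i (\<alpha> i) \<and> ?Q i (\<alpha> i) (\<alpha> (Suc i))"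
    by (rule dependent_nat_choice[of ?P ?Q, OF exI, OF base step])
  then obtain \<alpha> where "\<forall>i. ?P i (\<alpha> i) \<and> ?Q i (\<alpha> i) (\<alpha> (Suc i))"
    by (rule exE)
  then have "?P i (\<alpha> i)" "?Q i (\<alpha> i) (\<alpha> (Suc i))" for i
    by blast+
  then show ?thesis by (intro that[of \<alpha>]) auto
qed

lemma homotopy:
  fixes C :: "nat \<Rightarrow> ('a, 'b) module"
  assumes "gresolution R C A \<delta>"
    and p: "\<And>i. gproj R (C (Suc i)) (A (Suc i)) (C (Suc (Suc i))) (A (Suc (Suc i)))"
    and \<alpha>0: "\<And>x. x \<in> carrier (C 0) \<Longrightarrow> \<alpha> 0 x = x" and \<alpha>: "\<And>i. \<alpha> i \<in> ghom R (C i) (A i) (C i) (A i)"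
    and \<alpha>\<delta>: "\<And>i x. x \<in> carrier (C (Suc i)) \<Longrightarrow> \<delta> i (\<alpha> (Suc i) x) = \<alpha> i (\<delta> i x)"
  obtains h where "h 0 = (\<lambda>x. \<zero>\<^bsub>C 1\<^esub>)"
    "\<And>i. h i \<in> mod_hom R (C i) (C (Suc i))"
    "\<And>i x a. x \<in> A (Suc i) a \<Longrightarrow> h (Suc i) x \<in> A (Suc (Suc i)) a"
    "\<And>i x. x \<in> carrier (C (Suc i)) \<Longrightarrow>
       \<delta> (Suc i) (h (Suc i) x) = x \<ominus>\<^bsub>C (Suc i)\<^esub> \<alpha> (Suc i) x \<ominus>\<^bsub>C (Suc i)\<^esub> h i (\<delta> i x)"
proof -
  interpret C: gresolution R C A \<delta> by fact
  let ?f = "\<lambda>i h x. x \<ominus>\<^bsub>C (Suc i)\<^esub> \<alpha> (Suc i) x \<ominus>\<^bsub>C (Suc i)\<^esub> h (\<delta> i x)"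
  \<comment> \<open>The last clause makes \<open>?f\<close> land in the kernel of
    \<open>\<delta> i\<close>, as the next lift requires. It is stated on the image of
    \<open>\<delta> i\<close> only; there it holds at the start with \<open>h = 0\<close>, because
    \<open>\<alpha> 0\<close> is the identity.\<close>
  let ?P = "\<lambda>i h. h \<in> mod_hom R (C i) (C (Suc i)) \<and> (i = 0 \<longrightarrow> h = (\<lambda>x. \<zero>\<^bsub>C 1\<^esub>)) \<and>
    (\<forall>a. \<forall>x\<in>A (Suc i) a. h (\<delta> i x) \<in> A (Suc i) a) \<and>
    (i \<noteq> 0 \<longrightarrow> (\<forall>a. \<forall>x\<in>A i a. h x \<in> A (Suc i) a)) \<and>
    (\<forall>x\<in>carrier (C (Suc i)). \<delta> i (h (\<delta> i x)) = \<delta> i x \<ominus>\<^bsub>C i\<^esub> \<alpha> i (\<delta> i x))"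
  let ?Q = "\<lambda>i h h'. \<forall>x\<in>carrier (C (Suc i)). \<delta> (Suc i) (h' x) = ?f i h x"
  have base: "?P 0 (\<lambda>x. \<zero>\<^bsub>C 1\<^esub>)"
  proof -
    interpret C0: Module.module R "C 0" by (rule C.modul)
    interpret C1: Module.module R "C (Suc 0)" by (rule C.modul)
    have 1: "(\<lambda>x. \<zero>\<^bsub>C 1\<^esub>) \<in> mod_hom R (C 0) (C (Suc 0))" by (rule mod_homI) auto
    \<comment> \<open>Components are arbitrary sets and possibly empty, so zero is known to be in
      one only as a difference \<open>x - x\<close> of a given member.\<close>
    have 2: "\<zero>\<^bsub>C (Suc 0)\<^esub> \<in> A (Suc 0) a" if "x \<in> A (Suc 0) a" for x a
      using C.A_minus[OF that that] C.A_carrier[of "Suc 0" a] that by (metis C1.minus_self subsetD)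
    have 3: "\<delta> 0 \<zero>\<^bsub>C 1\<^esub> = \<delta> 0 x \<ominus>\<^bsub>C 0\<^esub> \<alpha> 0 (\<delta> 0 x)" if "x \<in> carrier (C (Suc 0))" for x
      using mod_homD(1)[OF C.\<delta>_hom that] \<alpha>0 mod_hom_zero[OF C.\<delta>_hom[of 0] C.modul C.modul]
      by simp
    show ?thesis using 1 2 3 by auto
  qed
  have step: "\<exists>h'. ?P (Suc i) h' \<and> ?Q i h h'" if P: "?P i h" for i h
  proof -
    interpret M: Module.module R "C (Suc i)" by (rule C.modul)
    interpret M0: Module.module R "C i" by (rule C.modul)
    interpret M2: Module.module R "C (Suc (Suc i))" by (rule C.modul)
    have hh: "h \<in> mod_hom R (C i) (C (Suc i))" using P by blast
    note clos = mod_homD(1)[OF C.\<delta>_hom[of i]] mod_homD(1)[OF ghomD(1)[OF \<alpha>[of "Suc i"]]]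
      mod_homD(1)[OF ghomD(1)[OF \<alpha>[of i]]] mod_homD(1)[OF hh]
    have f: "?f i h \<in> mod_hom R (C (Suc i)) (C (Suc i))"
      by (intro mod_hom_diff mod_hom_id C.modul ghomD(1)[OF \<alpha>] mod_hom_comp[OF C.\<delta>_hom hh])
    have g: "?f i h \<in> ghom R (C (Suc i)) (A (Suc i)) (C (Suc i)) (A (Suc i))"
      unfolding ghom_def using f P ghomD(2)[OF \<alpha>] by (auto intro!: C.A_minus)
    have z: "\<delta> i (?f i h x) = \<zero>\<^bsub>C i\<^esub>" if x: "x \<in> carrier (C (Suc i))" for x
    proof -
      have "\<delta> i (?f i h x) = (\<delta> i x \<ominus>\<^bsub>C i\<^esub> \<delta> i (\<alpha> (Suc i) x)) \<ominus>\<^bsub>C i\<^esub> \<delta> i (h (\<delta> i x))"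
        using x clos by (simp add: mod_hom_minus[OF C.\<delta>_hom[of i] C.modul C.modul])
      also have "\<dots> = \<zero>\<^bsub>C i\<^esub>"
        using \<alpha>\<delta>[OF x] P x clos by simp
      finally show ?thesis .
    qed
    obtain h' where h': "h' \<in> ghom R (C (Suc i)) (A (Suc i)) (C (Suc (Suc i))) (A (Suc (Suc i)))"
      "\<And>x. x \<in> carrier (C (Suc i)) \<Longrightarrow> \<delta> (Suc i) (h' x) = ?f i h x"
      by (rule C.lift_exists[OF C.modul C.A_carrier p g]) (use z that in auto)
    have "\<delta> (Suc i) (h' (\<delta> (Suc i) x)) = \<delta> (Suc i) x \<ominus>\<^bsub>C (Suc i)\<^esub> \<alpha> (Suc i) (\<delta> (Suc i) x)"
      if x: "x \<in> carrier (C (Suc (Suc i)))" for x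
      using h'(2)[OF mod_homD(1)[OF C.\<delta>_hom x]] C.\<delta>\<delta>[OF x] mod_hom_zero[OF hh C.modul C.modul]
        mod_homD(1)[OF C.\<delta>_hom x] clos(2)[OF mod_homD(1)[OF C.\<delta>_hom x]]
      by (simp add: a_minus_def)
    moreover have "h' (\<delta> (Suc i) x) \<in> A (Suc (Suc i)) a" if "x \<in> A (Suc (Suc i)) a" for x a
      using ghomD(2)[OF h'(1)] ghomD(2)[OF C.\<delta>_ghom] that by blast
    ultimately show ?thesis using h' ghomD[OF h'(1)] by auto
  qed
  have "\<exists>h. \<forall>i. ?P i (h i) \<and> ?Q i (h i) (h (Suc i))"
    by (rule dependent_nat_choice[of ?P ?Q, OF exI, OF base step])
  then obtain h where "\<forall>i. ?P i (h i) \<and> ?Q i (h i) (h (Suc i))"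
    by (rule exE)
  then have h: "?P i (h i)" "?Q i (h i) (h (Suc i))" for i
    by simp_all
  show ?thesis
  proof (rule that[of h])
    show "h 0 = (\<lambda>x. \<zero>\<^bsub>C 1\<^esub>)" "h i \<in> mod_hom R (C i) (C (Suc i))" for i using h(1) by blast+
    show "\<And>i x a. x \<in> A (Suc i) a \<Longrightarrow> h (Suc i) x \<in> A (Suc (Suc i)) a"
      using h(1) by (metis nat.distinct(1))
  qed (use h(2) in blast)
qed

section \<open>Free modules\<close>

definition unit_vec :: "'a ring \<Rightarrow> nat \<Rightarrow> nat \<Rightarrow> 'a" where
  "unit_vec R k = (\<lambda>j. if j = k then \<one>\<^bsub>R\<^esub> else \<zero>\<^bsub>R\<^esub>)"

context
  fixes R :: "'a ring" (structure)
  assumes R: "cring R"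
begin

interpretation cring R by (rule R)

lemma unit_vec_closed: "k < r \<Longrightarrow> unit_vec R k \<in> carrier (free_module R r)"
  by (auto simp: free_module_def unit_vec_def)

lemma mod_hom_free_expand:
  assumes N: "Module.module R N" and f: "f \<in> mod_hom R (free_module R r) N"
    and x: "x \<in> carrier (free_module R r)"
  shows "f x = (\<Oplus>\<^bsub>N\<^esub>k\<in>{..<r}. x k \<odot>\<^bsub>N\<^esub> f (unit_vec R k))"
proof -
  interpret N: Module.module R N by fact
  have F: "Module.module R (free_module R r)" by (rule free_module_module) (rule is_cring)
  have xk: "x k \<in> carrier R" for k
    using x by (cases "k < r") (auto simp: free_module_def)
  have "f (\<lambda>k. if k < m then x k else \<zero>) = (\<Oplus>\<^bsub>N\<^esub>k\<in>{..<m}. x k \<odot>\<^bsub>N\<^esub> f (unit_vec R k))" if "m \<le> r" for m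
    using that
  proof (induction m)
    case 0
    then show ?case using mod_hom_zero[OF f F N] by (simp add: free_module_def)
  next
    case (Suc m)
    let ?t = "\<lambda>k. if k < m then x k else \<zero>"
    have 1: "?t \<in> carrier (free_module R r)" "unit_vec R m \<in> carrier (free_module R r)"
      "x m \<odot>\<^bsub>free_module R r\<^esub> unit_vec R m \<in> carrier (free_module R r)"
      using Suc.prems xk by (auto simp: free_module_def unit_vec_def)
    have "(\<lambda>k. if k < Suc m then x k else \<zero>) =
        x m \<odot>\<^bsub>free_module R r\<^esub> unit_vec R m \<oplus>\<^bsub>free_module R r\<^esub> ?t"
      using xk by (auto simp: free_module_def unit_vec_def fun_eq_iff less_Suc_eq)
    then have "f (\<lambda>k. if k < Suc m then x k else \<zero>) =
        x m \<odot>\<^bsub>N\<^esub> f (unit_vec R m) \<oplus>\<^bsub>N\<^esub> (\<Oplus>\<^bsub>N\<^esub>k\<in>{..<m}. x k \<odot>\<^bsub>N\<^esub> f (unit_vec R k))"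
      using mod_homD(2,3)[OF f] 1 xk Suc by simp
    also have "\<dots> = (\<Oplus>\<^bsub>N\<^esub>k\<in>insert m {..<m}. x k \<odot>\<^bsub>N\<^esub> f (unit_vec R k))"
      using mod_homD(1)[OF f] unit_vec_closed[of _ r] xk Suc.prems
      by (subst N.finsum_insert) auto
    finally show ?case by (simp add: lessThan_Suc)
  qed
  moreover have "(\<lambda>k. if k < r then x k else \<zero>) = x"
    using x by (auto simp: free_module_def)
  ultimately show ?thesis using order_refl[of r] by metis
qed

lemma free_hom:
  assumes N: "Module.module R N" and y: "\<And>k. k < r \<Longrightarrow> y k \<in> carrier N"
  shows "(\<lambda>x. \<Oplus>\<^bsub>N\<^esub>k\<in>{..<r}. x k \<odot>\<^bsub>N\<^esub> y k) \<in> mod_hom R (free_module R r) N"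
proof -
  interpret N: Module.module R N by fact
  show ?thesis
  proof (rule mod_homI)
    fix x assume x: "x \<in> carrier (free_module R r)"
    then have xk: "x k \<in> carrier R" if "k < r" for k using that by (auto simp: free_module_def)
    show "(\<Oplus>\<^bsub>N\<^esub>k\<in>{..<r}. x k \<odot>\<^bsub>N\<^esub> y k) \<in> carrier N"
      using xk y by (intro N.finsum_closed) auto
    { fix x' assume x': "x' \<in> carrier (free_module R r)"
      then have xk': "x' k \<in> carrier R" if "k < r" for k using that by (auto simp: free_module_def)
      have "(\<Oplus>\<^bsub>N\<^esub>k\<in>{..<r}. (x \<oplus>\<^bsub>free_module R r\<^esub> x') k \<odot>\<^bsub>N\<^esub> y k) =
            (\<Oplus>\<^bsub>N\<^esub>k\<in>{..<r}. x k \<odot>\<^bsub>N\<^esub> y k \<oplus>\<^bsub>N\<^esub> x' k \<odot>\<^bsub>N\<^esub> y k)"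
        using xk xk' y by (intro N.finsum_cong') (auto simp: free_module_def N.smult_l_distr)
      also have "\<dots> = (\<Oplus>\<^bsub>N\<^esub>k\<in>{..<r}. x k \<odot>\<^bsub>N\<^esub> y k) \<oplus>\<^bsub>N\<^esub> (\<Oplus>\<^bsub>N\<^esub>k\<in>{..<r}. x' k \<odot>\<^bsub>N\<^esub> y k)"
        using xk xk' y by (intro N.finsum_addf) auto
      finally show "(\<Oplus>\<^bsub>N\<^esub>k\<in>{..<r}. (x \<oplus>\<^bsub>free_module R r\<^esub> x') k \<odot>\<^bsub>N\<^esub> y k) =
        (\<Oplus>\<^bsub>N\<^esub>k\<in>{..<r}. x k \<odot>\<^bsub>N\<^esub> y k) \<oplus>\<^bsub>N\<^esub> (\<Oplus>\<^bsub>N\<^esub>k\<in>{..<r}. x' k \<odot>\<^bsub>N\<^esub> y k)" . }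
    { fix a assume a: "a \<in> carrier R"
      show "(\<Oplus>\<^bsub>N\<^esub>k\<in>{..<r}. (a \<odot>\<^bsub>free_module R r\<^esub> x) k \<odot>\<^bsub>N\<^esub> y k) =
        a \<odot>\<^bsub>N\<^esub> (\<Oplus>\<^bsub>N\<^esub>k\<in>{..<r}. x k \<odot>\<^bsub>N\<^esub> y k)"
        using xk y a
        by (subst N.finsum_smult_ldistr)
          (auto simp: free_module_def N.smult_assoc1 intro!: N.finsum_cong') }
  qed
qed

lemma free_lift:
  assumes N: "Module.module R N" and N': "Module.module R N'"
    and g: "g \<in> mod_hom R N N'" and f: "f \<in> mod_hom R (free_module R r) N'"
    and y: "\<And>k. k < r \<Longrightarrow> y k \<in> carrier N" "\<And>k. k < r \<Longrightarrow> g (y k) = f (unit_vec R k)"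
    and x: "x \<in> carrier (free_module R r)"
  shows "g (\<Oplus>\<^bsub>N\<^esub>k\<in>{..<r}. x k \<odot>\<^bsub>N\<^esub> y k) = f x"
proof -
  interpret N: Module.module R N by fact
  interpret N': Module.module R N' by fact
  let ?h = "\<lambda>x. \<Oplus>\<^bsub>N\<^esub>k\<in>{..<r}. x k \<odot>\<^bsub>N\<^esub> y k"
  have h: "?h \<in> mod_hom R (free_module R r) N" by (rule free_hom[OF N y(1)])
  have hu: "?h (unit_vec R j) = y j" if j: "j < r" for j
  proof -
    have "?h (unit_vec R j) = (\<Oplus>\<^bsub>N\<^esub>k\<in>{..<r}. if j = k then y k else \<zero>\<^bsub>N\<^esub>)"
      using y j by (intro N.finsum_cong') (auto simp: unit_vec_def)
    also have "\<dots> = y j"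
      using y j by (intro N.finsum_singleton) auto
    finally show ?thesis .
  qed
  have gh: "(\<lambda>x. g (?h x)) \<in> mod_hom R (free_module R r) N'" by (rule mod_hom_comp[OF h g])
  have "g (?h x) = (\<Oplus>\<^bsub>N'\<^esub>k\<in>{..<r}. x k \<odot>\<^bsub>N'\<^esub> g (?h (unit_vec R k)))"
    by (rule mod_hom_free_expand[OF N' gh x])
  also have "\<dots> = (\<Oplus>\<^bsub>N'\<^esub>k\<in>{..<r}. x k \<odot>\<^bsub>N'\<^esub> f (unit_vec R k))"
    using hu y x mod_homD(1)[OF f unit_vec_closed]
    by (intro N'.finsum_cong') (auto simp: free_module_def)
  also have "\<dots> = f x" by (rule mod_hom_free_expand[OF N' f x, symmetric])
  finally show ?thesis .
qed

end

lemma free_gproj: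
  fixes N :: "('a, nat \<Rightarrow> 'a) module"
  assumes R: "cring R" and N: "Module.module R N" and A: "\<And>a. A a \<subseteq> carrier (free_module R r)"
  shows "gproj R (free_module R r) A N (\<lambda>_. carrier N)"
  unfolding gproj_def
proof (intro allI impI, elim conjE)
  fix N' :: "('a, nat \<Rightarrow> 'a) module" and f g
  assume N': "Module.module R N'" and f: "f \<in> mod_hom R (free_module R r) N'"
    and g: "g \<in> mod_hom R N N'"
    and sub: "f ` carrier (free_module R r) \<subseteq> g ` carrier N"
  have "\<forall>k. \<exists>y. k < r \<longrightarrow> y \<in> carrier N \<and> g y = f (unit_vec R k)"
    using sub unit_vec_closed[OF R] by (metis (no_types, lifting) image_iff subsetD)
  then obtain y where y: "\<And>k. k < r \<Longrightarrow> y k \<in> carrier N" "\<And>k. k < r \<Longrightarrow> g (y k) = f (unit_vec R k)"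
    by metis
  let ?h = "\<lambda>x. \<Oplus>\<^bsub>N\<^esub>k\<in>{..<r}. x k \<odot>\<^bsub>N\<^esub> y k"
  have h: "?h \<in> mod_hom R (free_module R r) N" by (rule free_hom[OF R N y(1)])
  then have "?h \<in> ghom R (free_module R r) A N (\<lambda>_. carrier N)"
    using A mod_homD(1)[OF h] unfolding ghom_def by blast
  then show "\<exists>h\<in>ghom R (free_module R r) A N (\<lambda>_. carrier N). \<forall>x\<in>carrier (free_module R r). g (h x) = f x"
    using free_lift[OF R N N' g f, of y, OF y]
    by (intro bexI[of _ ?h] ballI) simp_all
qed

lemma projective_free_module: "cring R \<Longrightarrow> projective_module R (free_module R r)"
  unfolding projective_module_def
proof (intro conjI allI impI, goal_cases)
  case 1
  then show ?case by (rule free_module_module)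
next
  case (2 N N' g f)
  then have p: "gproj R (free_module R r) (\<lambda>_::nat. carrier (free_module R r)) N (\<lambda>_. carrier N)"
    by (intro free_gproj) auto
  have N': "Module.module R N'" and g: "g \<in> mod_hom R N N'" and f: "f \<in> mod_hom R (free_module R r) N'"
    and im: "g ` carrier N = carrier N'"
    using 2 by blast+
  have ex: "\<exists>y\<in>carrier N. g y = f x" if "x \<in> carrier (free_module R r)" for x
    using mod_homD(1)[OF f that] im by (metis imageE)
  obtain h where "h \<in> ghom R (free_module R r) (\<lambda>_::nat. carrier (free_module R r)) N (\<lambda>_. carrier N)"
    "\<And>x. x \<in> carrier (free_module R r) \<Longrightarrow> g (h x) = f x"
    by (rule gprojD[OF p N' f g ex ex]) blast+
  then show ?case using ghomD(1)[of h] by (intro bexI[of _ h]) simp_all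
qed

section \<open>Multigraded free modules\<close>

abbreviation "lookup \<equiv> Poly_Mapping.lookup"
abbreviation "single \<equiv> Poly_Mapping.single"
abbreviation "keys \<equiv> Poly_Mapping.keys"

lemma mpoly_ring_simps [simp]:
  "f \<oplus>\<^bsub>mpoly_ring X\<^esub> g = f + g" "f \<otimes>\<^bsub>mpoly_ring X\<^esub> g = f * g"
  "\<zero>\<^bsub>mpoly_ring X\<^esub> = 0" "\<one>\<^bsub>mpoly_ring X\<^esub> = 1"
  by (simp_all add: mpoly_ring_def)

lemma mpoly_ring_carrier: "f \<in> carrier (mpoly_ring X) \<longleftrightarrow> (\<forall>m. lookup f m \<noteq> 0 \<longrightarrow> m \<in> multidegs X)"
  by (auto simp: mpoly_ring_def in_keys_iff)

lemma mpoly_ring_a_inv: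
  assumes "f \<in> carrier (mpoly_ring X)" shows "\<ominus>\<^bsub>mpoly_ring X\<^esub> f = - f"
proof -
  interpret cring "mpoly_ring X :: ('a, 'b) mpoly ring" by (rule mpoly_ring_cring)
  have "- f \<in> carrier (mpoly_ring X)" using assms by (auto simp: mpoly_ring_carrier)
  then show ?thesis using assms by (intro minus_equality) auto
qed

lemma shifted_module: "Module.module (mpoly_ring X) (shifted_free X D)"
  by (rule free_module_module[OF mpoly_ring_cring])

lemma shifted_free_simps [simp]:
  "f \<oplus>\<^bsub>shifted_free X D\<^esub> g = f + g" "\<zero>\<^bsub>shifted_free X D\<^esub> = 0"
  "p \<odot>\<^bsub>shifted_free X D\<^esub> f = (\<lambda>k. p * f k)"
  by (simp_all add: free_module_def fun_eq_iff)

lemma shifted_free_carrier: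
  "f \<in> carrier (shifted_free X D) \<longleftrightarrow>
     (\<forall>k<length D. \<forall>m. lookup (f k) m \<noteq> 0 \<longrightarrow> m \<in> multidegs X) \<and> (\<forall>k\<ge>length D. f k = 0)"
  by (auto simp: free_module_def mpoly_ring_carrier)

lemma shifted_iff:
  "f \<in> shifted_free_component X D a \<longleftrightarrow>
     f \<in> carrier (shifted_free X D) \<and> (\<forall>k<length D. \<forall>m. lookup (f k) m \<noteq> 0 \<longrightarrow> m + D ! k = a)"
  by (auto simp: shifted_free_component_def in_keys_iff)

lemma shifted_free_minus:
  assumes "f \<in> carrier (shifted_free X D)" "g \<in> carrier (shifted_free X D)"
  shows "f \<ominus>\<^bsub>shifted_free X D\<^esub> g = f - g"
proof -
  interpret Module.module "mpoly_ring X" "shifted_free X D" by (rule shifted_module)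
  have "- g \<in> carrier (shifted_free X D)" using assms by (auto simp: shifted_free_carrier)
  then have "\<ominus>\<^bsub>shifted_free X D\<^esub> g = - g" using assms by (intro M.minus_equality) auto
  then show ?thesis by (simp add: a_minus_def)
qed

lemma shifted_add:
  "f \<in> shifted_free_component X D a \<Longrightarrow> g \<in> shifted_free_component X D a \<Longrightarrow>
   f + g \<in> shifted_free_component X D a"
  by (auto simp: shifted_iff shifted_free_carrier lookup_add)
    (metis add.right_neutral)+

lemma shifted_diff:
  "f \<in> shifted_free_component X D a \<Longrightarrow> g \<in> shifted_free_component X D a \<Longrightarrow>
   f - g \<in> shifted_free_component X D a"
  by (auto simp: shifted_iff shifted_free_carrier lookup_minus)
    (metis diff_zero)+

lemma shifted_zero: "0 \<in> shifted_free_component X D a"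
  by (auto simp: shifted_iff shifted_free_carrier)

lemma shifted_carrier: "shifted_free_component X D a \<subseteq> carrier (shifted_free X D)"
  by (auto simp: shifted_iff)

lemma shifted_free_finsum:
  assumes "finite I" "\<And>i. i \<in> I \<Longrightarrow> f i \<in> carrier (shifted_free X D)"
  shows "finsum (shifted_free X D) f I = sum f I"
proof -
  interpret Module.module "mpoly_ring X" "shifted_free X D" by (rule shifted_module)
  show ?thesis using assms by (induction I rule: finite_induct) auto
qed

lemma shifted_free_sum_closed:
  assumes "\<And>i. i \<in> I \<Longrightarrow> f i \<in> shifted_free_component X D a"
  shows "sum f I \<in> shifted_free_component X D a"
  using assms
  by (induction I rule: infinite_finite_induct)
    (auto simp: shifted_zero shifted_add)

lemma lookup_nonzero_mult:
  fixes f g :: "'a::monoid_add \<Rightarrow>\<^sub>0 'b::semiring_0"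
  assumes "lookup (f * g) m \<noteq> 0"
  obtains a b where "m = a + b" "lookup f a \<noteq> 0" "lookup g b \<noteq> 0"
proof -
  have "m \<in> keys (f * g)" using assms by (simp add: in_keys_iff)
  then show ?thesis using Poly_Mapping.keys_mult[of f g] that
    by (auto simp: in_keys_iff)
qed

lemma shifted_mult:
  assumes f: "f \<in> shifted_free_component X D a" and p: "p \<in> carrier (mpoly_ring X)"
    and "\<And>m. lookup p m \<noteq> 0 \<Longrightarrow> m + a = b"
  shows "(\<lambda>k. p * f k) \<in> shifted_free_component X D b"
proof -
  interpret Module.module "mpoly_ring X" "shifted_free X D" by (rule shifted_module)
  have "p \<odot>\<^bsub>shifted_free X D\<^esub> f \<in> carrier (shifted_free X D)"
    using f p by (intro smult_closed) (auto simp: shifted_iff)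
  moreover have "m + D ! k = b" if "k < length D" "lookup (p * f k) m \<noteq> 0" for k m
    using that(2)
  proof (rule lookup_nonzero_mult)
    fix c c' assume c: "m = c + c'" "lookup p c \<noteq> 0" "lookup (f k) c' \<noteq> 0"
    have "c' + D ! k = a" using f that(1) c(3) by (auto simp: shifted_iff)
    then show "m + D ! k = b" using assms(3)[OF c(2)] c(1) by (simp add: add.assoc)
  qed
  ultimately show ?thesis by (auto simp: shifted_iff)
qed

text \<open>The basis vector \<open>k\<close> is homogeneous of degree \<open>D ! k\<close>, so its
  image has a preimage \<open>y k\<close> of that degree. In an element of degree \<open>a\<close>
  its coefficient has only exponents \<open>m\<close> with \<open>m + D ! k = a\<close>, hence the
  lift defined by \<open>y\<close> preserves degrees.\<close>

lemma shifted_free_gproj: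
  "gproj (mpoly_ring X :: ('v, 'k::field) mpoly ring) (shifted_free X D) (shifted_free_component X D)
     (shifted_free X D') (shifted_free_component X D')"
  unfolding gproj_def
proof (intro allI impI, elim conjE)
  let ?R = "mpoly_ring X :: ('v, 'k) mpoly ring"
  let ?N = "free_module ?R (length D')"
  fix N' :: "(('v, 'k) mpoly, nat \<Rightarrow> ('v, 'k) mpoly) module" and f g
  assume N': "Module.module ?R N'" and f: "f \<in> mod_hom ?R (shifted_free X D) N'"
    and g: "g \<in> mod_hom ?R (shifted_free X D') N'"
    and sub: "\<forall>a. f ` shifted_free_component X D a \<subseteq> g ` shifted_free_component X D' a"
  have "unit_vec ?R k \<in> shifted_free_component X D (D ! k)" if "k < length D" for k
    using unit_vec_closed[OF mpoly_ring_cring that]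
    by (auto simp: shifted_iff unit_vec_def lookup_one when_def split: if_splits)
  then have "f (unit_vec ?R k) \<in> g ` shifted_free_component X D' (D ! k)" if "k < length D" for k
    using sub that by blast
  then have "\<forall>k. \<exists>y. k < length D \<longrightarrow> y \<in> shifted_free_component X D' (D ! k) \<and> g y = f (unit_vec ?R k)"
    by (metis imageE)
  then obtain y where y: "\<And>k. k < length D \<Longrightarrow> y k \<in> shifted_free_component X D' (D ! k)"
    "\<And>k. k < length D \<Longrightarrow> g (y k) = f (unit_vec ?R k)"
    by metis
  then have y': "y k \<in> carrier ?N" if "k < length D" for k
    using that shifted_carrier by blast
  let ?h = "\<lambda>x. \<Oplus>\<^bsub>?N\<^esub>k\<in>{..<length D}. x k \<odot>\<^bsub>?N\<^esub> y k"
  interpret N: Module.module ?R ?N by (rule shifted_module)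
  have h: "?h \<in> mod_hom ?R (shifted_free X D) ?N" by (rule free_hom[OF mpoly_ring_cring shifted_module y'])
  have "?h x \<in> shifted_free_component X D' a" if x: "x \<in> shifted_free_component X D a" for x a
  proof -
    have 1: "x k \<odot>\<^bsub>?N\<^esub> y k \<in> shifted_free_component X D' a" if k: "k < length D" for k
      unfolding shifted_free_simps
      by (rule shifted_mult[OF y(1)[OF k]])
        (use x k in \<open>auto simp: shifted_iff shifted_free_carrier mpoly_ring_carrier\<close>)
    then have "?h x = (\<Sum>k\<in>{..<length D}. x k \<odot>\<^bsub>?N\<^esub> y k)"
      using shifted_carrier by (intro shifted_free_finsum) blast+
    then show ?thesis using 1 shifted_free_sum_closed by (metis (no_types, lifting) lessThan_iff)
  qed
  then have "?h \<in> ghom ?R (shifted_free X D) (shifted_free_component X D) ?N (shifted_free_component X D')"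
    unfolding ghom_def using h by blast
  then show "\<exists>h\<in>ghom ?R (shifted_free X D) (shifted_free_component X D) ?N (shifted_free_component X D').
      \<forall>x\<in>carrier (shifted_free X D). g (h x) = f x"
    using free_lift[OF mpoly_ring_cring shifted_module N' g f, of y, OF y' y(2)]
    by (intro bexI[of _ ?h] ballI) simp_all
qed

text \<open>The composite of \<open>\<alpha>\<close> with the projection of \<open>Z'\<close> onto
  the quotient by \<open>B'\<close> has its kernel inside \<open>B\<close>, so its rank is at least
  \<open>dim Z - dim B\<close>; it is at most \<open>dim Z' - dim B'\<close>. The proof replaces
  quotients by bases: the vectors that extend a basis of \<open>B\<close> to one of \<open>Z\<close>
  stay independent over \<open>B'\<close> after applying \<open>\<alpha>\<close>.\<close>

lemma (in vector_space) dim_diff_le: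
  assumes "finite W" "Z \<subseteq> span W" "finite W'" "Z' \<subseteq> span W'"
    and sub: "subspace B" "subspace Z" "subspace B'" "subspace Z'" and "B \<subseteq> Z" "B' \<subseteq> Z'"
    and \<alpha>_add: "\<And>z w. z \<in> Z \<Longrightarrow> w \<in> Z \<Longrightarrow> \<alpha> (z + w) = \<alpha> z + \<alpha> w"
    and \<alpha>_scale: "\<And>c z. z \<in> Z \<Longrightarrow> \<alpha> (scale c z) = scale c (\<alpha> z)"
    and \<alpha>_Z: "\<And>z. z \<in> Z \<Longrightarrow> \<alpha> z \<in> Z'" and inj: "\<And>z. z \<in> Z \<Longrightarrow> \<alpha> z \<in> B' \<Longrightarrow> z \<in> B"
  shows "dim Z - dim B \<le> dim Z' - dim B'"
proof -
  obtain b where b: "b \<subseteq> B" "independent b" "B \<subseteq> span b" by (rule maximal_independent_subset)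
  obtain bz where bz: "b \<subseteq> bz" "bz \<subseteq> Z" "independent bz" "Z \<subseteq> span bz"
    by (rule maximal_independent_subset_extend[OF subset_trans[OF b(1) \<open>B \<subseteq> Z\<close>] b(2)])
  obtain b' where b': "b' \<subseteq> B'" "independent b'" "B' \<subseteq> span b'" by (rule maximal_independent_subset)
  have spb: "span b = B" "span b' = B'"
    using span_subspace[OF b(1,3) sub(1)] span_subspace[OF b'(1,3) sub(3)] by simp_all
  have fin: "finite bz" "finite b'"
    using independent_span_bound[of W bz] independent_span_bound[of W' b'] assms bz b' by auto
  have \<alpha>_diff: "\<alpha> (z - w) = \<alpha> z - \<alpha> w" if "z \<in> Z" "w \<in> Z" for z w
    using \<alpha>_add[of "z - w" w] that subspace_diff[OF sub(2)] by (simp add: algebra_simps)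
  have \<alpha>_0: "\<alpha> 0 = 0" using \<alpha>_diff[of 0 0] subspace_0[OF sub(2)] by simp
  \<comment> \<open>The extending vectors are added one at a time. A relation between
    \<open>\<alpha> x\<close>, \<open>B'\<close> and the earlier images would put
    \<open>x - w\<close> into \<open>B\<close> for some \<open>w\<close> in the span of the earlier
    vectors.\<close>
  have *: "independent (b' \<union> \<alpha> ` t) \<and> card (b' \<union> \<alpha> ` t) = card b' + card t"
    if "finite t" "t \<subseteq> bz - b" for t
    using that
  proof (induction t rule: finite_induct)
    case empty
    then show ?case using b' by simp
  next
    case (insert x t)
    have tZ: "span t \<subseteq> Z" using insert.prems bz sub by (intro span_minimal) auto
    have x: "x \<notin> span (b \<union> t)"
    proof
      assume "x \<in> span (b \<union> t)"
      moreover have "b \<union> t \<subseteq> bz - {x}" using insert bz by auto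
      ultimately have "x \<in> span (bz - {x})" using span_mono by blast
      then show False using bz(3) insert.prems unfolding dependent_def by auto
    qed
    have "\<alpha> x \<notin> span (b' \<union> \<alpha> ` t)"
    proof
      assume "\<alpha> x \<in> span (b' \<union> \<alpha> ` t)"
      then obtain s u where su: "\<alpha> x = s + u" "s \<in> span b'" "u \<in> span (\<alpha> ` t)"
        unfolding span_Un by blast
      \<comment> \<open>\<open>\<alpha>\<close> is linear on \<open>Z\<close> only, so the span of
        the images is bounded by hand: the image of \<open>span t\<close> is a subspace that
        contains them.\<close>
      have "subspace (\<alpha> ` span t)"
      proof (rule subspaceI)
        show "0 \<in> \<alpha> ` span t" using \<alpha>_0 span_zero[of t] by (metis imageI)
        show "x + y \<in> \<alpha> ` span t" if xy: "x \<in> \<alpha> ` span t" "y \<in> \<alpha> ` span t" for x y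
        proof -
          obtain v w where "v \<in> span t" "w \<in> span t" "x = \<alpha> v" "y = \<alpha> w" using xy by auto
          then show ?thesis using \<alpha>_add[of v w] tZ span_add[of v t w] by (metis imageI subsetD)
        qed
        show "scale c x \<in> \<alpha> ` span t" if "x \<in> \<alpha> ` span t" for x c
          using that \<alpha>_scale tZ span_scale by (auto simp: image_iff) (metis subsetD)
      qed
      then have "span (\<alpha> ` t) \<subseteq> \<alpha> ` span t" by (intro span_minimal) (auto intro: span_base)
      then obtain w where w: "w \<in> span t" "u = \<alpha> w" using su by auto
      have xZ: "x \<in> Z" "w \<in> Z" using insert.prems bz tZ w by auto
      then have "\<alpha> (x - w) \<in> B'" using su w spb by (simp add: \<alpha>_diff)
      then have "x - w \<in> span b" using inj xZ subspace_diff[OF sub(2)] spb by blast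
      then have "x - w + w \<in> span (b \<union> t)"
        using w by (intro span_add) (auto intro: subsetD[OF span_mono, rotated])
      then show False using x by simp
    qed
    then have "independent (insert (\<alpha> x) (b' \<union> \<alpha> ` t))" "\<alpha> x \<notin> b' \<union> \<alpha> ` t"
      using insert.IH insert.prems span_base independent_insertI[of "\<alpha> x" "b' \<union> \<alpha> ` t"] by auto
    then show ?case using insert fin by auto
  qed
  let ?c = "bz - b"
  have c: "independent (b' \<union> \<alpha> ` ?c)" "card (b' \<union> \<alpha> ` ?c) = card b' + card ?c"
    using *[of ?c] fin by auto
  have "b' \<union> \<alpha> ` ?c \<subseteq> Z'" using b' assms bz by auto
  then obtain bz' where bz': "b' \<union> \<alpha> ` ?c \<subseteq> bz'" "bz' \<subseteq> Z'" "independent bz'" "Z' \<subseteq> span bz'"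
    by (rule maximal_independent_subset_extend[OF _ c(1)])
  have "finite bz'" using independent_span_bound[of W' bz'] assms bz' by auto
  then have "card b' + card ?c \<le> card bz'" using card_mono[OF _ bz'(1)] c by simp
  moreover have "card ?c = card bz - card b" using bz fin by (intro card_Diff_subset) (auto intro: finite_subset)
  moreover have "dim Z = card bz" "dim B = card b" "dim B' = card b'" "dim Z' = card bz'"
    using basis_card_eq_dim bz b b' bz' by metis+
  ultimately show ?thesis by linarith
qed

text \<open>\<open>I \<subseteq> carrier R\<close> puts the whole module among the submodules that
  are intersected, which keeps the intersection inside the carrier.\<close>

lemma submodule_ideal_smult:
  assumes M: "Module.module R M" and I: "I \<subseteq> carrier R"
  shows "submodule (ideal_smult R I M) R M"
proof -
  interpret M: Module.module R M by fact
  have "submodule (carrier M) R M" by (rule M.carrier_is_submodule)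
  then have c: "ideal_smult R I M \<subseteq> carrier M"
    unfolding ideal_smult_def using I by (intro Inter_lower) blast
  show ?thesis
  proof (rule M.submoduleI[OF c])
    show "\<zero>\<^bsub>M\<^esub> \<in> ideal_smult R I M"
      unfolding ideal_smult_def using subgroup.one_closed submodule.axioms(1) by fastforce
  qed (auto simp: ideal_smult_def intro: M.submoduleE)
qed

text \<open>The preimage of \<open>I N\<close> under \<open>f\<close> is a submodule of
  \<open>M\<close> containing all products of \<open>I\<close> with \<open>M\<close>, hence it
  contains \<open>I M\<close>.\<close>

lemma ideal_smult_hom:
  assumes M: "Module.module R M" and N: "Module.module R N" and f: "f \<in> mod_hom R M N"
    and I: "I \<subseteq> carrier R" and x: "x \<in> ideal_smult R I M"
  shows "f x \<in> ideal_smult R I N"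
proof -
  interpret M: Module.module R M by fact
  interpret N: Module.module R N by fact
  note S = N.submoduleE[OF submodule_ideal_smult[OF N I]]
  let ?K = "{x \<in> carrier M. f x \<in> ideal_smult R I N}"
  have 0: "f \<zero>\<^bsub>M\<^esub> \<in> ideal_smult R I N"
    using mod_hom_zero[OF f M N] subgroup.one_closed[OF submodule.axioms(1)[OF submodule_ideal_smult[OF N I]]]
    by simp
  have "submodule ?K R M"
  proof (rule M.submoduleI)
    show "\<ominus>\<^bsub>M\<^esub> a \<in> ?K" if "a \<in> ?K" for a
    proof -
      have "f (\<zero>\<^bsub>M\<^esub> \<ominus>\<^bsub>M\<^esub> a) = \<zero>\<^bsub>N\<^esub> \<ominus>\<^bsub>N\<^esub> f a"
        using mod_hom_minus[OF f M N M.zero_closed] that mod_hom_zero[OF f M N] by simp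
      then have "f (\<ominus>\<^bsub>M\<^esub> a) = \<ominus>\<^bsub>N\<^esub> f a"
        using that mod_homD(1)[OF f] by (simp add: a_minus_def)
      then show ?thesis using that S(3) by simp
    qed
  qed (use 0 S mod_homD[OF f] in auto)
  moreover have "a \<odot>\<^bsub>M\<^esub> y \<in> ?K" if "a \<in> I" "y \<in> carrier M" for a y
  proof -
    have "a \<odot>\<^bsub>N\<^esub> f y \<in> ideal_smult R I N"
      using that mod_homD(1)[OF f] unfolding ideal_smult_def by blast
    then show ?thesis using that I mod_homD(3)[OF f, of a y] by auto
  qed
  ultimately show ?thesis using x unfolding ideal_smult_def by blast
qed

subsection \<open>Resolutions in the comparison framework\<close>

text \<open>The framework keeps a whole augmented complex in one type, but the elements of the
  resolved module are cosets while those of the free modules are sequences. This is the copy of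
  \<open>M\<close> along an injection \<open>\<iota>\<close> with left inverse
  \<open>\<kappa>\<close>.\<close>

definition transport_module :: "('m \<Rightarrow> 'b) \<Rightarrow> ('b \<Rightarrow> 'm) \<Rightarrow> ('a, 'm) module \<Rightarrow> ('a, 'b) module" where
  "transport_module \<iota> \<kappa> M =
    \<lparr>carrier = \<iota> ` carrier M, monoid.mult = undefined, one = undefined, zero = \<iota> \<zero>\<^bsub>M\<^esub>,
     add = (\<lambda>x y. \<iota> (\<kappa> x \<oplus>\<^bsub>M\<^esub> \<kappa> y)), smult = (\<lambda>a x. \<iota> (a \<odot>\<^bsub>M\<^esub> \<kappa> x))\<rparr>"

lemma transport_module:
  assumes M: "Module.module R M" and \<kappa>: "\<And>x. x \<in> carrier M \<Longrightarrow> \<kappa> (\<iota> x) = x"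
  shows "Module.module R (transport_module \<iota> \<kappa> M)"
proof -
  interpret M: Module.module R M by fact
  have "abelian_group (transport_module \<iota> \<kappa> M)"
  proof (rule abelian_groupI)
    fix x assume "x \<in> carrier (transport_module \<iota> \<kappa> M)"
    then obtain y where y: "y \<in> carrier M" "x = \<iota> y" by (auto simp: transport_module_def)
    then show "\<exists>z\<in>carrier (transport_module \<iota> \<kappa> M).
        z \<oplus>\<^bsub>transport_module \<iota> \<kappa> M\<^esub> x = \<zero>\<^bsub>transport_module \<iota> \<kappa> M\<^esub>"
      by (intro bexI[of _ "\<iota> (\<ominus>\<^bsub>M\<^esub> y)"]) (auto simp: transport_module_def \<kappa> M.l_neg)
  qed (auto simp: transport_module_def \<kappa> M.a_ac)
  then show ?thesis
    by (intro moduleI M.is_cring)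
      (auto simp: transport_module_def \<kappa> M.smult_l_distr M.smult_r_distr M.smult_assoc1)
qed

lemma resolutionD:
  assumes "resolution R M F d e"
  shows "Module.module R (F i)" "e \<in> mod_hom R (F 0) M" "d i \<in> mod_hom R (F (Suc i)) (F i)"
    "e ` carrier (F 0) = carrier M" "d 0 ` carrier (F 1) = {x \<in> carrier (F 0). e x = \<zero>\<^bsub>M\<^esub>}"
    "d (Suc i) ` carrier (F (Suc (Suc i))) = {x \<in> carrier (F (Suc i)). d i x = \<zero>\<^bsub>F i\<^esub>}"
  using assms by (simp_all add: resolution_def)

text \<open>The module \<open>F i\<close> moves to position \<open>Suc i\<close>, the copy of
  \<open>M\<close> takes position 0, and the augmentation becomes the differential number 0.
  Exactness within the components is a hypothesis, since \<open>resolution\<close> speaks of whole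
  modules.\<close>

lemma resolution_gresolution:
  fixes F :: "nat \<Rightarrow> ('a, 'b) module"
  assumes M: "Module.module R M" and \<kappa>: "\<And>x. x \<in> carrier M \<Longrightarrow> \<kappa> (\<iota> x) = x"
    and res: "resolution R M F d e"
    and A: "\<And>i a. A i a \<subseteq> carrier (F i)"
    and A_minus: "\<And>i a x y. x \<in> A i a \<Longrightarrow> y \<in> A i a \<Longrightarrow> x \<ominus>\<^bsub>F i\<^esub> y \<in> A i a"
    and G: "\<And>a. G a \<subseteq> carrier M" and e: "\<And>a. e ` A 0 a = G a"
    and d: "\<And>i a. d i ` A (Suc i) a \<subseteq> A i a"
    and ge: "\<And>a x. x \<in> A 0 a \<Longrightarrow> e x = \<zero>\<^bsub>M\<^esub> \<Longrightarrow> \<exists>y\<in>A 1 a. d 0 y = x"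
    and gd: "\<And>i a x. x \<in> A (Suc i) a \<Longrightarrow> d i x = \<zero>\<^bsub>F i\<^esub> \<Longrightarrow> \<exists>y\<in>A (Suc (Suc i)) a. d (Suc i) y = x"
  shows "gresolution R (case_nat (transport_module \<iota> \<kappa> M) F) (case_nat (\<lambda>a. \<iota> ` G a) A)
    (case_nat (\<lambda>x. \<iota> (e x)) d)"
proof -
  let ?T = "transport_module \<iota> \<kappa> M"
  let ?C = "case_nat ?T F" and ?A = "case_nat (\<lambda>a. \<iota> ` G a) A" and ?\<delta> = "case_nat (\<lambda>x. \<iota> (e x)) d"
  interpret M: Module.module R M by fact
  have F: "Module.module R (F i)" and eh: "e \<in> mod_hom R (F 0) M"
    and dh: "d i \<in> mod_hom R (F (Suc i)) (F i)" and es: "e ` carrier (F 0) = carrier M"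
    and ex0: "d 0 ` carrier (F 1) = {x \<in> carrier (F 0). e x = \<zero>\<^bsub>M\<^esub>}"
    and ex: "d (Suc i) ` carrier (F (Suc (Suc i))) = {x \<in> carrier (F (Suc i)). d i x = \<zero>\<^bsub>F i\<^esub>}" for i
    using resolutionD[OF res] by blast+
  have ie: "(\<lambda>x. \<iota> (e x)) \<in> mod_hom R (F 0) ?T"
    by (rule mod_homI) (use mod_homD[OF eh] \<kappa> in \<open>auto simp: transport_module_def\<close>)
  have \<iota>0: "\<iota> x = \<iota> \<zero>\<^bsub>M\<^esub> \<longleftrightarrow> x = \<zero>\<^bsub>M\<^esub>" if "x \<in> carrier M" for x
    using \<kappa> that by (metis M.zero_closed)
  show ?thesis
  proof (rule gresolution.intro)
    show "Module.module R (?C i)" for i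
      using transport_module[where \<kappa>=\<kappa> and \<iota>=\<iota>, OF M \<kappa>] F by (cases i) auto
    show "?A i a \<subseteq> carrier (?C i)" for i a
      using A G[of a] by (cases i) (auto simp: transport_module_def)
    show "x \<ominus>\<^bsub>?C (Suc i)\<^esub> y \<in> ?A (Suc i) a" if "x \<in> ?A (Suc i) a" "y \<in> ?A (Suc i) a" for x y i a
      using A_minus that by simp
    show "?\<delta> i \<in> ghom R (?C (Suc i)) (?A (Suc i)) (?C i) (?A i)" for i
      using ie dh d by (cases i) (auto simp: ghom_def e[symmetric])
    show "?\<delta> i (?\<delta> (Suc i) x) = \<zero>\<^bsub>?C i\<^esub>" if "x \<in> carrier (?C (Suc (Suc i)))" for i x
    proof (cases i)
      case 0
      then have "d 0 x \<in> {x \<in> carrier (F 0). e x = \<zero>\<^bsub>M\<^esub>}" using ex0 that by auto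
      then show ?thesis using 0 by (simp add: transport_module_def)
    next
      case (Suc j)
      then have "d (Suc j) x \<in> {x \<in> carrier (F (Suc j)). d j x = \<zero>\<^bsub>F j\<^esub>}" using ex that by auto
      then show ?thesis using Suc by simp
    qed
    show "\<exists>y\<in>carrier (?C 1). ?\<delta> 0 y = x" if "x \<in> carrier (?C 0)" for x
      using that by (auto simp: transport_module_def es[symmetric])
    show "\<exists>y\<in>?A 1 a. ?\<delta> 0 y = x" if "x \<in> ?A 0 a" for x a
      using that by (auto simp: e[symmetric])
    show "\<exists>y\<in>carrier (?C (Suc (Suc i))). ?\<delta> (Suc i) y = x"
      if x: "x \<in> carrier (?C (Suc i))" "?\<delta> i x = \<zero>\<^bsub>?C i\<^esub>" for i x
    proof (cases i)
      case 0
      then have "x \<in> d 0 ` carrier (F 1)"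
        unfolding ex0 using x \<iota>0 mod_homD(1)[OF eh] by (auto simp: transport_module_def)
      then show ?thesis using 0 by auto
    next
      case (Suc j)
      then have "x \<in> d (Suc j) ` carrier (F (Suc (Suc j)))" unfolding ex using x by simp
      then show ?thesis using Suc by auto
    qed
    show "\<exists>y\<in>?A (Suc (Suc i)) a. ?\<delta> (Suc i) y = x"
      if x: "x \<in> ?A (Suc i) a" "?\<delta> i x = \<zero>\<^bsub>?C i\<^esub>" for i x a
    proof (cases i)
      case 0
      then show ?thesis using ge[of x a] x A[of 0 a] \<iota>0[of "e x"] mod_homD(1)[OF eh, of x]
        by (auto simp: transport_module_def)
    next
      case (Suc j)
      then show ?thesis using gd[of x j a] x by auto
    qed
  qed
qed

lemma resolution_gresolution_trivial:
  fixes F :: "nat \<Rightarrow> ('a, 'b) module"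
  assumes M: "Module.module R M" and \<kappa>: "\<And>x. x \<in> carrier M \<Longrightarrow> \<kappa> (\<iota> x) = x"
    and res: "resolution R M F d e"
  shows "gresolution R (case_nat (transport_module \<iota> \<kappa> M) F)
    (\<lambda>i (_ :: unit). carrier (case_nat (transport_module \<iota> \<kappa> M) F i))
    (case_nat (\<lambda>x. \<iota> (e x)) d)"
proof -
  have F: "Module.module R (F i)" and eh: "e \<in> mod_hom R (F 0) M"
    and dh: "d i \<in> mod_hom R (F (Suc i)) (F i)" and es: "e ` carrier (F 0) = carrier M"
    and ex0: "d 0 ` carrier (F 1) = {x \<in> carrier (F 0). e x = \<zero>\<^bsub>M\<^esub>}"
    and ex: "d (Suc i) ` carrier (F (Suc (Suc i))) = {x \<in> carrier (F (Suc i)). d i x = \<zero>\<^bsub>F i\<^esub>}" for i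
    using resolutionD[OF res] by blast+
  have "gresolution R (case_nat (transport_module \<iota> \<kappa> M) F) (case_nat (\<lambda>a. \<iota> ` carrier M) (\<lambda>i (_ :: unit). carrier (F i)))
    (case_nat (\<lambda>x. \<iota> (e x)) d)"
  proof (rule resolution_gresolution[where \<kappa>=\<kappa> and \<iota>=\<iota>, OF M \<kappa> res])
    show "x \<ominus>\<^bsub>F i\<^esub> y \<in> carrier (F i)" if "x \<in> carrier (F i)" "y \<in> carrier (F i)" for x y i
    proof -
      interpret Module.module R "F i" by (rule F)
      show ?thesis using that by simp
    qed
    show "\<exists>y\<in>carrier (F 1). d 0 y = x" if "x \<in> carrier (F 0)" "e x = \<zero>\<^bsub>M\<^esub>" for x
    proof -
      have "x \<in> d 0 ` carrier (F 1)" unfolding ex0 using that by simp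
      then show ?thesis by auto
    qed
    show "\<exists>y\<in>carrier (F (Suc (Suc i))). d (Suc i) y = x"
      if "x \<in> carrier (F (Suc i))" "d i x = \<zero>\<^bsub>F i\<^esub>" for x i
    proof -
      have "x \<in> d (Suc i) ` carrier (F (Suc (Suc i)))" unfolding ex using that by simp
      then show ?thesis by auto
    qed
  qed (use es mod_homD(1)[OF dh] in auto)
  moreover have "(case_nat (\<lambda>a. \<iota> ` carrier M) (\<lambda>i (_ :: unit). carrier (F i))) =
      (\<lambda>i (_ :: unit). carrier (case_nat (transport_module \<iota> \<kappa> M) F i))"
    by (auto simp: fun_eq_iff transport_module_def split: nat.splits)
  ultimately show ?thesis by simp
qed

section \<open>Homogeneous parts\<close>

text \<open>The projection onto degree \<open>a\<close>. Coordinate \<open>k\<close> can contribute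
  only the exponent \<open>a - D ! k\<close>; as subtraction of multidegrees is truncated, the test
  \<open>a - D ! k + D ! k = a\<close> says that \<open>D ! k\<close> divides
  \<open>a\<close>.\<close>

definition hpart :: "'v multideg list \<Rightarrow> 'v multideg \<Rightarrow> (nat \<Rightarrow> ('v, 'k::field) mpoly) \<Rightarrow> nat \<Rightarrow> ('v, 'k) mpoly" where
  "hpart D a f = (\<lambda>k. if k < length D \<and> a - D ! k + D ! k = a
     then single (a - D ! k) (lookup (f k) (a - D ! k)) else 0)"

lemma lookup_hpart:
  "lookup (hpart D a f k) m = (if k < length D \<and> m + D ! k = a then lookup (f k) m else 0)"
  by (auto simp: hpart_def lookup_single when_def)

lemma hpart_component:
  "f \<in> carrier (shifted_free X D) \<Longrightarrow> hpart D a f \<in> shifted_free_component X D a"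
  by (auto simp: shifted_iff shifted_free_carrier lookup_hpart split: if_splits
      intro!: poly_mapping_eqI)

lemma hpart_of_component:
  assumes f: "f \<in> shifted_free_component X D b"
  shows "hpart D a f = (if a = b then f else 0)"
proof (intro ext poly_mapping_eqI)
  fix k m
  show "lookup (hpart D a f k) m = lookup ((if a = b then f else 0) k) m"
  proof (cases "k < length D")
    case True
    then show ?thesis using f by (auto simp: shifted_iff lookup_hpart)
  next
    case False
    then show ?thesis
      using f by (auto simp: shifted_iff shifted_free_carrier lookup_hpart)
  qed
qed

lemma sum_apply: "sum f I k = (\<Sum>i\<in>I. f i k)"
  by (induction I rule: infinite_finite_induct) auto

lemma hpart_sum: "hpart D a (sum f I) = (\<Sum>i\<in>I. hpart D a (f i))"
  by (intro ext poly_mapping_eqI) (auto simp: sum_apply lookup_hpart lookup_sum intro!: sum.neutral)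

lemma hpart_decomp:
  assumes f: "f \<in> carrier (shifted_free X D)"
  obtains S where "finite S" "f = (\<Sum>a\<in>S. hpart D a f)"
proof
  \<comment> \<open>The degrees that occur in \<open>f\<close>: an exponent \<open>m\<close> in
    coordinate \<open>k\<close> has degree \<open>m + D ! k\<close>.\<close>
  let ?S = "\<Union>k<length D. (\<lambda>m. m + D ! k) ` keys (f k)"
  show fin: "finite ?S" by simp
  have "lookup (f k) m = (\<Sum>a\<in>?S. lookup (hpart D a f k) m)" for k m
  proof (cases "k < length D \<and> lookup (f k) m \<noteq> 0")
    case True
    then have "m + D ! k \<in> ?S"
      by (intro UN_I[of k] imageI) (auto simp: in_keys_iff)
    then have "(\<Sum>a\<in>?S. lookup (hpart D a f k) m) = lookup (hpart D (m + D ! k) f k) m"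
      by (intro sum.remove[OF fin, THEN trans]) (auto simp: lookup_hpart intro!: sum.neutral)
    then show ?thesis using True by (simp add: lookup_hpart)
  next
    case False
    then have "lookup (f k) m = 0" using f by (cases "k < length D") (auto simp: shifted_free_carrier)
    moreover have "(\<Sum>a\<in>?S. lookup (hpart D a f k) m) = 0"
      using False by (intro sum.neutral) (auto simp: lookup_hpart)
    ultimately show ?thesis by simp
  qed
  then show "f = (\<Sum>a\<in>?S. hpart D a f)"
    by (intro ext poly_mapping_eqI) (simp add: sum_apply lookup_sum)
qed

lemma mod_hom_sum:
  assumes \<phi>: "\<phi> \<in> mod_hom (mpoly_ring X) (shifted_free X D) (shifted_free X D')"
    and "\<And>i. i \<in> I \<Longrightarrow> f i \<in> carrier (shifted_free X D)"
  shows "\<phi> (sum f I) = (\<Sum>i\<in>I. \<phi> (f i))"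
proof -
  interpret M: Module.module "mpoly_ring X" "shifted_free X D" by (rule shifted_module)
  have 0: "\<phi> 0 = 0"
    using mod_hom_zero[OF \<phi> shifted_module shifted_module] by simp
  have "sum f I \<in> carrier (shifted_free X D) \<and> \<phi> (sum f I) = (\<Sum>i\<in>I. \<phi> (f i))"
    using assms(2)
    by (induction I rule: infinite_finite_induct)
      (use 0 M.zero_closed M.a_closed mod_homD(2)[OF \<phi>] in \<open>auto\<close>)
  then show ?thesis by simp
qed

text \<open>Decompose \<open>f\<close> into its parts. A degree-preserving map sends the part of
  degree \<open>b\<close> to degree \<open>b\<close>, so of all images only that of the part of
  degree \<open>a\<close> survives the projection.\<close>

lemma hpart_commute:
  assumes \<phi>: "\<phi> \<in> mod_hom (mpoly_ring X) (shifted_free X D) (shifted_free X D')"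
    and c: "\<And>a. \<phi> ` shifted_free_component X D a \<subseteq> shifted_free_component X D' a"
    and f: "f \<in> carrier (shifted_free X D)"
  shows "hpart D' a (\<phi> f) = \<phi> (hpart D a f)"
proof -
  obtain S where S: "finite S" "f = (\<Sum>a\<in>S. hpart D a f)" by (rule hpart_decomp[OF f])
  have hc: "hpart D b f \<in> carrier (shifted_free X D)" for b
    using hpart_component[OF f] shifted_carrier by blast
  have 0: "\<phi> 0 = 0"
    using mod_hom_zero[OF \<phi> shifted_module shifted_module] by simp
  have part: "hpart D' a (\<phi> (hpart D b f)) = (if a = b then \<phi> (hpart D b f) else 0)" for b
    by (rule hpart_of_component) (use c hpart_component[OF f] in blast)
  have "\<phi> f = (\<Sum>b\<in>S. \<phi> (hpart D b f))"
    using mod_hom_sum[OF \<phi>, of S "\<lambda>b. hpart D b f"] hc S(2) by simp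
  then have 1: "hpart D' a (\<phi> f) = (if a \<in> S then \<phi> (hpart D a f) else 0)"
    using S(1) by (simp add: hpart_sum part)
  have "hpart D a f = hpart D a (\<Sum>b\<in>S. hpart D b f)" using S(2) by simp
  also have "\<dots> = (\<Sum>b\<in>S. if a = b then hpart D b f else 0)"
    unfolding hpart_sum using hpart_of_component[OF hpart_component[OF f]] by (intro sum.cong) auto
  also have "\<dots> = (if a \<in> S then hpart D a f else 0)" using S(1) by simp
  finally show ?thesis using 1 0 by (auto split: if_splits)
qed

text \<open>Turns exactness of the whole modules into exactness in each degree: a preimage of a
  homogeneous element is replaced by its part of the same degree.\<close>

lemma graded_lift:
  assumes \<phi>: "\<phi> \<in> mod_hom (mpoly_ring X) (shifted_free X D) (shifted_free X D')"
    and c: "\<And>a. \<phi> ` shifted_free_component X D a \<subseteq> shifted_free_component X D' a"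
    and f: "f \<in> carrier (shifted_free X D)" and "\<phi> f \<in> shifted_free_component X D' a"
  shows "\<exists>g\<in>shifted_free_component X D a. \<phi> g = \<phi> f"
proof
  show "\<phi> (hpart D a f) = \<phi> f"
    using hpart_commute[OF \<phi> c f, of a] hpart_of_component[OF assms(4)] by simp
qed (rule hpart_component[OF f])

section \<open>Independence of Tor from the resolution\<close>

lemma graded_free_resolutionD:
  assumes "graded_free_resolution X M G D d e"
  shows "set (D i) \<subseteq> multidegs X" "resolution (mpoly_ring X) M (\<lambda>i. shifted_free X (D i)) d e"
    "e ` shifted_free_component X (D 0) a \<subseteq> G a"
    "d i ` shifted_free_component X (D (Suc i)) a \<subseteq> shifted_free_component X (D i) a"
  using assms by (simp_all add: graded_free_resolution_def)

lemma graded_exact: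
  assumes res: "graded_free_resolution X M G D d e"
  shows "x \<in> shifted_free_component X (D 0) a \<Longrightarrow> e x = \<zero>\<^bsub>M\<^esub> \<Longrightarrow>
      \<exists>y\<in>shifted_free_component X (D 1) a. d 0 y = x"
    and "x \<in> shifted_free_component X (D (Suc i)) a \<Longrightarrow> d i x = \<zero>\<^bsub>shifted_free X (D i)\<^esub> \<Longrightarrow>
      \<exists>y\<in>shifted_free_component X (D (Suc (Suc i))) a. d (Suc i) y = x"
proof -
  note r = graded_free_resolutionD[OF res]
  note rD = resolutionD[OF r(2)]
  { assume x: "x \<in> shifted_free_component X (D 0) a" "e x = \<zero>\<^bsub>M\<^esub>"
    then have "x \<in> d 0 ` carrier (shifted_free X (D 1))"
      unfolding rD(5) using shifted_carrier by auto
    then obtain f where f: "f \<in> carrier (shifted_free X (D 1))" "x = d 0 f" by auto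
    show "\<exists>y\<in>shifted_free_component X (D 1) a. d 0 y = x"
      using graded_lift[OF rD(3)[of 0] r(4)[of 0]] f x by simp }
  { assume x: "x \<in> shifted_free_component X (D (Suc i)) a" "d i x = \<zero>\<^bsub>shifted_free X (D i)\<^esub>"
    then have "x \<in> d (Suc i) ` carrier (shifted_free X (D (Suc (Suc i))))"
      unfolding rD(6) using shifted_carrier by auto
    then obtain f where f: "f \<in> carrier (shifted_free X (D (Suc (Suc i))))" "x = d (Suc i) f" by auto
    show "\<exists>y\<in>shifted_free_component X (D (Suc (Suc i))) a. d (Suc i) y = x"
      using graded_lift[OF rD(3)[of "Suc i"] r(4)[of "Suc i"]] f x by simp }
qed

text \<open>A multigraded resolution is only required to map components into \<open>G a\<close>. The
  reverse inclusion, hypothesis \<open>e\<close>, is a property of the resolved module; for monomial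
  quotients it is \<open>G_surj\<close>.\<close>

lemma graded_gresolution:
  assumes M: "Module.module (mpoly_ring X) M" and \<kappa>: "\<And>x. x \<in> carrier M \<Longrightarrow> \<kappa> (\<iota> x) = x"
    and res: "graded_free_resolution X M G D d e"
    and G: "\<And>a. G a \<subseteq> carrier M" and e: "\<And>a. G a \<subseteq> e ` shifted_free_component X (D 0) a"
  shows "gresolution (mpoly_ring X) (case_nat (transport_module \<iota> \<kappa> M) (\<lambda>i. shifted_free X (D i)))
    (case_nat (\<lambda>a. \<iota> ` G a) (\<lambda>i. shifted_free_component X (D i))) (case_nat (\<lambda>x. \<iota> (e x)) d)"
proof (rule resolution_gresolution[where \<kappa>=\<kappa> and \<iota>=\<iota>, OF M \<kappa> graded_free_resolutionD(2)[OF res]])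
  note r = graded_free_resolutionD[OF res]
  show "e ` shifted_free_component X (D 0) a = G a" for a
    using r(3) e by blast
  show "x \<ominus>\<^bsub>shifted_free X (D i)\<^esub> y \<in> shifted_free_component X (D i) a"
    if "x \<in> shifted_free_component X (D i) a" "y \<in> shifted_free_component X (D i) a" for i a x y
  proof -
    have "x \<in> carrier (shifted_free X (D i))" "y \<in> carrier (shifted_free X (D i))"
      using that by (simp_all add: shifted_iff)
    then show ?thesis
      using that by (simp only: shifted_free_minus shifted_diff)
  qed
qed (assumption | rule graded_exact[OF res] shifted_carrier G graded_free_resolutionD(4)[OF res])+

lemma irrelevant_ideal_subset: "irrelevant_ideal X \<subseteq> carrier (mpoly_ring X :: ('v, 'k::field) mpoly ring)"
proof -
  interpret cring "mpoly_ring X :: ('v, 'k) mpoly ring" by (rule mpoly_ring_cring)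
  have "Var ` X \<subseteq> carrier (mpoly_ring X :: ('v, 'k) mpoly ring)"
    by (auto simp: Var_def mpoly_ring_carrier lookup_single when_def multidegs_def split: if_splits)
  then show ?thesis
    unfolding irrelevant_ideal_def by (intro genideal_minimal oneideal)
qed

section \<open>Cycles and boundaries as vector spaces over the field\<close>

lemma Const_carrier: "Const c \<in> carrier (mpoly_ring X)"
  by (auto simp: Const_def mpoly_ring_carrier lookup_single when_def multidegs_def)

lemma kscale_component: "f \<in> shifted_free_component X D a \<Longrightarrow> kscale c f \<in> shifted_free_component X D a"
  unfolding kscale_def
  by (rule shifted_mult[OF _ Const_carrier])
    (auto simp: Const_def lookup_single when_def split: if_splits)

lemma submodule_irrelevant_smult:
  "submodule (ideal_smult (mpoly_ring X) (irrelevant_ideal X) (shifted_free X D)) (mpoly_ring X) (shifted_free X D)"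
  by (rule submodule_ideal_smult[OF shifted_module irrelevant_ideal_subset])

lemma shifted_free_closed:
  "0 \<in> carrier (shifted_free X D)"
  "f \<in> carrier (shifted_free X D) \<Longrightarrow> g \<in> carrier (shifted_free X D) \<Longrightarrow> f + g \<in> carrier (shifted_free X D)"
  "f \<in> carrier (shifted_free X D) \<Longrightarrow> kscale c f \<in> carrier (shifted_free X D)"
proof -
  interpret M: Module.module "mpoly_ring X" "shifted_free X D" by (rule shifted_module)
  show "0 \<in> carrier (shifted_free X D)" using M.zero_closed by simp
  show "f \<in> carrier (shifted_free X D) \<Longrightarrow> g \<in> carrier (shifted_free X D) \<Longrightarrow> f + g \<in> carrier (shifted_free X D)"
    using M.a_closed[of f g] by simp
  show "f \<in> carrier (shifted_free X D) \<Longrightarrow> kscale c f \<in> carrier (shifted_free X D)"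
    using M.smult_closed[OF Const_carrier, of f c] by (simp add: kscale_def)
qed

abbreviation "mF X D \<equiv> ideal_smult (mpoly_ring X) (irrelevant_ideal X) (shifted_free X D)"

lemma mF_closed:
  "mF X D \<subseteq> carrier (shifted_free X D)" "0 \<in> mF X D"
  "f \<in> mF X D \<Longrightarrow> g \<in> mF X D \<Longrightarrow> f + g \<in> mF X D"
  "f \<in> mF X D \<Longrightarrow> kscale c f \<in> mF X D"
proof -
  interpret M: Module.module "mpoly_ring X" "shifted_free X D" by (rule shifted_module)
  note s = M.submoduleE[OF submodule_irrelevant_smult]
  show "mF X D \<subseteq> carrier (shifted_free X D)" by (rule s)
  show "0 \<in> mF X D"
    using subgroup.one_closed[OF submodule.axioms(1)[OF submodule_irrelevant_smult[of X D]]] by simp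
  show "f \<in> mF X D \<Longrightarrow> g \<in> mF X D \<Longrightarrow> f + g \<in> mF X D" using s(5)[of f g] by simp
  show "f \<in> mF X D \<Longrightarrow> kscale c f \<in> mF X D"
    using s(4)[OF Const_carrier, of f c] by (simp add: kscale_def)
qed

interpretation kscale: vector_space "kscale :: 'k::field \<Rightarrow> (nat \<Rightarrow> ('v, 'k) mpoly) \<Rightarrow> _"
  by (rule kscale_vector_space)

text \<open>Once the degree is fixed, each coordinate admits at most one monomial, so one vector per
  basis element spans. Finite dimension matters because \<open>dim\<close> is only a meaningful
  number then.\<close>

lemma component_finite_dim:
  obtains W where "finite W" "shifted_free_component X D a \<subseteq> kscale.span W"
proof
  let ?w = "\<lambda>k j. if j = k then single (a - D ! k) 1 else 0"
  let ?W = "?w ` {..<length D}"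
  show "finite ?W" by simp
  show "shifted_free_component X D a \<subseteq> kscale.span ?W"
  proof
    fix f assume f: "f \<in> shifted_free_component X D a"
    have "f = (\<Sum>k<length D. kscale (lookup (f k) (a - D ! k)) (?w k))"
    proof (intro ext poly_mapping_eqI)
      fix j m
      show "lookup (f j) m = lookup ((\<Sum>k<length D. kscale (lookup (f k) (a - D ! k)) (?w k)) j) m"
      proof (cases "j < length D")
        case True
        have "a - D ! j = m" if "lookup (f j) m \<noteq> 0"
          using f True that by (metis add_diff_cancel_right' shifted_iff)
        then have "lookup (f j) m = lookup (kscale (lookup (f j) (a - D ! j)) (?w j) j) m"
          by (auto simp: kscale_def Const_def mult_single lookup_single when_def)
        also have "\<dots> = (\<Sum>k<length D. lookup (kscale (lookup (f k) (a - D ! k)) (?w k) j) m)"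
          using True by (intro sum.remove[THEN trans, symmetric, of _ j])
            (auto simp: kscale_def intro!: sum.neutral)
        finally show ?thesis by (simp add: sum_apply lookup_sum)
      next
        case False
        then have "lookup (kscale (lookup (f k) (a - D ! k)) (?w k) j) m = 0" if "k < length D" for k
          using that by (auto simp: kscale_def)
        moreover have "f j = 0" using f False by (simp add: shifted_iff shifted_free_carrier)
        ultimately show ?thesis by (simp add: sum_apply lookup_sum)
      qed
    qed
    also have "\<dots> \<in> kscale.span ?W"
      by (intro kscale.span_sum kscale.span_scale kscale.span_base) auto
    finally show "f \<in> kscale.span ?W" .
  qed
qed

lemma tor_cycles_iff:
  "f \<in> tor_cycles X D d i a \<longleftrightarrow>
     f \<in> shifted_free_component X (D i) a \<and> (\<forall>j. i = Suc j \<longrightarrow> d j f \<in> mF X (D j))"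
  by (cases i) (auto simp: tor_cycles_def)

lemma tor_boundaries_iff:
  "f \<in> tor_boundaries X D d i a \<longleftrightarrow>
     f \<in> shifted_free_component X (D i) a \<and>
     (\<exists>g\<in>carrier (shifted_free X (D (Suc i))). \<exists>h\<in>mF X (D i). f = d i g + h)"
  by (auto simp: tor_boundaries_def)

lemma tor_subspaces:
  assumes res: "graded_free_resolution X M G D d e"
  shows "kscale.subspace (tor_cycles X D d i a)" "kscale.subspace (tor_boundaries X D d i a)"
    "tor_boundaries X D d i a \<subseteq> tor_cycles X D d i a"
proof -
  note rD = resolutionD[OF graded_free_resolutionD(2)[OF res]]
  have d0: "d j 0 = 0" for j
    using mod_hom_zero[OF rD(3) shifted_module shifted_module] by simp
  have dadd: "d j (f + g) = d j f + d j g"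
    if "f \<in> carrier (shifted_free X (D (Suc j)))" "g \<in> carrier (shifted_free X (D (Suc j)))" for j f g
    using mod_homD(2)[OF rD(3) that] by simp
  have dsc: "d j (kscale c f) = kscale c (d j f)"
    if "f \<in> carrier (shifted_free X (D (Suc j)))" for j f c
    using mod_homD(3)[OF rD(3)[of j] Const_carrier that, of c] by (simp add: kscale_def)
  have cc: "f \<in> carrier (shifted_free X (D j))" if "f \<in> shifted_free_component X (D j) a" for j f
    using that shifted_carrier by blast
  show "kscale.subspace (tor_cycles X D d i a)"
    by (rule kscale.subspaceI)
      (auto simp: tor_cycles_iff d0 dadd dsc cc mF_closed shifted_zero
         shifted_add kscale_component)
  note cl = shifted_free_closed
  show "kscale.subspace (tor_boundaries X D d i a)"
  proof (rule kscale.subspaceI)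
    show "0 \<in> tor_boundaries X D d i a"
      unfolding tor_boundaries_iff using cl(1) mF_closed(2) d0 shifted_zero
      by (metis add.left_neutral)
    fix f g assume f: "f \<in> tor_boundaries X D d i a"
    then obtain u h where u: "u \<in> carrier (shifted_free X (D (Suc i)))" "h \<in> mF X (D i)" "f = d i u + h"
      unfolding tor_boundaries_iff by blast
    { assume g: "g \<in> tor_boundaries X D d i a"
      then obtain u' h' where u': "u' \<in> carrier (shifted_free X (D (Suc i)))" "h' \<in> mF X (D i)" "g = d i u' + h'"
        unfolding tor_boundaries_iff by blast
      have "f + g = d i (u + u') + (h + h')" using u u' by (simp add: dadd)
      then show "f + g \<in> tor_boundaries X D d i a"
        using f g cl(2)[OF u(1) u'(1)] mF_closed(3)[OF u(2) u'(2)] shifted_add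
        unfolding tor_boundaries_iff by blast }
    fix c
    have "kscale c f = d i (kscale c u) + kscale c h"
      using u by (simp add: dsc kscale.scale_right_distrib)
    then show "kscale c f \<in> tor_boundaries X D d i a"
      using f cl(3)[OF u(1)] mF_closed(4)[OF u(2)] kscale_component
      unfolding tor_boundaries_iff by blast
  qed
  show "tor_boundaries X D d i a \<subseteq> tor_cycles X D d i a"
  proof
    fix f assume f: "f \<in> tor_boundaries X D d i a"
    then obtain u h where u: "u \<in> carrier (shifted_free X (D (Suc i)))" "h \<in> mF X (D i)" "f = d i u + h"
      unfolding tor_boundaries_iff by blast
    have "d j f \<in> mF X (D j)" if i: "i = Suc j" for j
    proof -
      have "d i u \<in> d i ` carrier (shifted_free X (D (Suc i)))" using u by auto
      then have "d j (d i u) = 0" unfolding i rD(6) by simp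
      moreover have "d i u \<in> carrier (shifted_free X (D i))" using mod_homD(1)[OF rD(3) u(1)] .
      ultimately have "d j f = d j h"
        using dadd[of "d i u" j h] mF_closed(1) u i by auto
      then show ?thesis
        using ideal_smult_hom[OF shifted_module shifted_module rD(3) irrelevant_ideal_subset] u i by metis
    qed
    then show "f \<in> tor_cycles X D d i a" using f by (simp add: tor_cycles_iff tor_boundaries_iff)
  qed
qed

text \<open>Comparison maps \<open>\<alpha>\<close> and \<open>\<beta>\<close> and the homotopy give
  \<open>z = \<beta> (\<alpha> z) + d (h z) + h (d z)\<close>, written without positions. For a
  cycle \<open>z\<close> the last term lies in the submodule \<open>mF\<close>; if
  \<open>\<alpha> z\<close> is a boundary, then so is \<open>z\<close>. Hence
  \<open>\<alpha>\<close> is injective on Tor, and exchanging the resolutions gives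
  equality.\<close>

lemma tor_dim_le:
  fixes M :: "(('v, 'k::field) mpoly, 'm) module"
  assumes M: "Module.module (mpoly_ring X) M" and G: "\<And>a. G a \<subseteq> carrier M"
    and res: "graded_free_resolution X M G D d e" and e: "\<And>a. G a \<subseteq> e ` shifted_free_component X (D 0) a"
    and res': "graded_free_resolution X M G D' d' e'" and e': "\<And>a. G a \<subseteq> e' ` shifted_free_component X (D' 0) a"
  shows "tor_dim X D d i a \<le> tor_dim X D' d' i a"
proof -
  let ?R = "mpoly_ring X :: ('v, 'k) mpoly ring"
  note rD = resolutionD[OF graded_free_resolutionD(2)[OF res]]
  note rD' = resolutionD[OF graded_free_resolutionD(2)[OF res']]
  \<comment> \<open>The copy of \<open>M\<close> is made of chosen preimages under \<open>e\<close>,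
    with \<open>e\<close> as left inverse. It serves both resolutions, whose elements have the same
    type.\<close>
  define \<iota> where "\<iota> = inv_into (carrier (shifted_free X (D 0))) e"
  have \<kappa>: "e (\<iota> x) = x" if "x \<in> carrier M" for x
  proof -
    have "x \<in> e ` carrier (shifted_free X (D 0))" using that rD(4) by simp
    then show ?thesis unfolding \<iota>_def by (rule f_inv_into_f)
  qed
  let ?T = "transport_module \<iota> e M"
  define C A \<delta> where "C = case_nat ?T (\<lambda>i. shifted_free X (D i))"
    and "A = case_nat (\<lambda>a. \<iota> ` G a) (\<lambda>i. shifted_free_component X (D i))"
    and "\<delta> = case_nat (\<lambda>x. \<iota> (e x)) d"
  define C' A' \<delta>' where "C' = case_nat ?T (\<lambda>i. shifted_free X (D' i))"
    and "A' = case_nat (\<lambda>a. \<iota> ` G a) (\<lambda>i. shifted_free_component X (D' i))"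
    and "\<delta>' = case_nat (\<lambda>x. \<iota> (e' x)) d'"
  have r: "gresolution ?R C A \<delta>"
    unfolding C_def A_def \<delta>_def by (rule graded_gresolution[OF M _ res G e]) (rule \<kappa>)
  have r': "gresolution ?R C' A' \<delta>'"
    unfolding C'_def A'_def \<delta>'_def by (rule graded_gresolution[OF M _ res' G e']) (rule \<kappa>)
  interpret r: gresolution ?R C A \<delta> by (rule r)
  interpret r': gresolution ?R C' A' \<delta>' by (rule r')
  obtain \<alpha> where \<alpha>: "\<alpha> 0 = (\<lambda>x. x)" "\<And>i. \<alpha> i \<in> ghom ?R (C i) (A i) (C' i) (A' i)"
    "\<And>i x. x \<in> carrier (C (Suc i)) \<Longrightarrow> \<delta>' i (\<alpha> (Suc i) x) = \<alpha> i (\<delta> i x)"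
    by (rule comparison[OF r r']) (simp_all add: C_def C'_def A_def A'_def shifted_free_gproj)
  obtain \<beta> where \<beta>: "\<beta> 0 = (\<lambda>x. x)" "\<And>i. \<beta> i \<in> ghom ?R (C' i) (A' i) (C i) (A i)"
    "\<And>i x. x \<in> carrier (C' (Suc i)) \<Longrightarrow> \<delta> i (\<beta> (Suc i) x) = \<beta> i (\<delta>' i x)"
    by (rule comparison[OF r' r]) (simp_all add: C_def C'_def A_def A'_def shifted_free_gproj)
  have \<beta>\<alpha>: "\<delta> i (\<beta> (Suc i) (\<alpha> (Suc i) x)) = \<beta> i (\<alpha> i (\<delta> i x))" if "x \<in> carrier (C (Suc i))" for i x
    using \<beta>(3)[OF mod_homD(1)[OF ghomD(1)[OF \<alpha>(2)] that]] \<alpha>(3)[OF that] by simp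
  obtain h where h: "h 0 = (\<lambda>x. \<zero>\<^bsub>C 1\<^esub>)" "\<And>i. h i \<in> mod_hom ?R (C i) (C (Suc i))"
    "\<And>i x. x \<in> carrier (C (Suc i)) \<Longrightarrow>
       \<delta> (Suc i) (h (Suc i) x) = x \<ominus>\<^bsub>C (Suc i)\<^esub> \<beta> (Suc i) (\<alpha> (Suc i) x) \<ominus>\<^bsub>C (Suc i)\<^esub> h i (\<delta> i x)"
    by (rule homotopy[OF r, where \<alpha>="\<lambda>i x. \<beta> i (\<alpha> i x)"])
      (use \<alpha> \<beta> ghom_comp[OF \<alpha>(2) \<beta>(2)] \<beta>\<alpha> in \<open>auto simp: C_def A_def shifted_free_gproj\<close>)
  have Cs: "C (Suc j) = shifted_free X (D j)" "C' (Suc j) = shifted_free X (D' j)"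
    "A (Suc j) = shifted_free_component X (D j)" "A' (Suc j) = shifted_free_component X (D' j)"
    "\<delta> (Suc j) = d j" "\<delta>' (Suc j) = d' j" for j
    by (simp_all add: C_def C'_def A_def A'_def \<delta>_def \<delta>'_def)
  have \<alpha>h: "\<alpha> (Suc j) \<in> mod_hom ?R (shifted_free X (D j)) (shifted_free X (D' j))" for j
    using ghomD(1)[OF \<alpha>(2)[of "Suc j"]] by (simp add: Cs)
  have \<beta>h: "\<beta> (Suc j) \<in> mod_hom ?R (shifted_free X (D' j)) (shifted_free X (D j))" for j
    using ghomD(1)[OF \<beta>(2)[of "Suc j"]] by (simp add: Cs)
  have \<alpha>c: "\<alpha> (Suc j) f \<in> shifted_free_component X (D' j) a" if "f \<in> shifted_free_component X (D j) a" for j f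
    using ghomD(2)[OF \<alpha>(2)[of "Suc j"]] that by (simp add: Cs)
  have cc: "f \<in> carrier (shifted_free X D0)" if "f \<in> shifted_free_component X D0 a" for D0 f
    using that shifted_carrier by blast
  note mFh = ideal_smult_hom[OF shifted_module shifted_module _ irrelevant_ideal_subset]
  obtain W W' :: "(nat \<Rightarrow> ('v, 'k) mpoly) set" where W: "finite W" "shifted_free_component X (D i) a \<subseteq> kscale.span W"
    "finite W'" "shifted_free_component X (D' i) a \<subseteq> kscale.span W'"
    using component_finite_dim by metis
  show ?thesis
    unfolding tor_dim_def
  proof (rule kscale.dim_diff_le[of W _ W' _ _ _ "\<alpha> (Suc i)"])
    let ?Z = "tor_cycles X D d i a"
    show "?Z \<subseteq> kscale.span W" "tor_cycles X D' d' i a \<subseteq> kscale.span W'"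
      using W tor_cycles_iff by blast+
    fix z assume z: "z \<in> ?Z"
    then have zc: "z \<in> shifted_free_component X (D i) a" "z \<in> carrier (shifted_free X (D i))"
      using cc by (auto simp: tor_cycles_iff)
    have \<alpha>z: "\<alpha> (Suc i) z \<in> carrier (shifted_free X (D' i))" by (rule mod_homD(1)[OF \<alpha>h zc(2)])
    show "\<alpha> (Suc i) (kscale c z) = kscale c (\<alpha> (Suc i) z)" for c
      using mod_homD(3)[OF \<alpha>h Const_carrier zc(2), of c] by (simp add: kscale_def)
    show "\<alpha> (Suc i) (z + w) = \<alpha> (Suc i) z + \<alpha> (Suc i) w" if "w \<in> ?Z" for w
      using mod_homD(2)[OF \<alpha>h zc(2) cc[of w "D i"]] that by (simp add: tor_cycles_iff)
    show "\<alpha> (Suc i) z \<in> tor_cycles X D' d' i a"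
      unfolding tor_cycles_iff
    proof (intro conjI allI impI)
      show "\<alpha> (Suc i) z \<in> shifted_free_component X (D' i) a" by (rule \<alpha>c[OF zc(1)])
      fix j assume j: "i = Suc j"
      then have "d' j (\<alpha> (Suc i) z) = \<alpha> i (d j z)" using \<alpha>(3)[of z i] zc by (simp add: Cs)
      moreover have "d j z \<in> mF X (D j)" using z j by (simp add: tor_cycles_iff)
      ultimately show "d' j (\<alpha> (Suc i) z) \<in> mF X (D' j)" using mFh[OF \<alpha>h[of j]] j by simp
    qed
    assume "\<alpha> (Suc i) z \<in> tor_boundaries X D' d' i a"
    then obtain u v where u: "u \<in> carrier (shifted_free X (D' (Suc i)))" "v \<in> mF X (D' i)"
      "\<alpha> (Suc i) z = d' i u + v"
      unfolding tor_boundaries_iff by blast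
    have v: "v \<in> carrier (shifted_free X (D' i))" using u mF_closed(1) by blast
    have \<beta>u: "\<beta> (Suc (Suc i)) u \<in> carrier (shifted_free X (D (Suc i)))" by (rule mod_homD(1)[OF \<beta>h u(1)])
    have hz: "h (Suc i) z \<in> carrier (shifted_free X (D (Suc i)))"
      using mod_homD(1)[OF h(2)[of "Suc i"]] zc by (simp add: Cs)
    have \<beta>z: "\<beta> (Suc i) (\<alpha> (Suc i) z) \<in> carrier (shifted_free X (D i))" by (rule mod_homD(1)[OF \<beta>h \<alpha>z])
    \<comment> \<open>In position 0 the homotopy on \<open>M\<close> is zero. Later the cycle
      condition puts \<open>d j z\<close> into \<open>mF\<close>, and homomorphisms respect that
      submodule.\<close>
    have h\<delta>: "h i (\<delta> i z) \<in> mF X (D i)"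
    proof (cases i)
      case 0
      then show ?thesis using h(1) mF_closed(2)[of X "D 0"] by (simp add: Cs)
    next
      case (Suc j)
      then have "d j z \<in> mF X (D j)" using z by (simp add: tor_cycles_iff)
      then show ?thesis using mFh[of "h (Suc j)"] h(2)[of "Suc j"] Suc by (simp add: Cs)
    qed
    then have h\<delta>c: "h i (\<delta> i z) \<in> carrier (shifted_free X (D i))" using mF_closed(1) by blast
    interpret F: Module.module ?R "shifted_free X (D i)" by (rule shifted_module)
    have "d i (h (Suc i) z) = z - \<beta> (Suc i) (\<alpha> (Suc i) z) - h i (\<delta> i z)"
      using h(3)[of z i] zc \<beta>z h\<delta>c F.minus_closed[OF zc(2) \<beta>z] by (simp add: Cs shifted_free_minus)
    moreover have "\<beta> (Suc i) (\<alpha> (Suc i) z) = d i (\<beta> (Suc (Suc i)) u) + \<beta> (Suc i) v"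
      using \<beta>(3)[of u "Suc i"] mod_homD(2)[OF \<beta>h[of i] mod_homD(1)[OF rD'(3) u(1)] v] u by (simp add: Cs)
    moreover have "d i (h (Suc i) z + \<beta> (Suc (Suc i)) u) = d i (h (Suc i) z) + d i (\<beta> (Suc (Suc i)) u)"
      using mod_homD(2)[OF rD(3) hz \<beta>u] by simp
    ultimately have "z = d i (h (Suc i) z + \<beta> (Suc (Suc i)) u) + (\<beta> (Suc i) v + h i (\<delta> i z))"
      by (simp add: algebra_simps)
    moreover have "h (Suc i) z + \<beta> (Suc (Suc i)) u \<in> carrier (shifted_free X (D (Suc i)))"
    proof -
      interpret F': Module.module ?R "shifted_free X (D (Suc i))" by (rule shifted_module)
      show ?thesis using F'.a_closed[OF hz \<beta>u] by simp
    qed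
    moreover have "\<beta> (Suc i) v + h i (\<delta> i z) \<in> mF X (D i)"
      using mF_closed(3)[OF mFh[OF \<beta>h u(2)] h\<delta>] .
    ultimately show "z \<in> tor_boundaries X D d i a"
      unfolding tor_boundaries_iff using zc by blast
  qed (use W tor_subspaces[OF res] tor_subspaces[OF res'] in auto)
qed

text \<open>The definite description ranges over all resolutions of \<open>M\<close>, so
  surjectivity of \<open>e\<close> on components is demanded of every one of them and not just of
  the given one.\<close>

lemma multigraded_betti_eq_tor_dim:
  assumes M: "Module.module (mpoly_ring X) M" and G: "\<And>a. G a \<subseteq> carrier M"
    and surj: "\<And>D d e a. graded_free_resolution X M G D d e \<Longrightarrow> G a \<subseteq> e ` shifted_free_component X (D 0) a"
    and res: "graded_free_resolution X M G D d e"
  shows "multigraded_betti X M G i a = tor_dim X D d i a"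
  unfolding multigraded_betti_def
proof (rule the_equality)
  fix n assume "\<exists>D d e. graded_free_resolution X M G D d e \<and> n = tor_dim X D d i a"
  then obtain D' d' e' where r: "graded_free_resolution X M G D' d' e'" "n = tor_dim X D' d' i a" by blast
  show "n = tor_dim X D d i a"
    unfolding r(2)
    by (intro antisym tor_dim_le[OF M G r(1) surj[OF r(1)] res surj[OF res]]
      tor_dim_le[OF M G res surj[OF res] r(1) surj[OF r(1)]])
qed (use res in blast)

section \<open>Monomial ideals\<close>

definition mdvd :: "'v multideg \<Rightarrow> 'v multideg \<Rightarrow> bool" where
  "mdvd m a \<longleftrightarrow> (\<forall>v. lookup m v \<le> lookup a v)"

lemma mdvd_iff_minus: "mdvd m a \<longleftrightarrow> a - m + m = a"
  by (simp add: mdvd_def poly_mapping_eq_iff fun_eq_iff lookup_add lookup_minus)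
    (metis le_add2 le_add_diff_inverse2)

lemma mdvd_add: "mdvd m (c + m)"
  by (simp add: mdvd_def lookup_add)

lemma mdvd_refl [simp]: "mdvd a a"
  by (simp add: mdvd_def)

lemma mdvd_trans: "mdvd a b \<Longrightarrow> mdvd b c \<Longrightarrow> mdvd a c"
  unfolding mdvd_def by (meson order_trans)

lemma mdvd_multidegs: "mdvd m a \<Longrightarrow> a \<in> multidegs X \<Longrightarrow> m \<in> multidegs X"
proof -
  assume m: "mdvd m a" and a: "a \<in> multidegs X"
  have "v \<in> keys a" if "v \<in> keys m" for v
    using m that unfolding mdvd_def in_keys_iff by (metis le_zero_eq)
  then show "m \<in> multidegs X" using a by (auto simp: multidegs_def)
qed

lemma minus_multidegs: "a \<in> multidegs X \<Longrightarrow> a - m \<in> multidegs X"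
  unfolding multidegs_def by (auto simp: in_keys_iff lookup_minus)

lemma multideg_add_eq_0: "(0 :: 'v multideg) = c + c' \<Longrightarrow> c = 0 \<and> c' = 0"
  by (auto simp: poly_mapping_eq_iff fun_eq_iff lookup_add)

lemma poly_sum_monomials: "f = (\<Sum>a\<in>keys f. single a (lookup f a))"
proof (rule poly_mapping_eqI)
  fix m
  have "(\<Sum>a\<in>keys f. lookup (single a (lookup f a)) m) =
        (\<Sum>a\<in>keys f. if a = m then lookup f a else 0)"
    by (intro sum.cong) (auto simp: lookup_single when_def)
  also have "\<dots> = lookup f m" by (simp add: in_keys_iff)
  finally show "lookup f m = lookup (\<Sum>a\<in>keys f. single a (lookup f a)) m"
    by (simp add: lookup_sum)
qed

lemma single_carrier: "a \<in> multidegs X \<Longrightarrow> single a c \<in> carrier (mpoly_ring X)"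
  by (auto simp: mpoly_ring_carrier lookup_single when_def)

lemma mpoly_ring_minus:
  assumes "f \<in> carrier (mpoly_ring X)" "g \<in> carrier (mpoly_ring X)"
  shows "f \<ominus>\<^bsub>mpoly_ring X\<^esub> g = f - g"
  using assms by (simp add: a_minus_def mpoly_ring_a_inv)

lemma ideal_sum_closed:
  assumes "ideal I (mpoly_ring X)" "\<And>i. i \<in> S \<Longrightarrow> f i \<in> I"
  shows "sum f S \<in> I"
proof -
  interpret ideal I "mpoly_ring X" by fact
  show ?thesis
    using assms(2)
  proof (induction S rule: infinite_finite_induct)
    case (insert x F)
    then have "f x \<oplus>\<^bsub>mpoly_ring X\<^esub> sum f F \<in> I"
      using additive_subgroup.a_closed[OF is_additive_subgroup, of "f x" "sum f F"] by auto
    then show ?case using insert by simp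
  qed (use additive_subgroup.zero_closed[OF is_additive_subgroup] in auto)
qed

definition monomial_ideal :: "'v set \<Rightarrow> 'v multideg set \<Rightarrow> ('v, 'k::field) mpoly set" where
  "monomial_ideal X B = genideal (mpoly_ring X) ((\<lambda>m. single m 1) ` B)"

text \<open>Membership is decided term by term: the right-hand side describes an ideal that contains
  the generators, and conversely each term of \<open>f\<close> is a multiple of the generator that
  divides it.\<close>

lemma monomial_ideal_iff:
  fixes f :: "('v, 'k::field) mpoly"
  assumes B: "B \<subseteq> multidegs X"
  shows "f \<in> monomial_ideal X B \<longleftrightarrow>
    f \<in> carrier (mpoly_ring X) \<and> (\<forall>a. lookup f a \<noteq> 0 \<longrightarrow> (\<exists>m\<in>B. mdvd m a))"
proof -
  let ?R = "mpoly_ring X :: ('v, 'k) mpoly ring"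
  interpret cring ?R by (rule mpoly_ring_cring)
  let ?J = "{f \<in> carrier ?R. \<forall>a. lookup f a \<noteq> 0 \<longrightarrow> (\<exists>m\<in>B. mdvd m a)}"
  let ?g = "(\<lambda>m. single m 1) ` B :: ('v, 'k) mpoly set"
  have gc: "?g \<subseteq> carrier ?R" using B single_carrier by blast
  have mult: "x * f \<in> ?J" if f: "f \<in> ?J" and x: "x \<in> carrier ?R" for f x
  proof -
    have "x * f \<in> carrier ?R" using m_closed[of x f] f x by simp
    moreover have "\<exists>m\<in>B. mdvd m a" if "lookup (x * f) a \<noteq> 0" for a
      using that
    proof (rule lookup_nonzero_mult)
      fix c c' assume "a = c + c'" "lookup f c' \<noteq> 0"
      then show ?thesis using f mdvd_add mdvd_trans by blast
    qed
    ultimately show ?thesis by blast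
  qed
  have J: "ideal ?J ?R"
  proof (rule idealI)
    show "subgroup ?J (add_monoid ?R)"
    proof (rule add.subgroupI)
      show "?J \<noteq> {}" using zero_closed by force
      show "\<ominus>\<^bsub>?R\<^esub> f \<in> ?J" if "f \<in> ?J" for f
        using that by (auto simp: mpoly_ring_a_inv mpoly_ring_carrier)
      show "f \<oplus>\<^bsub>?R\<^esub> g \<in> ?J" if "f \<in> ?J" "g \<in> ?J" for f g
        using that a_closed[of f g] by (auto simp: lookup_add) (metis add.right_neutral)
    qed auto
    show "x \<otimes>\<^bsub>?R\<^esub> f \<in> ?J" "f \<otimes>\<^bsub>?R\<^esub> x \<in> ?J" if "f \<in> ?J" "x \<in> carrier ?R" for f x
      using mult[OF that] by (simp_all add: mult.commute)
  qed (rule ring_axioms)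
  have "monomial_ideal X B \<subseteq> ?J"
    unfolding monomial_ideal_def
  proof (rule genideal_minimal[OF J])
    show "?g \<subseteq> ?J"
      using gc by (auto simp: lookup_single when_def split: if_splits intro!: bexI mdvd_refl)
  qed
  moreover have "f \<in> monomial_ideal X B" if f: "f \<in> ?J" for f
  proof -
    interpret I: ideal "monomial_ideal X B" ?R
      unfolding monomial_ideal_def by (rule genideal_ideal[OF gc])
    have "single a (lookup f a) \<in> monomial_ideal X B" if a: "lookup f a \<noteq> 0" for a
    proof -
      obtain m where m: "m \<in> B" "mdvd m a" using f a by blast
      then have "single (a - m) (lookup f a) * single m 1 = single a (lookup f a)"
        by (simp add: mult_single mdvd_iff_minus)
      moreover have "(single m 1 :: ('v, 'k) mpoly) \<in> monomial_ideal X B"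
        unfolding monomial_ideal_def by (rule subsetD[OF genideal_self[OF gc] imageI[OF m(1)]])
      moreover have "a \<in> multidegs X" using f a by (auto simp: mpoly_ring_carrier)
      ultimately show ?thesis
        using I.I_l_closed[of "single m 1" "single (a - m) (lookup f a)"]
          single_carrier[OF minus_multidegs, of a X m "lookup f a"] by simp
    qed
    then have "(\<Sum>a\<in>keys f. single a (lookup f a)) \<in> monomial_ideal X B"
      by (intro ideal_sum_closed[OF I.ideal_axioms]) (auto simp: in_keys_iff)
    then show ?thesis by (subst poly_sum_monomials)
  qed
  ultimately show ?thesis by blast
qed

lemma irrelevant_ideal_eq: "irrelevant_ideal X = monomial_ideal X ((\<lambda>v. single v 1) ` X)"
  unfolding irrelevant_ideal_def monomial_ideal_def image_image Var_def by (rule refl)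

lemma irrelevant_ideal_iff:
  "f \<in> irrelevant_ideal X \<longleftrightarrow> f \<in> carrier (mpoly_ring X) \<and> lookup f 0 = 0"
proof -
  have "(\<lambda>v. single v 1) ` X \<subseteq> multidegs X" by (auto simp: multidegs_def)
  note * = monomial_ideal_iff[OF this]
  have "(\<exists>m\<in>(\<lambda>v. single v 1) ` X. mdvd m a) \<longleftrightarrow> a \<noteq> 0" if "a \<in> multidegs X" for a
  proof
    assume "a \<noteq> 0"
    then obtain v where v: "lookup a v \<noteq> 0" by (auto simp: poly_mapping_eq_iff fun_eq_iff)
    then have "v \<in> X" using that by (auto simp: multidegs_def in_keys_iff subset_iff)
    moreover have "mdvd (single v 1) a"
      using v by (auto simp: mdvd_def lookup_single when_def)
    ultimately show "\<exists>m\<in>(\<lambda>v. single v 1) ` X. mdvd m a" by blast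
  next
    assume "\<exists>m\<in>(\<lambda>v. single v 1) ` X. mdvd m a"
    then obtain v where "mdvd (single v 1) a" by blast
    then have "lookup a v \<ge> 1" unfolding mdvd_def by (metis lookup_single_eq)
    then show "a \<noteq> 0" by auto
  qed
  then show ?thesis unfolding irrelevant_ideal_eq * by (auto simp: mpoly_ring_carrier)
qed

text \<open>A product with an element of the maximal ideal has no constant term, because exponents
  add up to 0 only if both are 0; conversely \<open>f\<close> is the sum of its coordinates times
  basis vectors. The criterion mentions the ring only through the carrier, which makes Tor
  comparable over two polynomial rings.\<close>

lemma mF_iff:
  fixes f :: "nat \<Rightarrow> ('v, 'k::field) mpoly"
  shows "f \<in> mF X D \<longleftrightarrow> f \<in> carrier (shifted_free X D) \<and> (\<forall>k. lookup (f k) 0 = 0)"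
proof
  interpret M: Module.module "mpoly_ring X :: ('v, 'k) mpoly ring" "shifted_free X D"
    by (rule shifted_module)
  let ?K = "{f :: nat \<Rightarrow> ('v, 'k) mpoly. f \<in> carrier (shifted_free X D) \<and> (\<forall>k. lookup (f k) 0 = 0)}"
  have mult: "lookup (p * q) 0 = 0" if "lookup q 0 = 0" for p q :: "('v, 'k) mpoly"
    using that lookup_nonzero_mult[of p q 0] multideg_add_eq_0 by metis
  have "submodule ?K (mpoly_ring X) (shifted_free X D)"
  proof (rule M.submoduleI)
    show "\<ominus>\<^bsub>shifted_free X D\<^esub> f \<in> ?K" if f: "f \<in> ?K" for f
    proof -
      have "\<ominus>\<^bsub>shifted_free X D\<^esub> f = - f"
        using shifted_free_minus[of 0 X D f] f M.zero_closed by (simp add: a_minus_def)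
      then show ?thesis using f M.a_inv_closed[of f] by simp
    qed
    show "f \<oplus>\<^bsub>shifted_free X D\<^esub> g \<in> ?K" if "f \<in> ?K" "g \<in> ?K" for f g
      using that M.a_closed[of f g] by (simp add: lookup_add)
    show "p \<odot>\<^bsub>shifted_free X D\<^esub> f \<in> ?K" if "p \<in> carrier (mpoly_ring X)" "f \<in> ?K" for p f
      using that M.smult_closed[of p f] mult by simp
  qed (use M.zero_closed in auto)
  moreover have "p \<odot>\<^bsub>shifted_free X D\<^esub> f \<in> ?K" if "p \<in> irrelevant_ideal X" "f \<in> carrier (shifted_free X D)" for p f
  proof -
    have "lookup (p * f k) 0 = 0" for k
      using mult[of p "f k"] that by (simp add: irrelevant_ideal_iff mult.commute[of p])
    then show ?thesis using that M.smult_closed[of p f] by (simp add: irrelevant_ideal_iff)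
  qed
  ultimately show "f \<in> carrier (shifted_free X D) \<and> (\<forall>k. lookup (f k) 0 = 0)" if "f \<in> mF X D"
    using that unfolding ideal_smult_def by blast
next
  assume f: "f \<in> carrier (shifted_free X D) \<and> (\<forall>k. lookup (f k) 0 = 0)"
  let ?e = "unit_vec (mpoly_ring X)"
  have fk: "(\<lambda>j. f k * ?e k j) \<in> mF X D" if k: "k < length D" for k
  proof -
    have "f k \<in> irrelevant_ideal X"
      using f k by (auto simp: irrelevant_ideal_iff shifted_free_carrier mpoly_ring_carrier)
    then have "f k \<odot>\<^bsub>shifted_free X D\<^esub> ?e k \<in> mF X D"
      using unit_vec_closed[OF mpoly_ring_cring k] unfolding ideal_smult_def by blast
    then show ?thesis by simp
  qed
  have "(\<Sum>k\<in>K. (\<lambda>j. f k * ?e k j)) \<in> mF X D" if "K \<subseteq> {..<length D}" for K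
    using finite_subset[OF that finite_lessThan] that
    by (induction K rule: finite_induct) (auto simp: mF_closed fk)
  then have "(\<Sum>k<length D. (\<lambda>j. f k * ?e k j)) \<in> mF X D" by simp
  moreover have "f = (\<Sum>k<length D. (\<lambda>j. f k * ?e k j))"
  proof
    fix j
    have "(\<Sum>k<length D. f k * ?e k j) = (\<Sum>k<length D. if j = k then f k else 0)"
      by (intro sum.cong) (auto simp: unit_vec_def)
    also have "\<dots> = f j" using f by (auto simp: shifted_free_carrier)
    finally show "f j = (\<Sum>k<length D. (\<lambda>j. f k * ?e k j)) j" by (simp add: sum_apply)
  qed
  ultimately show "f \<in> mF X D" by simp
qed

section \<open>Quotients by monomial ideals\<close>

definition monomial_quotient_component :: "'v set \<Rightarrow> 'v multideg set \<Rightarrow> 'v multideg \<Rightarrow> ('v, 'k::field) mpoly set set"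
  where "monomial_quotient_component X B a =
    (\<lambda>f. monomial_ideal X B +>\<^bsub>mpoly_ring X\<^esub> f) ` mpoly_component X a"

lemma mpoly_component_iff:
  "f \<in> mpoly_component X a \<longleftrightarrow> f \<in> carrier (mpoly_ring X) \<and> (\<forall>m. lookup f m \<noteq> 0 \<longrightarrow> m = a)"
  by (auto simp: mpoly_component_def in_keys_iff)

locale monomial_quotient =
  fixes K :: "'k::field itself" and X :: "'v set" and B :: "'v multideg set"
  assumes B: "B \<subseteq> multidegs X"
begin

abbreviation SX :: "('v, 'k) mpoly ring" where "SX \<equiv> mpoly_ring X"
abbreviation I :: "('v, 'k) mpoly set" where "I \<equiv> monomial_ideal X B"
abbreviation M :: "(('v, 'k) mpoly, ('v, 'k) mpoly set) module" where "M \<equiv> quot_module SX I"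
abbreviation G :: "'v multideg \<Rightarrow> ('v, 'k) mpoly set set" where "G \<equiv> monomial_quotient_component X B"

sublocale S: cring SX by (rule mpoly_ring_cring)

lemma I_ideal: "ideal I SX"
  unfolding monomial_ideal_def using B single_carrier by (intro S.genideal_ideal) blast

sublocale I: ideal I SX by (rule I_ideal)

lemma M_module: "Module.module SX M"
  by (rule quot_module_module[OF mpoly_ring_cring I_ideal])

lemma carrier_M: "carrier M = (\<lambda>f. I +>\<^bsub>SX\<^esub> f) ` carrier SX"
  by (auto simp: quot_module_def FactRing_def A_RCOSETS_def')

lemma coset_eq_iff: "f \<in> carrier SX \<Longrightarrow> g \<in> carrier SX \<Longrightarrow> I +>\<^bsub>SX\<^esub> f = I +>\<^bsub>SX\<^esub> g \<longleftrightarrow> f - g \<in> I"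
  using S.quotient_eq_iff_same_a_r_cos[OF I_ideal, of f g] mpoly_ring_minus[of f X g] by simp

lemma M_ops:
  "f \<in> carrier SX \<Longrightarrow> g \<in> carrier SX \<Longrightarrow> (I +>\<^bsub>SX\<^esub> f) \<oplus>\<^bsub>M\<^esub> (I +>\<^bsub>SX\<^esub> g) = I +>\<^bsub>SX\<^esub> (f + g)"
  "f \<in> carrier SX \<Longrightarrow> g \<in> carrier SX \<Longrightarrow> f \<odot>\<^bsub>M\<^esub> (I +>\<^bsub>SX\<^esub> g) = I +>\<^bsub>SX\<^esub> (f * g)"
  "\<zero>\<^bsub>M\<^esub> = I +>\<^bsub>SX\<^esub> 0"
proof -
  show "f \<in> carrier SX \<Longrightarrow> g \<in> carrier SX \<Longrightarrow> (I +>\<^bsub>SX\<^esub> f) \<oplus>\<^bsub>M\<^esub> (I +>\<^bsub>SX\<^esub> g) = I +>\<^bsub>SX\<^esub> (f + g)"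
    using I.a_rcos_sum[of f g] by (simp add: quot_module_def FactRing_def)
  show "f \<in> carrier SX \<Longrightarrow> g \<in> carrier SX \<Longrightarrow> f \<odot>\<^bsub>M\<^esub> (I +>\<^bsub>SX\<^esub> g) = I +>\<^bsub>SX\<^esub> (f * g)"
    using I.rcoset_mult_add[of f g] by (simp add: quot_module_def FactRing_def)
  have "I +>\<^bsub>SX\<^esub> 0 = I" using I.a_rcos_const[OF I.zero_closed] by simp
  then show "\<zero>\<^bsub>M\<^esub> = I +>\<^bsub>SX\<^esub> 0" by (simp add: quot_module_def FactRing_def)
qed

lemma coset_zero_iff: "f \<in> carrier SX \<Longrightarrow> I +>\<^bsub>SX\<^esub> f = \<zero>\<^bsub>M\<^esub> \<longleftrightarrow> f \<in> I"
  unfolding M_ops using coset_eq_iff[of f 0] S.zero_closed by simp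

lemma component_carrier: "f \<in> mpoly_component X a \<Longrightarrow> f \<in> carrier SX"
  by (simp add: mpoly_component_iff)

lemma G_carrier: "G a \<subseteq> carrier M"
  unfolding carrier_M monomial_quotient_component_def using component_carrier by blast

text \<open>For a class of \<open>f\<close> of degree \<open>a\<close>, split a preimage
  \<open>y\<close> into parts; the part of degree \<open>b\<close> goes to the class of some
  \<open>g b\<close> of degree \<open>b\<close>. Then \<open>f\<close> minus the sum of the
  \<open>g b\<close> is in \<open>I\<close>. As \<open>I\<close> is monomial, so is the degree
  \<open>a\<close> part \<open>f - g a\<close>, and the part of \<open>y\<close> in degree
  \<open>a\<close> is a homogeneous preimage.\<close>

lemma G_surj:
  assumes res: "graded_free_resolution X M G D d e"
  shows "G a \<subseteq> e ` shifted_free_component X (D 0) a"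
proof
  fix x assume "x \<in> G a"
  then obtain f where f: "f \<in> mpoly_component X a" "x = I +>\<^bsub>SX\<^esub> f"
    unfolding monomial_quotient_component_def by blast
  note rD = resolutionD[OF graded_free_resolutionD(2)[OF res]]
  have "x \<in> e ` carrier (shifted_free X (D 0))"
    unfolding rD(4) carrier_M using f component_carrier by blast
  then obtain y where y: "y \<in> carrier (shifted_free X (D 0))" "x = e y" by blast
  let ?y = "\<lambda>b. hpart (D 0) b y"
  have yc: "?y b \<in> carrier (shifted_free X (D 0))" for b
    using hpart_component[OF y(1)] shifted_carrier by blast
  have "e (?y b) \<in> G b" for b
    using graded_free_resolutionD(3)[OF res, of b] hpart_component[OF y(1)] by blast
  then have "\<exists>g. g \<in> mpoly_component X b \<and> e (?y b) = I +>\<^bsub>SX\<^esub> g" for b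
    unfolding monomial_quotient_component_def by blast
  then obtain g where g: "\<And>b. g b \<in> mpoly_component X b" "\<And>b. e (?y b) = I +>\<^bsub>SX\<^esub> g b" by metis
  have gc: "g b \<in> carrier SX" for b using g(1) component_carrier by blast
  obtain T where T: "finite T" "y = (\<Sum>b\<in>T. ?y b)" by (rule hpart_decomp[OF y(1)])
  have e0: "e 0 = I +>\<^bsub>SX\<^esub> 0"
    using mod_hom_zero[OF rD(2) shifted_module M_module] by (simp add: M_ops)
  have sum: "e (\<Sum>b\<in>T. ?y b) = I +>\<^bsub>SX\<^esub> (\<Sum>b\<in>T. g b) \<and> (\<Sum>b\<in>T. ?y b) \<in> carrier (shifted_free X (D 0))
      \<and> (\<Sum>b\<in>T. g b) \<in> carrier SX"
    using T(1)
  proof (induction T rule: finite_induct)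
    case empty
    show ?case using e0 shifted_free_closed(1) S.zero_closed unfolding sum.empty mpoly_ring_simps by blast
  next
    case (insert b T)
    then show ?case
      using mod_homD(2)[OF rD(2) yc[of b], of "\<Sum>b\<in>T. ?y b"] g(2) M_ops(1)[OF gc, of "\<Sum>b\<in>T. g b" b]
        shifted_free_closed(2)[OF yc[of b]] S.a_closed[OF gc, of "\<Sum>b\<in>T. g b" b]
      by (simp only: sum.insert shifted_free_simps mpoly_ring_simps simp_thms)
  qed
  have "I +>\<^bsub>SX\<^esub> f = I +>\<^bsub>SX\<^esub> (\<Sum>b\<in>T. g b)" using sum T(2) y(2) f(2) by metis
  then have "f - (\<Sum>b\<in>T. g b) \<in> I"
    using coset_eq_iff[OF component_carrier[OF f(1)], of "\<Sum>b\<in>T. g b"] sum by simp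
  then have nz: "\<exists>m\<in>B. mdvd m a" if "lookup (f - (\<Sum>b\<in>T. g b)) a \<noteq> 0"
    using that unfolding monomial_ideal_iff[OF B] by blast
  have look: "lookup (\<Sum>b\<in>T. g b) a = (if a \<in> T then lookup (g a) a else 0)"
  proof -
    have "lookup (\<Sum>b\<in>T. g b) a = (\<Sum>b\<in>T. if a = b then lookup (g b) a else 0)"
      unfolding lookup_sum using g(1) by (intro sum.cong) (auto simp: mpoly_component_iff)
    then show ?thesis using T(1) by simp
  qed
  \<comment> \<open>If \<open>a\<close> is not among the degrees in \<open>T\<close>, then the part
    of \<open>y\<close> in degree \<open>a\<close> is zero, whatever representative
    \<open>g a\<close> was chosen for it.\<close>
  define g' where "g' = (if a \<in> T then g a else 0)"
  have g': "g' \<in> carrier SX" "e (?y a) = I +>\<^bsub>SX\<^esub> g'"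
  proof -
    show "g' \<in> carrier SX" using gc S.zero_closed by (simp add: g'_def)
    show "e (?y a) = I +>\<^bsub>SX\<^esub> g'"
    proof (cases "a \<in> T")
      case False
      have "?y a = hpart (D 0) a (\<Sum>b\<in>T. ?y b)" using T(2) by simp
      also have "\<dots> = 0"
        unfolding hpart_sum using False hpart_of_component[OF hpart_component[OF y(1)], of a]
        by (intro sum.neutral) auto
      finally show ?thesis using False e0 by (simp add: g'_def)
    qed (simp add: g g'_def)
  qed
  have "f - g' \<in> I"
    unfolding monomial_ideal_iff[OF B]
  proof (intro conjI allI impI)
    show "f - g' \<in> carrier SX"
      using S.minus_closed[OF component_carrier[OF f(1)] g'(1)] mpoly_ring_minus[OF component_carrier[OF f(1)] g'(1)]
      by simp
    fix m assume m: "lookup (f - g') m \<noteq> 0"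
    then have "lookup f m \<noteq> 0 \<or> lookup g' m \<noteq> 0" by (auto simp: lookup_minus)
    then have "m = a" using f(1) g(1)[of a] by (auto simp: mpoly_component_iff g'_def split: if_splits)
    then show "\<exists>m'\<in>B. mdvd m' m"
      using nz m look by (auto simp: lookup_minus g'_def split: if_splits)
  qed
  then have "x = e (?y a)"
    using coset_eq_iff[OF component_carrier[OF f(1)] g'(1)] f(2) g'(2) by simp
  then show "x \<in> e ` shifted_free_component X (D 0) a" using hpart_component[OF y(1)] by blast
qed

lemma betti_eq_tor_dim:
  assumes "graded_free_resolution X M G D d e"
  shows "multigraded_betti X M G i a = tor_dim X D d i a"
  by (rule multigraded_betti_eq_tor_dim[where G=G, OF M_module G_carrier _ assms]) (rule G_surj)

end

section \<open>The Taylor resolution\<close>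

lemma lookup_single_mult:
  "lookup (single e s * p) c = (if mdvd e c then s * lookup p (c - e) else 0)"
  for p :: "('v, 'k::field) mpoly"
proof -
  have "single e s * p = (\<Sum>a\<in>keys p. single (e + a) (s * lookup p a))"
  proof -
    have "single e s * p =
        single e s * (\<Sum>a\<in>keys p. single a (lookup p a))"
      by (rule arg_cong[OF poly_sum_monomials])
    also have "\<dots> = (\<Sum>a\<in>keys p. single (e + a) (s * lookup p a))"
      by (simp add: sum_distrib_left mult_single)
    finally show ?thesis .
  qed
  then have "lookup (single e s * p) c = (\<Sum>a\<in>keys p. if e + a = c then s * lookup p a else 0)"
    by (simp add: lookup_sum lookup_single when_def)
  also have "\<dots> = (\<Sum>a\<in>keys p. if mdvd e c \<and> a = c - e then s * lookup p a else 0)"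
  proof (rule sum.cong[OF refl])
    fix a
    have "e + a = c \<longleftrightarrow> mdvd e c \<and> a = c - e"
      unfolding mdvd_iff_minus by (metis add.commute add_diff_cancel_right')
    then show "(if e + a = c then s * lookup p a else 0) = (if mdvd e c \<and> a = c - e then s * lookup p a else 0)"
      by simp
  qed
  also have "\<dots> = (if mdvd e c then s * lookup p (c - e) else 0)"
    by (cases "mdvd e c") (auto simp: in_keys_iff)
  finally show ?thesis .
qed

text \<open>The terms for \<open>s, t\<close> and \<open>t, s\<close> cancel. The diagonal is left
  out of the sum: in characteristic 2 antisymmetry would not make its terms vanish.\<close>

lemma sum_antisym:
  fixes g :: "'a \<Rightarrow> 'a \<Rightarrow> 'b::ab_group_add"
  assumes "finite N" "\<And>s t. s \<in> N \<Longrightarrow> t \<in> N \<Longrightarrow> s \<noteq> t \<Longrightarrow> g s t = - g t s"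
  shows "(\<Sum>s\<in>N. \<Sum>t\<in>N - {s}. g s t) = 0"
  using assms
proof (induction N rule: finite_induct)
  case (insert x N)
  have ins: "(\<Sum>t\<in>insert x N - {s}. g s t) = g s x + (\<Sum>t\<in>N - {s}. g s t)" if "s \<in> N" for s
  proof -
    have "insert x N - {s} = insert x (N - {s})" using insert.hyps that by auto
    then show ?thesis using insert.hyps by simp
  qed
  have x: "insert x N - {x} = N" using insert.hyps by auto
  have "(\<Sum>s\<in>insert x N. \<Sum>t\<in>insert x N - {s}. g s t) =
      (\<Sum>t\<in>N. g x t) + (\<Sum>s\<in>N. \<Sum>t\<in>insert x N - {s}. g s t)"
    unfolding sum.insert[OF insert.hyps] x ..
  also have "(\<Sum>s\<in>N. \<Sum>t\<in>insert x N - {s}. g s t) = (\<Sum>s\<in>N. g s x + (\<Sum>t\<in>N - {s}. g s t))"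
    by (rule sum.cong[OF refl]) (rule ins)
  also have "\<dots> = (\<Sum>s\<in>N. g s x)"
  proof -
    have "(\<Sum>s\<in>N. \<Sum>t\<in>N - {s}. g s t) = 0"
      by (rule insert.IH) (rule insert.prems; blast)
    then show ?thesis unfolding sum.distrib by simp
  qed
  also have "\<dots> = (\<Sum>s\<in>N. - g x s)"
  proof (rule sum.cong[OF refl])
    fix s assume "s \<in> N"
    then show "g s x = - g x s" using insert.hyps by (intro insert.prems) blast+
  qed
  finally show ?case by (simp add: sum_negf)
qed simp

text \<open>Inserting 0 makes the maximum well defined for the empty family, whose lcm is then the
  monomial 1.\<close>

definition monomial_lcm :: "('i \<Rightarrow> 'v multideg) \<Rightarrow> 'i set \<Rightarrow> 'v multideg" where
  "monomial_lcm m T = Abs_poly_mapping (\<lambda>v. Max (insert 0 ((\<lambda>t. lookup (m t) v) ` T)))"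

lemma mdvd_monomial_lcm:
  assumes "finite T"
  shows "mdvd (monomial_lcm m T) a \<longleftrightarrow> (\<forall>t\<in>T. mdvd (m t) a)"
proof -
  have "{v. Max (insert 0 ((\<lambda>t. lookup (m t) v) ` T)) \<noteq> 0} \<subseteq> (\<Union>t\<in>T. keys (m t))"
  proof
    fix v assume "v \<in> {v. Max (insert 0 ((\<lambda>t. lookup (m t) v) ` T)) \<noteq> 0}"
    moreover have "Max (insert 0 ((\<lambda>t. lookup (m t) v) ` T)) \<in> insert 0 ((\<lambda>t. lookup (m t) v) ` T)"
      using assms by (intro Max_in) auto
    ultimately show "v \<in> (\<Union>t\<in>T. keys (m t))" by (auto simp: in_keys_iff)
  qed
  then have "finite {v. Max (insert 0 ((\<lambda>t. lookup (m t) v) ` T)) \<noteq> 0}"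
    by (rule finite_subset) (use assms in auto)
  then have "lookup (monomial_lcm m T) v = Max (insert 0 ((\<lambda>t. lookup (m t) v) ` T))" for v
    by (simp add: monomial_lcm_def Abs_poly_mapping_inverse)
  then show ?thesis using assms by (auto simp: mdvd_def)
qed

lemma monomial_lcm_mono: "finite T \<Longrightarrow> S \<subseteq> T \<Longrightarrow> mdvd (monomial_lcm m S) (monomial_lcm m T)"
  using mdvd_monomial_lcm[of T m "monomial_lcm m T"] mdvd_monomial_lcm[of S m "monomial_lcm m T"]
    finite_subset[of S T] by auto

lemma monomial_lcm_empty [simp]: "monomial_lcm m {} = 0"
proof -
  have "mdvd (monomial_lcm m {}) 0" by (simp add: mdvd_monomial_lcm)
  then show ?thesis by (simp add: mdvd_def poly_mapping_eq_iff fun_eq_iff)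
qed

text \<open>The lcm divides the product of the monomials, and divisors of a monomial in the
  variables of \<open>X\<close> stay within those variables.\<close>

lemma monomial_lcm_multidegs:
  assumes "finite T" "\<And>t. t \<in> T \<Longrightarrow> m t \<in> multidegs X"
  shows "monomial_lcm m T \<in> multidegs X"
proof -
  have "mdvd (m t) (\<Sum>t\<in>T. m t)" if "t \<in> T" for t
    using sum.remove[OF assms(1) that, of m] by (simp add: mdvd_def lookup_add)
  then have "mdvd (monomial_lcm m T) (\<Sum>t\<in>T. m t)" using assms by (simp add: mdvd_monomial_lcm)
  moreover have "(\<Sum>t\<in>T. m t) \<in> multidegs X"
    using assms(2)
  proof (induction T rule: infinite_finite_induct)
    case (insert t T)
    then show ?case using multidegs_add[of "m t" X "sum m T"] by simp
  qed (auto simp: multidegs_def)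
  ultimately show ?thesis by (rule mdvd_multidegs)
qed

text \<open>
  An element of the Taylor complex is a family \<open>u\<close> of polynomials indexed by the sets \<open>T\<close> of
  generators; \<open>coef u T a\<close> is the coefficient of the basis element \<open>x\<^sup>a / lcm T \<cdot> e\<^sub>T\<close> of degree \<open>a\<close>.
  In these coordinates the differential in each multidegree is that of a simplex.
\<close>

locale taylor = monomial_quotient K X B
  for K :: "'k::field itself" and X :: "'v set" and B +
  fixes m :: "nat \<Rightarrow> 'v multideg" and r :: nat and xs :: "nat \<Rightarrow> nat set list"
  assumes mB: "m ` {..<r} = B"
    and xs: "distinct (xs i)" "set (xs i) = {T. T \<subseteq> {..<r} \<and> card T = i}"
begin

abbreviation L where "L \<equiv> monomial_lcm m"

definition coef :: "(nat set \<Rightarrow> ('v, 'k) mpoly) \<Rightarrow> nat set \<Rightarrow> 'v multideg \<Rightarrow> 'k" where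
  "coef u S a = (if mdvd (L S) a then lookup (u S) (a - L S) else 0)"

text \<open>The exponent is the position of \<open>t\<close> in the increasing enumeration of
  \<open>insert t S\<close>, as in the simplicial boundary.\<close>

definition sign :: "nat \<Rightarrow> nat set \<Rightarrow> 'k" where
  "sign t S = (- 1) ^ card {s \<in> S. s < t}"

text \<open>The Taylor differential read at its target: the coefficient of the basis element
  \<open>S\<close> collects the contributions of all sets \<open>insert t S\<close> of which
  \<open>S\<close> is a face. The quotient of the two lcms makes the map homogeneous.\<close>

definition bd :: "(nat set \<Rightarrow> ('v, 'k) mpoly) \<Rightarrow> nat set \<Rightarrow> ('v, 'k) mpoly" where
  "bd u S = (\<Sum>t\<in>{..<r} - S. single (L (insert t S) - L S) (sign t S) * u (insert t S))"

definition dividing :: "'v multideg \<Rightarrow> nat set" where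
  "dividing a = {t. t < r \<and> mdvd (m t) a}"

text \<open>The coefficient of \<open>c\<close> at \<open>S\<close> sits in degree
  \<open>c + L S\<close>. The vertex of the cone depends on that degree, so the operator is given
  coefficient by coefficient; linearity over the polynomial ring is not claimed, and exactness does
  not ask for it.\<close>

definition contr :: "(nat set \<Rightarrow> ('v, 'k) mpoly) \<Rightarrow> nat set \<Rightarrow> ('v, 'k) mpoly" where
  "contr u S = Abs_poly_mapping (\<lambda>c. if dividing (c + L S) \<noteq> {} \<and> Min (dividing (c + L S)) \<in> S
     then coef u (S - {Min (dividing (c + L S))}) (c + L S) else 0)"

section \<open>Boundary and contraction in a single multidegree\<close>

lemma finite_gens: "S \<subseteq> {..<r} \<Longrightarrow> finite S"
  by (rule finite_subset) auto

lemma L_multidegs: "S \<subseteq> {..<r} \<Longrightarrow> L S \<in> multidegs X"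
  using B mB by (intro monomial_lcm_multidegs finite_gens) auto

lemma lookup_eq_coef: "lookup (u S) c = coef u S (c + L S)"
  by (simp add: coef_def mdvd_add)

lemma coef_eqI: "(\<And>a. coef u S a = coef v S a) \<Longrightarrow> u S = v S"
  by (rule poly_mapping_eqI) (simp add: lookup_eq_coef)

lemma coef_dividing:
  assumes "coef u S a \<noteq> 0" "S \<subseteq> {..<r}" shows "S \<subseteq> dividing a"
proof -
  have "mdvd (L S) a" using assms by (auto simp: coef_def split: if_splits)
  then show ?thesis using assms finite_gens by (auto simp: mdvd_monomial_lcm dividing_def)
qed

lemma coef_bd:
  assumes S: "S \<subseteq> {..<r}"
  shows "coef (bd u) S a = (\<Sum>t\<in>{..<r} - S. sign t S * coef u (insert t S) a)"
proof (cases "mdvd (L S) a")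
  case True
  have "lookup (single (L (insert t S) - L S) (sign t S) * u (insert t S)) (a - L S) =
      sign t S * coef u (insert t S) a" if "t \<in> {..<r} - S" for t
  proof -
    have le: "lookup (L S) v \<le> lookup (L (insert t S)) v" for v
      using monomial_lcm_mono[of "insert t S" S m] finite_gens[OF S] by (auto simp: mdvd_def)
    have "mdvd (L (insert t S) - L S) (a - L S) \<longleftrightarrow> mdvd (L (insert t S)) a"
      using True le unfolding mdvd_def lookup_minus by (metis diff_le_mono eq_diff_iff le_diff_iff)
    moreover have "a - L S - (L (insert t S) - L S) = a - L (insert t S)"
      using le by (intro poly_mapping_eqI) (simp add: lookup_minus)
    ultimately show ?thesis by (simp add: lookup_single_mult coef_def)
  qed
  then show ?thesis using True by (simp add: coef_def[of "bd u"] bd_def lookup_sum)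
next
  case False
  have "coef u (insert t S) a = 0" if "t \<in> {..<r} - S" for t
    using False monomial_lcm_mono[of "insert t S" S m] mdvd_trans finite_gens[OF S]
    by (auto simp: coef_def)
  then show ?thesis using False by (simp add: coef_def[of "bd u"])
qed

lemma sign_insert: "t \<notin> S \<Longrightarrow> finite S \<Longrightarrow> sign t' (insert t S) = (if t < t' then - sign t' S else sign t' S)"
proof -
  assume "t \<notin> S" "finite S"
  moreover have "{s \<in> insert t S. s < t'} = (if t < t' then insert t {s \<in> S. s < t'} else {s \<in> S. s < t'})"
    by auto
  ultimately show ?thesis by (simp add: sign_def)
qed

text \<open>Two elements \<open>t\<close> and \<open>t'\<close> can be added in either order. The
  order affects exactly one of the two signs, that of the larger element, so the contributions
  cancel in pairs.\<close>

lemma bd_bd: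
  assumes S: "S \<subseteq> {..<r}"
  shows "bd (bd u) S = 0"
proof -
  let ?N = "{..<r} - S"
  let ?g = "\<lambda>t t' a. sign t S * (sign t' (insert t S) * coef u (insert t' (insert t S)) a)"
  have "coef (bd (bd u)) S a = (\<Sum>t\<in>?N. \<Sum>t'\<in>?N - {t}. ?g t t' a)" for a
  proof -
    have "coef (bd (bd u)) S a = (\<Sum>t\<in>?N. sign t S * coef (bd u) (insert t S) a)"
      by (rule coef_bd[OF S])
    also have "\<dots> = (\<Sum>t\<in>?N. sign t S * (\<Sum>t'\<in>{..<r} - insert t S. sign t' (insert t S) * coef u (insert t' (insert t S)) a))"
      using S by (intro sum.cong refl arg_cong[of _ _ "(*) _"] coef_bd) auto
    also have "\<dots> = (\<Sum>t\<in>?N. \<Sum>t'\<in>?N - {t}. ?g t t' a)"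
    proof (rule sum.cong[OF refl])
      fix t
      have "{..<r} - insert t S = ?N - {t}" by blast
      then show "sign t S * (\<Sum>t'\<in>{..<r} - insert t S. sign t' (insert t S) * coef u (insert t' (insert t S)) a) =
          (\<Sum>t'\<in>?N - {t}. ?g t t' a)"
        by (simp only: sum_distrib_left)
    qed
    finally show ?thesis .
  qed
  moreover have "(\<Sum>t\<in>?N. \<Sum>t'\<in>?N - {t}. ?g t t' a) = 0" for a
  proof (rule sum_antisym)
    fix t t' assume "t \<in> ?N" "t' \<in> ?N" "t \<noteq> t'"
    then show "?g t t' a = - ?g t' t a"
      using finite_gens[OF S] by (cases "t < t'") (auto simp: sign_insert insert_commute)
  qed simp
  ultimately show ?thesis using coef_eqI[of "bd (bd u)" S "\<lambda>_. 0"] by (simp add: coef_def)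
qed

lemma Min_dividing:
  assumes "dividing a \<noteq> {}"
  shows "Min (dividing a) \<in> dividing a" "t \<in> dividing a \<Longrightarrow> Min (dividing a) \<le> t" "Min (dividing a) < r"
proof -
  have "finite (dividing a)" by (simp add: dividing_def)
  then show 1: "Min (dividing a) \<in> dividing a" "t \<in> dividing a \<Longrightarrow> Min (dividing a) \<le> t"
    using assms by simp_all
  then show "Min (dividing a) < r" by (simp add: dividing_def)
qed

lemma coef_contr:
  assumes S: "S \<subseteq> {..<r}"
  shows "coef (contr u) S a =
    (if dividing a \<noteq> {} \<and> Min (dividing a) \<in> S then coef u (S - {Min (dividing a)}) a else 0)"
proof -
  let ?f = "\<lambda>c. if dividing (c + L S) \<noteq> {} \<and> Min (dividing (c + L S)) \<in> S
     then coef u (S - {Min (dividing (c + L S))}) (c + L S) else 0"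
  \<comment> \<open>Finite support is needed for \<open>Abs_poly_mapping\<close>. A nonzero value at
    \<open>c\<close> comes from an exponent \<open>k\<close> of \<open>u (S - {j})\<close> with
    \<open>k + L (S - {j}) = c + L S\<close>, which determines \<open>c\<close>.\<close>
  have "{c. ?f c \<noteq> 0} \<subseteq> (\<Union>j\<in>S. (\<lambda>k. k + L (S - {j}) - L S) ` keys (u (S - {j})))"
  proof
    fix c assume "c \<in> {c. ?f c \<noteq> 0}"
    then have j: "Min (dividing (c + L S)) \<in> S" and
      n: "coef u (S - {Min (dividing (c + L S))}) (c + L S) \<noteq> 0"
      by (auto split: if_splits)
    let ?j = "Min (dividing (c + L S))"
    have "mdvd (L (S - {?j})) (c + L S)" "c + L S - L (S - {?j}) \<in> keys (u (S - {?j}))"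
      using n by (auto simp: coef_def in_keys_iff split: if_splits)
    moreover from this have "c = (c + L S - L (S - {?j})) + L (S - {?j}) - L S"
      by (simp add: mdvd_iff_minus)
    ultimately show "c \<in> (\<Union>j\<in>S. (\<lambda>k. k + L (S - {j}) - L S) ` keys (u (S - {j})))"
      using j by blast
  qed
  then have fin: "finite {c. ?f c \<noteq> 0}" by (rule finite_subset) (use finite_gens[OF S] in auto)
  then have lk: "lookup (contr u S) c = ?f c" for c
    unfolding contr_def by (simp add: Abs_poly_mapping_inverse)
  show ?thesis
  proof (cases "mdvd (L S) a")
    case True
    then have "a - L S + L S = a" by (simp add: mdvd_iff_minus)
    then show ?thesis using True by (simp add: coef_def[of "contr u"] lk)
  next
    case False
    \<comment> \<open>With \<open>L S\<close> not dividing \<open>a\<close> the left side is 0. So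
      is the right: otherwise \<open>S - {j}\<close> and \<open>j\<close> would both consist of
      generators dividing \<open>a\<close>, forcing \<open>L S\<close> to divide it.\<close>
    have "coef u (S - {j}) a = 0" if j: "dividing a \<noteq> {}" "j = Min (dividing a)" "j \<in> S" for j
    proof (rule ccontr)
      assume "coef u (S - {j}) a \<noteq> 0"
      then have "S - {j} \<subseteq> dividing a" using S by (intro coef_dividing) auto
      then have "S \<subseteq> dividing a" using Min_dividing(1)[OF j(1)] j by auto
      then show False using False finite_gens[OF S] by (auto simp: mdvd_monomial_lcm dividing_def)
    qed
    then show ?thesis using False by (simp add: coef_def[of "contr u"])
  qed
qed

text \<open>The coning operator with the least generator dividing \<open>x\<^sup>a\<close> contracts the complex in degree \<open>a\<close>.\<close>

lemma bd_contr:
  assumes S: "S \<subseteq> {..<r}" and a: "dividing a \<noteq> {}"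
  shows "coef (bd (contr u)) S a + coef (contr (bd u)) S a = coef u S a"
proof -
  let ?j = "Min (dividing a)"
  note j = Min_dividing[OF a]
  \<comment> \<open>A nonzero coefficient forces all elements of \<open>T'\<close> to divide
    \<open>a\<close>, so none of them is below the minimum \<open>?j\<close> and the sign is
    +1.\<close>
  have sg: "sign ?j T * coef u T' a = coef u T' a" if "T \<subseteq> T'" "T' \<subseteq> {..<r}" for T T'
  proof (cases "coef u T' a = 0")
    case False
    then have "{s \<in> T. s < ?j} = {}" using coef_dividing[OF False that(2)] that(1) j(2) by (auto simp: not_less)
    then have "sign ?j T = 1" unfolding sign_def by (simp only: card.empty power_0)
    then show ?thesis by simp
  qed simp
  have cb: "coef (bd (contr u)) S a = (\<Sum>t\<in>{..<r} - S. sign t S * (if ?j \<in> insert t S then coef u (insert t S - {?j}) a else 0))"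
    unfolding coef_bd[OF S] using S a by (intro sum.cong refl arg_cong[of _ _ "(*) _"]) (simp add: coef_contr)
  show ?thesis
  \<comment> \<open>If \<open>?j\<close> is outside \<open>S\<close>, only \<open>t = ?j\<close>
    contributes to the first summand and the second is 0. If it is in \<open>S\<close>, the boundary
    at \<open>S - {?j}\<close> has the term \<open>t = ?j\<close>, which is \<open>u S\<close>; the
    other terms cancel against the first summand, since \<open>?j < t\<close> reverses the sign of
    \<open>t\<close>.\<close>
  proof (cases "?j \<in> S")
    case False
    have "coef (bd (contr u)) S a = (\<Sum>t\<in>{..<r} - S. if t = ?j then sign ?j S * coef u S a else 0)"
      unfolding cb using False by (intro sum.cong) auto
    also have "\<dots> = coef u S a" using False j(3) sg[OF order_refl S] by simp
    finally show ?thesis using False S by (simp add: coef_contr)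
  next
    case True
    define S' where "S' = S - {?j}"
    have S': "S = insert ?j S'" "?j \<notin> S'" "S' \<subseteq> {..<r}" "finite S'"
      using True S finite_gens[OF S] by (auto simp: S'_def)
    have "coef (contr (bd u)) S a = coef (bd u) S' a" using True a S by (simp add: coef_contr S'_def)
    also have "\<dots> = (\<Sum>t\<in>insert ?j ({..<r} - S). sign t S' * coef u (insert t S') a)"
      unfolding coef_bd[OF S'(3)] using S' j(3) by (intro sum.cong) auto
    also have "\<dots> = coef u S a + (\<Sum>t\<in>{..<r} - S. sign t S' * coef u (insert t S') a)"
      using True sg[of S' S] S' S by (subst sum.insert) auto
    finally have 1: "coef (contr (bd u)) S a = \<dots>" .
    have "coef (bd (contr u)) S a = (\<Sum>t\<in>{..<r} - S. - (sign t S' * coef u (insert t S') a))"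
      unfolding cb
    proof (rule sum.cong[OF refl])
      fix t assume t: "t \<in> {..<r} - S"
      then have eq: "insert t S - {?j} = insert t S'" using True by (auto simp: S'_def)
      have "sign t S * coef u (insert t S') a = - (sign t S' * coef u (insert t S') a)"
      proof (cases "coef u (insert t S') a = 0")
        case False
        then have "t \<in> dividing a" using coef_dividing[OF False] t S' by auto
        then have "?j < t" using j(2)[of t] t True by (metis DiffD2 order_le_neq_trans)
        then show ?thesis using S' sign_insert[of ?j S' t] by simp
      qed simp
      then show "sign t S * (if ?j \<in> insert t S then coef u (insert t S - {?j}) a else 0) =
          - (sign t S' * coef u (insert t S') a)"
        using True by (simp add: eq)
    qed
    then show ?thesis using 1 by (simp add: sum_negf)
  qed
qed

text \<open>In a degree that no generator divides there is no vertex to cone from. Hypothesis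
  \<open>div\<close> says that \<open>u\<close> vanishes there; elsewhere the contraction identity
  applies with its boundary term gone.\<close>

lemma bd_exact:
  assumes bd: "\<And>S. S \<subseteq> {..<r} \<Longrightarrow> bd u S = 0"
    and div: "\<And>S a. S \<subseteq> {..<r} \<Longrightarrow> coef u S a \<noteq> 0 \<Longrightarrow> dividing a \<noteq> {}"
    and S: "S \<subseteq> {..<r}"
  shows "bd (contr u) S = u S"
proof (rule coef_eqI)
  fix a
  show "coef (bd (contr u)) S a = coef u S a"
  proof (cases "dividing a = {}")
    case True
    then have "coef (bd (contr u)) S a = 0"
      unfolding coef_bd[OF S] using S by (intro sum.neutral) (auto simp: coef_contr)
    then show ?thesis using div[OF S, of a] True by auto
  next
    case False
    have "bd u (S - {Min (dividing a)}) = 0" using S by (intro bd) auto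
    then have "coef (bd u) (S - {Min (dividing a)}) a = 0" by (simp add: coef_def)
    then have "coef (contr (bd u)) S a = 0" using S by (simp add: coef_contr)
    then show ?thesis using bd_contr[OF S False, of u] by simp
  qed
qed

subsection \<open>The complex of free modules\<close>

definition D :: "nat \<Rightarrow> 'v multideg list" where
  "D i = map L (xs i)"

text \<open>Free modules consist of sequences, whereas the boundary works on families over all
  subsets at once. The list \<open>xs i\<close> translates position \<open>k\<close> into a subset
  of size \<open>i\<close>; families are extended by zero to the other sizes.\<close>

definition to_sets :: "nat \<Rightarrow> (nat \<Rightarrow> ('v, 'k) mpoly) \<Rightarrow> nat set \<Rightarrow> ('v, 'k) mpoly" where
  "to_sets i f T = (if T \<in> set (xs i) then f (THE k. k < length (xs i) \<and> xs i ! k = T) else 0)"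

definition of_sets :: "nat \<Rightarrow> (nat set \<Rightarrow> ('v, 'k) mpoly) \<Rightarrow> nat \<Rightarrow> ('v, 'k) mpoly" where
  "of_sets i u k = (if k < length (xs i) then u (xs i ! k) else 0)"

definition d :: "nat \<Rightarrow> (nat \<Rightarrow> ('v, 'k) mpoly) \<Rightarrow> nat \<Rightarrow> ('v, 'k) mpoly" where
  "d i f = of_sets i (bd (to_sets (Suc i) f))"

definition e :: "(nat \<Rightarrow> ('v, 'k) mpoly) \<Rightarrow> ('v, 'k) mpoly set" where
  "e f = I +>\<^bsub>SX\<^esub> f 0"

lemma length_D: "length (D i) = length (xs i)"
  by (simp add: D_def)

lemma D_nth: "k < length (xs i) \<Longrightarrow> D i ! k = L (xs i ! k)"
  by (simp add: D_def)

lemma xs_nth: "k < length (xs i) \<Longrightarrow> xs i ! k \<subseteq> {..<r} \<and> card (xs i ! k) = i"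
  using xs(2)[of i] nth_mem[of k "xs i"] by auto

lemma xs_0: "xs 0 = [{}]"
proof -
  have "set (xs 0) = {{}}"
    unfolding xs using finite_gens by (auto simp: card_eq_0_iff)
  moreover have "length (xs 0) = card (set (xs 0))" using distinct_card[OF xs(1)] by simp
  ultimately have "length (xs 0) = 1" by simp
  then obtain T where "xs 0 = [T]" by (metis One_nat_def length_0_conv length_Suc_conv)
  then show ?thesis using \<open>set (xs 0) = {{}}\<close> by simp
qed

lemma to_sets_nth: "k < length (xs i) \<Longrightarrow> to_sets i f (xs i ! k) = f k"
  using xs(1)[of i] by (auto simp: to_sets_def nth_eq_iff_index_eq intro!: arg_cong[of _ _ f] the_equality)

lemma to_sets_outside: "\<not> (T \<subseteq> {..<r} \<and> card T = i) \<Longrightarrow> to_sets i f T = 0"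
  by (auto simp: to_sets_def xs)

lemma sets_cases:
  assumes "T \<subseteq> {..<r}" "card T = i"
  obtains k where "k < length (xs i)" "T = xs i ! k"
  using assms xs(2)[of i] by (metis (mono_tags, lifting) in_set_conv_nth mem_Collect_eq)

lemma to_sets_of_sets: "T \<subseteq> {..<r} \<Longrightarrow> card T = i \<Longrightarrow> to_sets i (of_sets i u) T = u T"
  using to_sets_nth[of _ i "of_sets i u"] by (metis of_sets_def sets_cases)

lemma carrier_iff:
  "f \<in> carrier (shifted_free X (D i)) \<longleftrightarrow>
     (\<forall>k<length (xs i). f k \<in> carrier SX) \<and> (\<forall>k\<ge>length (xs i). f k = 0)"
  by (simp add: free_module_def length_D)

lemma of_sets_to_sets: "f \<in> carrier (shifted_free X (D i)) \<Longrightarrow> of_sets i (to_sets i f) = f"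
  by (auto simp: of_sets_def fun_eq_iff to_sets_nth carrier_iff)

lemma to_sets_carrier: "f \<in> carrier (shifted_free X (D i)) \<Longrightarrow> to_sets i f T \<in> carrier SX"
proof (cases "T \<subseteq> {..<r} \<and> card T = i")
  case True
  assume f: "f \<in> carrier (shifted_free X (D i))"
  obtain k where "k < length (xs i)" "T = xs i ! k" by (rule sets_cases[of T i]) (use True in auto)
  then show ?thesis using f by (simp add: to_sets_nth carrier_iff)
qed (simp add: to_sets_outside mpoly_ring_carrier)

lemma of_sets_carrier:
  "(\<And>T. T \<subseteq> {..<r} \<Longrightarrow> card T = i \<Longrightarrow> u T \<in> carrier SX) \<Longrightarrow> of_sets i u \<in> carrier (shifted_free X (D i))"
  using xs_nth by (simp add: carrier_iff of_sets_def)

lemma bd_carrier: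
  assumes u: "\<And>T. u T \<in> carrier SX" and T: "T \<subseteq> {..<r}"
  shows "bd u T \<in> carrier SX"
proof -
  have "single (L (insert t T) - L T) (sign t T) * u (insert t T) \<in> carrier SX"
    if "t \<in> {..<r} - T" for t
  proof -
    have "L (insert t T) - L T \<in> multidegs X" using that T by (intro minus_multidegs L_multidegs) auto
    then show ?thesis using S.m_closed[OF single_carrier u, of "L (insert t T) - L T" "sign t T" "insert t T"] by simp
  qed
  then show ?thesis
    unfolding bd_def mpoly_ring_carrier lookup_sum
    by (metis (no_types, lifting) mpoly_ring_carrier sum.neutral)
qed

lemma contr_carrier:
  assumes u: "\<And>T. u T \<in> carrier SX" and T: "T \<subseteq> {..<r}"
  shows "contr u T \<in> carrier SX"
  unfolding mpoly_ring_carrier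
proof (intro allI impI)
  fix c assume "lookup (contr u T) c \<noteq> 0"
  then obtain T' where T': "T' \<subseteq> T" "coef u T' (c + L T) \<noteq> 0"
    unfolding lookup_eq_coef coef_contr[OF T] by (metis Diff_subset)
  then have md: "mdvd (L T') (c + L T)" "lookup (u T') (c + L T - L T') \<noteq> 0"
    by (auto simp: coef_def split: if_splits)
  then have "c + L T - L T' \<in> multidegs X" using u[of T'] by (simp add: mpoly_ring_carrier)
  then have "(c + L T - L T') + L T' \<in> multidegs X" using T T' by (intro multidegs_add L_multidegs) auto
  then have "c + L T \<in> multidegs X" using md by (simp add: mdvd_iff_minus)
  then show "c \<in> multidegs X" using minus_multidegs[of "c + L T" X "L T"] by simp
qed

lemma d_hom: "d i \<in> mod_hom SX (shifted_free X (D (Suc i))) (shifted_free X (D i))"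
proof (rule mod_homI)
  show "d i f \<in> carrier (shifted_free X (D i))" if "f \<in> carrier (shifted_free X (D (Suc i)))" for f
    unfolding d_def using bd_carrier to_sets_carrier[OF that] by (intro of_sets_carrier) auto
  have "to_sets (Suc i) (f + g) = to_sets (Suc i) f + to_sets (Suc i) g" for f g
    by (auto simp: to_sets_def)
  moreover have "bd (u + v) = bd u + bd v" for u v
    by (simp add: bd_def fun_eq_iff distrib_left sum.distrib)
  moreover have "of_sets i (u + v) = of_sets i u + of_sets i v" for u v
    by (auto simp: of_sets_def)
  ultimately show "d i (f \<oplus>\<^bsub>shifted_free X (D (Suc i))\<^esub> g) = d i f \<oplus>\<^bsub>shifted_free X (D i)\<^esub> d i g" for f g
    by (simp add: d_def)
  have "to_sets (Suc i) (\<lambda>k. p * f k) = (\<lambda>T. p * to_sets (Suc i) f T)" for p f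
    by (auto simp: to_sets_def)
  moreover have "bd (\<lambda>T. p * u T) = (\<lambda>T. p * bd u T)" for p u
    by (simp add: bd_def fun_eq_iff sum_distrib_left mult.left_commute)
  moreover have "of_sets i (\<lambda>T. p * u T) = (\<lambda>k. p * of_sets i u k)" for p u
    by (auto simp: of_sets_def)
  ultimately show "d i (p \<odot>\<^bsub>shifted_free X (D (Suc i))\<^esub> f) = p \<odot>\<^bsub>shifted_free X (D i)\<^esub> d i f" for p f
    by (simp add: d_def)
qed

lemma e_hom: "e \<in> mod_hom SX (shifted_free X (D 0)) M"
  by (rule mod_homI) (auto simp: e_def carrier_M carrier_iff xs_0 M_ops)

lemma component_iff:
  "f \<in> shifted_free_component X (D i) a \<longleftrightarrow> f \<in> carrier (shifted_free X (D i)) \<and>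
     (\<forall>T b. T \<subseteq> {..<r} \<longrightarrow> card T = i \<longrightarrow> coef (to_sets i f) T b \<noteq> 0 \<longrightarrow> b = a)"
proof -
  have "(\<forall>c. lookup (f k) c \<noteq> 0 \<longrightarrow> c + D i ! k = a) \<longleftrightarrow> (\<forall>b. coef (to_sets i f) (xs i ! k) b \<noteq> 0 \<longrightarrow> b = a)"
    if k: "k < length (xs i)" for k
  proof -
    have l: "lookup (f k) c = coef (to_sets i f) (xs i ! k) (c + D i ! k)" for c
      using lookup_eq_coef[of "to_sets i f" "xs i ! k" c] k by (simp add: to_sets_nth D_nth)
    have "\<exists>c. b = c + D i ! k" if "coef (to_sets i f) (xs i ! k) b \<noteq> 0" for b
      using that k by (auto simp: coef_def D_nth mdvd_iff_minus intro!: exI[of _ "b - L (xs i ! k)"] split: if_splits)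
    then show ?thesis unfolding l by metis
  qed
  then show ?thesis
    unfolding shifted_iff by (metis length_D sets_cases xs_nth)
qed

lemma d_component: "d i ` shifted_free_component X (D (Suc i)) a \<subseteq> shifted_free_component X (D i) a"
proof (rule image_subsetI)
  fix f :: "nat \<Rightarrow> ('v, 'k) mpoly"
  assume f: "f \<in> shifted_free_component X (D (Suc i)) a"
  then have fc: "f \<in> carrier (shifted_free X (D (Suc i)))" by (simp add: shifted_iff)
  have "b = a" if T: "T \<subseteq> {..<r}" "card T = i" "coef (to_sets i (d i f)) T b \<noteq> 0" for T b
  proof -
    have "coef (bd (to_sets (Suc i) f)) T b \<noteq> 0"
      using T(3) unfolding d_def coef_def to_sets_of_sets[OF T(1,2)] .
    then obtain t where t: "t \<in> {..<r} - T" "coef (to_sets (Suc i) f) (insert t T) b \<noteq> 0"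
      unfolding coef_bd[OF T(1)] by (metis (no_types, lifting) mult_zero_right sum.neutral)
    have "insert t T \<subseteq> {..<r}" "card (insert t T) = Suc i" using T t finite_gens by auto
    then show ?thesis using f t(2) unfolding component_iff by blast
  qed
  then show "d i f \<in> shifted_free_component X (D i) a"
    unfolding component_iff using mod_homD(1)[OF d_hom fc] by blast
qed

text \<open>Coning raises sizes by one, so the contraction of a family on sets of size
  \<open>i\<close> lives on size \<open>Suc i\<close> and comes from a sequence. The boundary of
  \<open>u\<close> can be nonzero only at sets of one size less than \<open>i\<close>, which is why
  \<open>bd\<close> is required only there, and is vacuous for \<open>i = 0\<close>.\<close>

lemma exact_step:
  assumes f: "f \<in> carrier (shifted_free X (D i))"
    and bd: "\<And>T. T \<subseteq> {..<r} \<Longrightarrow> Suc (card T) = i \<Longrightarrow> bd (to_sets i f) T = 0"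
    and div: "\<And>T a. T \<subseteq> {..<r} \<Longrightarrow> coef (to_sets i f) T a \<noteq> 0 \<Longrightarrow> dividing a \<noteq> {}"
  shows "\<exists>g\<in>carrier (shifted_free X (D (Suc i))). d i g = f"
proof
  let ?u = "to_sets i f"
  let ?g = "of_sets (Suc i) (contr ?u)"
  show "?g \<in> carrier (shifted_free X (D (Suc i)))"
    using contr_carrier to_sets_carrier[OF f] by (intro of_sets_carrier) auto
  have z: "contr ?u T = 0" if T: "T \<subseteq> {..<r}" "card T \<noteq> Suc i" for T
  proof -
    have "coef ?u (T - {j}) a = 0" if "j \<in> T" for j a
    proof -
      have "card (T - {j}) \<noteq> i" using T that finite_gens[OF T(1)] by (metis card_Suc_Diff1)
      then show ?thesis by (simp add: coef_def to_sets_outside)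
    qed
    then have "coef (contr ?u) T a = 0" for a
      unfolding coef_contr[OF T(1)] by simp
    then show ?thesis using coef_eqI[of "contr ?u" T "\<lambda>_. 0"] by (simp add: coef_def)
  qed
  have "to_sets (Suc i) ?g T = contr ?u T" if "T \<subseteq> {..<r}" for T
    using that z to_sets_of_sets to_sets_outside by (cases "card T = Suc i") auto
  then have "bd (to_sets (Suc i) ?g) T = bd (contr ?u) T" if "T \<subseteq> {..<r}" for T
    unfolding bd_def using that by (intro sum.cong) auto
  moreover have "bd (contr ?u) T = ?u T" if "T \<subseteq> {..<r}" for T
  proof (rule bd_exact[OF _ div that])
    fix T assume T: "T \<subseteq> {..<r}"
    show "bd ?u T = 0"
    proof (cases "Suc (card T) = i")
      case False
      have "?u (insert t T) = 0" if "t \<in> {..<r} - T" for t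
        using that T False finite_gens[OF T] by (intro to_sets_outside) auto
      then show ?thesis unfolding bd_def by (intro sum.neutral) auto
    qed (rule bd[OF T])
  qed
  ultimately have "d i ?g = of_sets i ?u"
    unfolding d_def of_sets_def using xs_nth by auto
  then show "d i ?g = f" by (simp add: of_sets_to_sets[OF f])
qed

lemma taylor_resolution: "graded_free_resolution X M G D d e"
  unfolding graded_free_resolution_def resolution_def
proof (intro conjI allI shifted_module e_hom d_hom d_component)
  show "set (D i) \<subseteq> multidegs X" for i
    using L_multidegs xs(2) by (auto simp: D_def)
  show "e ` carrier (shifted_free X (D 0)) = carrier M"
  proof
    show "e ` carrier (shifted_free X (D 0)) \<subseteq> carrier M" using mod_homD(1)[OF e_hom] by blast
    show "carrier M \<subseteq> e ` carrier (shifted_free X (D 0))"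
    proof
      fix x assume "x \<in> carrier M"
      then obtain f where f: "f \<in> carrier SX" "x = I +>\<^bsub>SX\<^esub> f" unfolding carrier_M by blast
      then show "x \<in> e ` carrier (shifted_free X (D 0))"
        by (intro image_eqI[of _ _ "\<lambda>k. if k = 0 then f else 0"]) (auto simp: e_def carrier_iff xs_0)
    qed
  qed
  show "d 0 ` carrier (shifted_free X (D 1)) = {x \<in> carrier (shifted_free X (D 0)). e x = \<zero>\<^bsub>M\<^esub>}"
  proof (intro equalityI subsetI)
    fix x assume "x \<in> d 0 ` carrier (shifted_free X (D 1))"
    then obtain f where f: "f \<in> carrier (shifted_free X (D 1))" "x = d 0 f" by blast
    have xc: "x \<in> carrier (shifted_free X (D 0))" using mod_homD(1)[OF d_hom, of f 0] f by simp
    have x0: "x 0 = bd (to_sets 1 f) {}" using f by (simp add: d_def of_sets_def xs_0)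
    have "\<exists>b\<in>B. mdvd b a" if "lookup (x 0) a \<noteq> 0" for a
    proof -
      have "coef (bd (to_sets 1 f)) {} a \<noteq> 0" using that x0 lookup_eq_coef[of "bd (to_sets 1 f)" "{}" a] by simp
      then obtain t where t: "t \<in> {..<r}" "coef (to_sets 1 f) {t} a \<noteq> 0"
        unfolding coef_bd[OF empty_subsetI] by (metis (no_types, lifting) Diff_empty mult_zero_right sum.neutral)
      then have "t \<in> dividing a" using coef_dividing[OF t(2)] by auto
      then show ?thesis using t mB by (auto simp: dividing_def)
    qed
    then have "x 0 \<in> I" using xc by (auto simp: monomial_ideal_iff[OF B] carrier_iff xs_0)
    then show "x \<in> {x \<in> carrier (shifted_free X (D 0)). e x = \<zero>\<^bsub>M\<^esub>}"
      using xc coset_zero_iff[of "x 0"] by (auto simp: e_def carrier_iff xs_0)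
  next
    fix x assume x: "x \<in> {x \<in> carrier (shifted_free X (D 0)). e x = \<zero>\<^bsub>M\<^esub>}"
    then have "x 0 \<in> carrier SX" by (auto simp: carrier_iff xs_0)
    then have xI: "x 0 \<in> I" using x coset_zero_iff[of "x 0"] by (auto simp: e_def)
    \<comment> \<open>Only here does the ideal enter: membership of \<open>x 0\<close> provides a
      generator dividing each of its exponents, which is the \<open>div\<close> condition in
      position 0.\<close>
    have "\<exists>g\<in>carrier (shifted_free X (D (Suc 0))). d 0 g = x"
    proof (rule exact_step)
      fix T a assume T: "T \<subseteq> {..<r}" "coef (to_sets 0 x) T a \<noteq> 0"
      have "T = {}"
      proof (rule ccontr)
        assume "T \<noteq> {}"
        then have "card T \<noteq> 0" using finite_gens[OF T(1)] by simp
        then have "to_sets 0 x T = 0" by (intro to_sets_outside) simp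
        then show False using T(2) by (simp add: coef_def split: if_splits)
      qed
      then have "lookup (x 0) a \<noteq> 0"
        using T to_sets_nth[of 0 0 x] by (simp add: coef_def xs_0 split: if_splits)
      then obtain b where "b \<in> B" "mdvd b a" using xI unfolding monomial_ideal_iff[OF B] by blast
      then show "dividing a \<noteq> {}" using mB by (auto simp: dividing_def)
    qed (use x in auto)
    then show "x \<in> d 0 ` carrier (shifted_free X (D 1))" by auto
  qed
  show "d (Suc i) ` carrier (shifted_free X (D (Suc (Suc i)))) =
      {x \<in> carrier (shifted_free X (D (Suc i))). d i x = \<zero>\<^bsub>shifted_free X (D i)\<^esub>}" for i
  proof (intro equalityI subsetI)
    fix x assume "x \<in> d (Suc i) ` carrier (shifted_free X (D (Suc (Suc i))))"
    then obtain f where f: "f \<in> carrier (shifted_free X (D (Suc (Suc i))))" "x = d (Suc i) f" by blast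
    have "to_sets (Suc i) x T = bd (to_sets (Suc (Suc i)) f) T" if "T \<subseteq> {..<r}" "card T = Suc i" for T
      using that f by (simp add: d_def to_sets_of_sets)
    then have "bd (to_sets (Suc i) x) T = bd (bd (to_sets (Suc (Suc i)) f)) T" if "T \<subseteq> {..<r}" "card T = i" for T
      unfolding bd_def[of _ T] using that finite_gens by (intro sum.cong) auto
    then have "d i x = 0"
      using xs_nth bd_bd by (auto simp: d_def of_sets_def fun_eq_iff)
    then show "x \<in> {x \<in> carrier (shifted_free X (D (Suc i))). d i x = \<zero>\<^bsub>shifted_free X (D i)\<^esub>}"
      using mod_homD(1)[OF d_hom f(1)] f(2) by simp
  next
    fix x assume x: "x \<in> {x \<in> carrier (shifted_free X (D (Suc i))). d i x = \<zero>\<^bsub>shifted_free X (D i)\<^esub>}"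
    have "\<exists>g\<in>carrier (shifted_free X (D (Suc (Suc i)))). d (Suc i) g = x"
    proof (rule exact_step)
      fix T assume T: "T \<subseteq> {..<r}"
      { assume "Suc (card T) = Suc i"
        then obtain k where k: "k < length (xs i)" "T = xs i ! k" using sets_cases[OF T, of i] by auto
        have "d i x k = 0" using x by simp
        then show "bd (to_sets (Suc i) x) T = 0" using k by (simp add: d_def of_sets_def) }
      fix a assume c: "coef (to_sets (Suc i) x) T a \<noteq> 0"
      \<comment> \<open>In later positions a nonzero coefficient sits on a nonempty set, whose
        elements themselves divide \<open>a\<close>.\<close>
      have "card T = Suc i"
      proof (rule ccontr)
        assume "card T \<noteq> Suc i"
        then have "to_sets (Suc i) x T = 0" by (intro to_sets_outside) simp
        then show False using c by (simp add: coef_def split: if_splits)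
      qed
      then show "dividing a \<noteq> {}" using coef_dividing[OF c T] by auto
    qed (use x in auto)
    then show "x \<in> d (Suc i) ` carrier (shifted_free X (D (Suc (Suc i))))" by auto
  qed
  show "e ` shifted_free_component X (D 0) a \<subseteq> G a" for a
  proof (rule image_subsetI)
    fix f :: "nat \<Rightarrow> ('v, 'k) mpoly"
    assume "f \<in> shifted_free_component X (D 0) a"
    then have "f \<in> carrier (shifted_free X (D 0))" "\<forall>m. lookup (f 0) m \<noteq> 0 \<longrightarrow> m = a"
      unfolding shifted_iff length_D xs_0 by (auto simp: D_nth xs_0)
    then have "f 0 \<in> mpoly_component X a"
      by (simp add: carrier_iff xs_0 mpoly_component_iff)
    then show "e f \<in> G a" unfolding e_def monomial_quotient_component_def by blast
  qed
qed

end

section \<open>Projective dimension\<close>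

lemma (in abelian_group) minus_zero_right: "x \<in> carrier G \<Longrightarrow> x \<ominus> \<zero> = x"
  by (simp add: a_minus_def)

lemma mod_hom_restrict:
  "f \<in> mod_hom R M N \<Longrightarrow> A \<subseteq> carrier M \<Longrightarrow> f ` A \<subseteq> B \<Longrightarrow>
   f \<in> mod_hom R (M\<lparr>carrier := A\<rparr>) (N\<lparr>carrier := B\<rparr>)"
  unfolding mod_hom_def by (auto simp: subset_iff image_subset_iff)

text \<open>A direct summand of a projective module: extend \<open>f\<close> to \<open>F\<close> by
  composing with \<open>\<pi>\<close>, lift there, and restrict the lift, using that
  \<open>\<pi>\<close> is the identity on its image.\<close>

lemma projective_retract:
  assumes F: "projective_module R F" and \<pi>: "\<pi> \<in> mod_hom R F F"
    and idem: "\<And>x. x \<in> carrier F \<Longrightarrow> \<pi> (\<pi> x) = \<pi> x"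
  shows "projective_module R (F\<lparr>carrier := \<pi> ` carrier F\<rparr>)"
proof -
  let ?C = "F\<lparr>carrier := \<pi> ` carrier F\<rparr>"
  have Fm: "Module.module R F" using F by (simp add: projective_module_def)
  have sub: "\<pi> ` carrier F \<subseteq> carrier F" using mod_homD(1)[OF \<pi>] by blast
  show ?thesis
    unfolding projective_module_def
  proof (intro conjI allI impI, goal_cases)
    case 1
    show ?case by (rule image_module[OF \<pi> Fm Fm])
  next
    case (2 N N' g f)
    have \<pi>': "\<pi> \<in> mod_hom R F ?C" using \<pi> unfolding mod_hom_def by auto
    have f: "f \<in> mod_hom R ?C N'" using 2 by blast
    have "(\<lambda>x. f (\<pi> x)) \<in> mod_hom R F N'" by (rule mod_hom_comp[OF \<pi>' f])
    then obtain h where h: "h \<in> mod_hom R F N" "\<And>x. x \<in> carrier F \<Longrightarrow> g (h x) = f (\<pi> x)"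
      using F[unfolded projective_module_def, THEN conjunct2, rule_format, of N N' g "\<lambda>x. f (\<pi> x)"] 2 by blast
    have "h \<in> mod_hom R ?C N" using mod_hom_restrict[OF h(1) sub, of "carrier N"] mod_homD(1)[OF h(1)] sub by auto
    moreover have "g (h x) = f x" if "x \<in> carrier ?C" for x
      using that h(2) idem sub by auto
    ultimately show ?case by blast
  qed
qed

text \<open>By \<open>d h d = d\<close> the map \<open>\<pi> = 1 - d h\<close> is idempotent,
  vanishes on the image of \<open>d n\<close>, and differs from the identity by values in that
  image. So \<open>F n\<close> is the direct sum of that image and of \<open>\<pi> F n\<close>; the
  latter replaces \<open>F n\<close>, and everything above it becomes zero.\<close>

lemma split_syzygy_projective_resolution:
  fixes F :: "nat \<Rightarrow> ('a, nat \<Rightarrow> 'a) module"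
  assumes M: "Module.module R M" and res: "resolution R M F d e" and proj: "\<And>i. projective_module R (F i)"
    and h: "h \<in> mod_hom R (F n) (F (Suc n))"
    and dhd: "\<And>x. x \<in> carrier (F (Suc n)) \<Longrightarrow> d n (h (d n x)) = d n x"
  shows "has_projective_resolution_of_length_le R M n"
proof -
  note rD = resolutionD[OF res]
  define \<pi> where "\<pi> = (\<lambda>x. x \<ominus>\<^bsub>F n\<^esub> d n (h x))"
  have \<pi>: "\<pi> \<in> mod_hom R (F n) (F n)"
    unfolding \<pi>_def by (intro mod_hom_diff mod_hom_id mod_hom_comp[OF h rD(3)] rD(1))
  interpret Fn: Module.module R "F n" by (rule rD(1))
  note hc = mod_homD(1)[OF h] and dc = mod_homD(1)[OF rD(3)]
  have \<pi>c: "\<pi> x \<in> carrier (F n)" if "x \<in> carrier (F n)" for x by (rule mod_homD(1)[OF \<pi> that])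
  have \<pi>d: "\<pi> (d n x) = \<zero>\<^bsub>F n\<^esub>" if "x \<in> carrier (F (Suc n))" for x
    using dhd[OF that] dc[OF that] by (simp add: \<pi>_def)
  have idem: "\<pi> (\<pi> x) = \<pi> x" if x: "x \<in> carrier (F n)" for x
  proof -
    have "\<pi> (\<pi> x) = \<pi> x \<ominus>\<^bsub>F n\<^esub> \<pi> (d n (h x))"
      by (subst (2) \<pi>_def) (rule mod_hom_minus[OF \<pi> rD(1) rD(1) x dc[OF hc[OF x]]])
    then show ?thesis using \<pi>d[OF hc[OF x]] \<pi>c[OF x] by (simp add: a_minus_def)
  qed
  \<comment> \<open>A homomorphism that kills \<open>d n (h x)\<close> takes the same value at
    \<open>x\<close> and at \<open>\<pi> x\<close>; it will be the augmentation or the next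
    differential.\<close>
  have \<epsilon>: "f (\<pi> x) = f x"
    if f: "f \<in> mod_hom R (F n) N" and N: "Module.module R N" and fd: "f (d n (h x)) = \<zero>\<^bsub>N\<^esub>" and x: "x \<in> carrier (F n)"
    for f x and N :: "('a, 'c) module"
  proof -
    interpret N: Module.module R N by (rule N)
    have "f (\<pi> x) = f x \<ominus>\<^bsub>N\<^esub> f (d n (h x))"
      unfolding \<pi>_def by (rule mod_hom_minus[OF f rD(1) N x dc[OF hc[OF x]]])
    then show ?thesis using fd mod_homD(1)[OF f x] by (simp add: a_minus_def)
  qed
  have e\<pi>: "e (\<pi> x) = e x" if n: "n = 0" and x: "x \<in> carrier (F n)" for x
  proof (rule \<epsilon>[OF _ M _ x])
    have "d 0 (h x) \<in> {x \<in> carrier (F 0). e x = \<zero>\<^bsub>M\<^esub>}"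
      unfolding rD(5)[symmetric] using hc[OF x] n by auto
    then show "e (d n (h x)) = \<zero>\<^bsub>M\<^esub>" using n by simp
  qed (use rD(2) n in simp)
  have d\<pi>: "d i (\<pi> x) = d i x" if n: "n = Suc i" and x: "x \<in> carrier (F n)" for i x
  proof (rule \<epsilon>[OF _ rD(1) _ x])
    have "d (Suc i) (h x) \<in> {x \<in> carrier (F (Suc i)). d i x = \<zero>\<^bsub>F i\<^esub>}"
      unfolding rD(6)[symmetric] using hc[OF x] n by auto
    then show "d i (d n (h x)) = \<zero>\<^bsub>F i\<^esub>" using n by simp
  qed (use rD(3) n in simp)
  have zero: "\<pi> \<zero>\<^bsub>F n\<^esub> = \<zero>\<^bsub>F n\<^esub>" by (rule mod_hom_zero[OF \<pi> rD(1) rD(1)])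
  \<comment> \<open>The two summands meet in zero only: \<open>\<pi>\<close> fixes its own image and
    kills that of \<open>d n\<close>.\<close>
  have im0: "x = \<zero>\<^bsub>F n\<^esub>" if x: "x \<in> \<pi> ` carrier (F n)" and im: "x \<in> d n ` carrier (F (Suc n))" for x
  proof -
    obtain y z where "y \<in> carrier (F n)" "x = \<pi> y" "z \<in> carrier (F (Suc n))" "x = d n z" using x im by blast
    then show ?thesis using idem[of y] \<pi>d[of z] by simp
  qed
  define A where "A i = (if i < n then carrier (F i) else if i = n then \<pi> ` carrier (F n) else {\<zero>\<^bsub>F i\<^esub>})" for i
  define F' where "F' i = F i\<lparr>carrier := A i\<rparr>" for i
  define d' where "d' i = (if i < n then d i else (\<lambda>_. \<zero>\<^bsub>F i\<^esub>))" for i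
  have A0: "\<zero>\<^bsub>F i\<^esub> \<in> A i" for i
  proof -
    interpret Module.module R "F i" by (rule rD(1))
    show ?thesis using zero by (auto simp: A_def image_iff intro!: bexI[of _ "\<zero>\<^bsub>F n\<^esub>"])
  qed
  have A: "A i \<subseteq> carrier (F i)" for i
  proof -
    interpret Module.module R "F i" by (rule rD(1))
    show ?thesis using \<pi>c by (auto simp: A_def)
  qed
  have projF': "projective_module R (F' i)" for i
  proof -
    interpret Module.module R "F i" by (rule rD(1))
    have z: "(\<lambda>_. \<zero>\<^bsub>F i\<^esub>) \<in> mod_hom R (F i) (F i)" by (rule mod_homI) auto
    have "(\<lambda>_. \<zero>\<^bsub>F i\<^esub>) ` carrier (F i) = {\<zero>\<^bsub>F i\<^esub>}" by auto
    \<comment> \<open>The zero module is the retract of \<open>F i\<close> along the zero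
      endomorphism.\<close>
    then have "projective_module R (F i\<lparr>carrier := {\<zero>\<^bsub>F i\<^esub>}\<rparr>)"
      using projective_retract[OF proj z] by simp
    moreover have "projective_module R (F n\<lparr>carrier := \<pi> ` carrier (F n)\<rparr>)"
      by (rule projective_retract[OF proj \<pi> idem])
    ultimately show ?thesis using proj[of i] by (simp add: F'_def A_def)
  qed
  have "resolution R M F' d' e"
    unfolding resolution_def
  proof (intro conjI allI)
    show "Module.module R (F' i)" for i using projF' by (simp add: projective_module_def)
    show "e \<in> mod_hom R (F' 0) M"
      using mod_hom_restrict[OF rD(2) A, of "carrier M"] mod_homD(1)[OF rD(2)] A[of 0] by (auto simp: F'_def)
    show "d' i \<in> mod_hom R (F' (Suc i)) (F' i)" for i
    proof (cases "i < n")
      case True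
      then have "A i = carrier (F i)" by (simp add: A_def)
      moreover have "d i x \<in> carrier (F i)" if "x \<in> A (Suc i)" for x
        by (rule dc[OF subsetD[OF A that]])
      ultimately have "d i ` A (Suc i) \<subseteq> A i" by blast
      then show ?thesis using mod_hom_restrict[OF rD(3) A] True by (simp add: F'_def d'_def)
    next
      case False
      interpret Module.module R "F i" by (rule rD(1))
      show ?thesis using False A0 by (intro mod_homI) (auto simp: F'_def d'_def)
    qed
    show "e ` carrier (F' 0) = carrier M"
      using e\<pi> rD(4) by (cases "n = 0") (auto simp: F'_def A_def image_image)
    show "d' 0 ` carrier (F' 1) = {x \<in> carrier (F' 0). e x = \<zero>\<^bsub>M\<^esub>}"
    proof -
      \<comment> \<open>For \<open>n = 0\<close> the incoming map is zero and \<open>e\<close> must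
        be injective on the summand; for \<open>n = 1\<close> the source shrinks without changing
        the image; beyond that, this place of the complex is untouched.\<close>
      consider "n = 0" | "n = 1" | "n > 1" by linarith
      then show ?thesis
      proof cases
        case 1
        have "x = \<zero>\<^bsub>F 0\<^esub>" if "x \<in> \<pi> ` carrier (F 0)" "e x = \<zero>\<^bsub>M\<^esub>" for x
        proof -
          have "x \<in> {x \<in> carrier (F 0). e x = \<zero>\<^bsub>M\<^esub>}" using that 1 \<pi>c by auto
          then show ?thesis using im0[of x] that 1 unfolding rD(5)[symmetric] by simp
        qed
        moreover have "e \<zero>\<^bsub>F 0\<^esub> = \<zero>\<^bsub>M\<^esub>" by (rule mod_hom_zero[OF rD(2) rD(1) M])
        moreover have "\<zero>\<^bsub>F 0\<^esub> \<in> \<pi> ` carrier (F 0)" using A0[of 0] 1 by (simp add: A_def)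
        ultimately have "{x \<in> \<pi> ` carrier (F 0). e x = \<zero>\<^bsub>M\<^esub>} = {\<zero>\<^bsub>F 0\<^esub>}" by blast
        then show ?thesis using 1 by (simp add: F'_def d'_def A_def)
      next
        case 2
        have "d 0 ` \<pi> ` carrier (F n) = d 0 ` carrier (F n)"
          unfolding image_image using d\<pi>[of 0] 2 by (intro image_cong) auto
        then show ?thesis using 2 rD(5) by (simp add: F'_def d'_def A_def)
      next
        case 3
        then show ?thesis using rD(5) by (simp add: F'_def d'_def A_def)
      qed
    qed
    show "d' (Suc i) ` carrier (F' (Suc (Suc i))) = {x \<in> carrier (F' (Suc i)). d' i x = \<zero>\<^bsub>F' i\<^esub>}" for i
    proof -
      consider "n \<le> i" | "n = Suc i" | "n = Suc (Suc i)" | "n > Suc (Suc i)" by linarith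
      then show ?thesis
      proof cases
        case 1
        then show ?thesis by (auto simp: F'_def d'_def A_def)
      next
        case 2
        have "x = \<zero>\<^bsub>F (Suc i)\<^esub>" if "x \<in> \<pi> ` carrier (F (Suc i))" "d i x = \<zero>\<^bsub>F i\<^esub>" for x
        proof -
          have "x \<in> {x \<in> carrier (F (Suc i)). d i x = \<zero>\<^bsub>F i\<^esub>}" using that 2 \<pi>c by auto
          then show ?thesis using im0[of x] that 2 unfolding rD(6)[symmetric] by simp
        qed
        moreover have "d i \<zero>\<^bsub>F (Suc i)\<^esub> = \<zero>\<^bsub>F i\<^esub>" by (rule mod_hom_zero[OF rD(3) rD(1) rD(1)])
        moreover have "\<zero>\<^bsub>F (Suc i)\<^esub> \<in> \<pi> ` carrier (F (Suc i))" using A0[of "Suc i"] 2 by (simp add: A_def)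
        ultimately have "{x \<in> \<pi> ` carrier (F (Suc i)). d i x = \<zero>\<^bsub>F i\<^esub>} = {\<zero>\<^bsub>F (Suc i)\<^esub>}" by blast
        then show ?thesis using 2 by (simp add: F'_def d'_def A_def)
      next
        case 3
        have "d (Suc i) ` \<pi> ` carrier (F n) = d (Suc i) ` carrier (F n)"
          unfolding image_image using d\<pi>[of "Suc i"] 3 by (intro image_cong) auto
        then show ?thesis using 3 rD(6) by (simp add: F'_def d'_def A_def)
      next
        case 4
        then show ?thesis using rD(6) by (simp add: F'_def d'_def A_def)
      qed
    qed
  qed
  moreover have "\<forall>i>n. carrier (F' i) = {\<zero>\<^bsub>F' i\<^esub>}" by (auto simp: F'_def A_def)
  ultimately show ?thesis unfolding has_projective_resolution_of_length_le_def using projF' by blast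
qed

text \<open>Let \<open>P\<close> be the short resolution. The composite of the comparison maps to
  \<open>P\<close> and back is homotopic to the identity, and it is zero at \<open>F (Suc n)\<close>
  because \<open>P (Suc n)\<close> is zero. Hence \<open>x = d (h' x) + h (d x)\<close> there, and
  applying \<open>d n\<close> removes the first summand.\<close>

lemma projective_resolution_syzygy_split:
  fixes F :: "nat \<Rightarrow> ('a, nat \<Rightarrow> 'a) module"
  assumes M: "Module.module R M" and res: "resolution R M F d e" and proj: "\<And>i. projective_module R (F i)"
    and len: "has_projective_resolution_of_length_le R M n"
  obtains h where "h \<in> mod_hom R (F n) (F (Suc n))"
    "\<And>x. x \<in> carrier (F (Suc n)) \<Longrightarrow> d n (h (d n x)) = d n x"
proof -
  obtain P :: "nat \<Rightarrow> ('a, nat \<Rightarrow> 'a) module" and dP eP where P: "resolution R M P dP eP"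
    "\<And>i. projective_module R (P i)" "\<And>i. i > n \<Longrightarrow> carrier (P i) = {\<zero>\<^bsub>P i\<^esub>}"
    using len unfolding has_projective_resolution_of_length_le_def by blast
  note rD = resolutionD[OF res] and rP = resolutionD[OF P(1)]
  define \<iota> where "\<iota> = inv_into (carrier (F 0)) e"
  have \<kappa>: "e (\<iota> x) = x" if "x \<in> carrier M" for x
  proof -
    have "x \<in> e ` carrier (F 0)" using that rD(4) by simp
    then show ?thesis unfolding \<iota>_def by (rule f_inv_into_f)
  qed
  define C C' where "C = case_nat (transport_module \<iota> e M) F" and "C' = case_nat (transport_module \<iota> e M) P"
  define \<delta> \<delta>' where "\<delta> = case_nat (\<lambda>x. \<iota> (e x)) d" and "\<delta>' = case_nat (\<lambda>x. \<iota> (eP x)) dP"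
  let ?A = "\<lambda>i (_ :: unit). carrier (C i)" and ?A' = "\<lambda>i (_ :: unit). carrier (C' i)"
  have r: "gresolution R C ?A \<delta>"
    unfolding C_def \<delta>_def by (rule resolution_gresolution_trivial[OF M _ res]) (rule \<kappa>)
  have r': "gresolution R C' ?A' \<delta>'"
    unfolding C'_def \<delta>'_def by (rule resolution_gresolution_trivial[OF M _ P(1)]) (rule \<kappa>)
  interpret r: gresolution R C ?A \<delta> by (rule r)
  interpret r': gresolution R C' ?A' \<delta>' by (rule r')
  have Cs: "C (Suc j) = F j" "C' (Suc j) = P j" "\<delta> (Suc j) = d j" for j
    by (simp_all add: C_def C'_def \<delta>_def)
  obtain \<alpha> where \<alpha>: "\<alpha> 0 = (\<lambda>x. x)" "\<And>i. \<alpha> i \<in> ghom R (C i) (?A i) (C' i) (?A' i)"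
    "\<And>i x. x \<in> carrier (C (Suc i)) \<Longrightarrow> \<delta>' i (\<alpha> (Suc i) x) = \<alpha> i (\<delta> i x)"
    by (rule comparison[OF r r']) (simp_all add: C_def C'_def projective_imp_gproj proj rP(1))
  obtain \<beta> where \<beta>: "\<beta> 0 = (\<lambda>x. x)" "\<And>i. \<beta> i \<in> ghom R (C' i) (?A' i) (C i) (?A i)"
    "\<And>i x. x \<in> carrier (C' (Suc i)) \<Longrightarrow> \<delta> i (\<beta> (Suc i) x) = \<beta> i (\<delta>' i x)"
    by (rule comparison[OF r' r]) (simp_all add: C_def C'_def projective_imp_gproj P(2) rD(1))
  have \<beta>\<alpha>: "\<delta> i (\<beta> (Suc i) (\<alpha> (Suc i) x)) = \<beta> i (\<alpha> i (\<delta> i x))" if "x \<in> carrier (C (Suc i))" for i x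
    using \<beta>(3)[OF mod_homD(1)[OF ghomD(1)[OF \<alpha>(2)] that]] \<alpha>(3)[OF that] by simp
  obtain h where h: "\<And>i. h i \<in> mod_hom R (C i) (C (Suc i))"
    "\<And>i x. x \<in> carrier (C (Suc i)) \<Longrightarrow>
       \<delta> (Suc i) (h (Suc i) x) = x \<ominus>\<^bsub>C (Suc i)\<^esub> \<beta> (Suc i) (\<alpha> (Suc i) x) \<ominus>\<^bsub>C (Suc i)\<^esub> h i (\<delta> i x)"
  proof (rule homotopy[OF r, where \<alpha>="\<lambda>i x. \<beta> i (\<alpha> i x)"])
    show "gproj R (C (Suc i)) (?A (Suc i)) (C (Suc (Suc i))) (?A (Suc (Suc i)))" for i
      by (simp add: Cs projective_imp_gproj proj rD(1))
    show "(\<lambda>x. \<beta> i (\<alpha> i x)) \<in> ghom R (C i) (?A i) (C i) (?A i)" for i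
      by (rule ghom_comp[OF \<alpha>(2) \<beta>(2)])
  qed (use \<alpha>(1) \<beta>(1) \<beta>\<alpha> that in auto)
  show ?thesis
  proof (rule that)
    show hn: "h (Suc n) \<in> mod_hom R (F n) (F (Suc n))" using h(1)[of "Suc n"] by (simp add: Cs)
    fix x assume x: "x \<in> carrier (F (Suc n))"
    interpret F1: Module.module R "F (Suc n)" by (rule rD(1))
    interpret F0: Module.module R "F n" by (rule rD(1))
    \<comment> \<open>\<open>F (Suc n)\<close> has position \<open>Suc (Suc n)\<close> in the
      augmented complex, whose position 0 holds the resolved module.\<close>
    let ?k = "Suc (Suc n)"
    have "\<alpha> ?k x = \<zero>\<^bsub>P (Suc n)\<^esub>"
      using mod_homD(1)[OF ghomD(1)[OF \<alpha>(2)[of ?k]], of x] x P(3)[of "Suc n"] by (simp add: Cs)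
    then have \<beta>0: "\<beta> ?k (\<alpha> ?k x) = \<zero>\<^bsub>F (Suc n)\<^esub>"
      using mod_hom_zero[OF ghomD(1)[OF \<beta>(2)[of ?k]] r'.modul r.modul] by (simp add: Cs)
    have dx: "d n x \<in> carrier (F n)" and hdx: "h (Suc n) (d n x) \<in> carrier (F (Suc n))"
      using mod_homD(1)[OF rD(3) x] mod_homD(1)[OF hn] by auto
    have hx: "h ?k x \<in> carrier (F ?k)" using mod_homD(1)[OF h(1)[of ?k]] x by (simp add: Cs)
    have "d (Suc n) (h ?k x) = x \<ominus>\<^bsub>F (Suc n)\<^esub> h (Suc n) (d n x)"
      using h(2)[of x "Suc n"] x \<beta>0 by (simp add: Cs F1.minus_zero_right)
    moreover have "d n (d (Suc n) (h ?k x)) = \<zero>\<^bsub>F n\<^esub>"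
      using r.\<delta>\<delta>[of "h ?k x" "Suc n"] hx by (simp add: Cs)
    ultimately have "d n x \<ominus>\<^bsub>F n\<^esub> d n (h (Suc n) (d n x)) = \<zero>\<^bsub>F n\<^esub>"
      using mod_hom_minus[OF rD(3) rD(1) rD(1) x hdx] by simp
    then have "d n x \<ominus>\<^bsub>F n\<^esub> d n (h (Suc n) (d n x)) \<oplus>\<^bsub>F n\<^esub> d n (h (Suc n) (d n x)) = d n (h (Suc n) (d n x))"
      using mod_homD(1)[OF rD(3) hdx] by simp
    then show "d n (h (Suc n) (d n x)) = d n x"
      using mod_homD(1)[OF rD(3) hdx] dx by (simp add: a_minus_def F0.a_assoc F0.l_neg)
  qed
qed

section \<open>Homogeneous splittings\<close>

lemma hpart_mult:
  fixes p :: "('v, 'k::field) mpoly"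
  assumes p: "\<And>m. lookup p m \<noteq> 0 \<Longrightarrow> m = c"
  shows "hpart D (c + b) (\<lambda>k. p * f k) = (\<lambda>k. p * hpart D b f k)"
proof (intro ext poly_mapping_eqI)
  fix k m
  have "p = single c (lookup p c)"
    using p by (intro poly_mapping_eqI) (auto simp: lookup_single when_def)
  then have l: "lookup (p * q) m = (if mdvd c m then lookup p c * lookup q (m - c) else 0)" for q
    using lookup_single_mult[of c "lookup p c" q m] by metis
  have "m + D ! k = c + b \<longleftrightarrow> m - c + D ! k = b" if "mdvd c m"
  proof -
    have "m = c + (m - c)" using that by (simp add: mdvd_iff_minus add.commute)
    then have "m + D ! k = c + (m - c + D ! k)" by (metis add.assoc)
    then show ?thesis by simp
  qed
  then show "lookup (hpart D (c + b) (\<lambda>k. p * f k) k) m = lookup (p * hpart D b f k) m"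
    by (simp add: lookup_hpart l)
qed

lemma component_hom_eqI:
  assumes f: "f \<in> mod_hom (mpoly_ring X) (shifted_free X D) (shifted_free X D')"
    and g: "g \<in> mod_hom (mpoly_ring X) (shifted_free X D) (shifted_free X D')"
    and eq: "\<And>a x. x \<in> shifted_free_component X D a \<Longrightarrow> f x = g x"
    and x: "x \<in> carrier (shifted_free X D)"
  shows "f x = g x"
proof -
  obtain S where S: "finite S" "x = (\<Sum>a\<in>S. hpart D a x)" by (rule hpart_decomp[OF x])
  have hc: "hpart D b x \<in> carrier (shifted_free X D)" for b
    using hpart_component[OF x] shifted_carrier by blast
  have "f (\<Sum>a\<in>S. hpart D a x) = g (\<Sum>a\<in>S. hpart D a x)"
    using mod_hom_sum[OF f, of S "\<lambda>a. hpart D a x"] mod_hom_sum[OF g, of S "\<lambda>a. hpart D a x"] hc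
      eq[OF hpart_component[OF x]] by simp
  then show ?thesis using S(2) by simp
qed

text \<open>The map \<open>h0\<close> sends the basis vector \<open>k\<close> to the part of its
  image under \<open>h\<close> in degree \<open>D ! k\<close>. On an element of degree
  \<open>a\<close> it then equals the degree \<open>a\<close> part of \<open>h\<close>; since
  \<open>d\<close> commutes with taking parts, \<open>d h0 d\<close> and \<open>d\<close> agree on
  homogeneous elements, hence everywhere.\<close>

lemma homogeneous_splitting:
  fixes h :: "(nat \<Rightarrow> ('v, 'k::field) mpoly) \<Rightarrow> nat \<Rightarrow> ('v, 'k) mpoly"
  assumes d: "d \<in> mod_hom (mpoly_ring X) (shifted_free X D') (shifted_free X D)"
    and dc: "\<And>a. d ` shifted_free_component X D' a \<subseteq> shifted_free_component X D a"
    and h: "h \<in> mod_hom (mpoly_ring X) (shifted_free X D) (shifted_free X D')"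
    and dhd: "\<And>x. x \<in> carrier (shifted_free X D') \<Longrightarrow> d (h (d x)) = d x"
  obtains h0 where "h0 \<in> mod_hom (mpoly_ring X) (shifted_free X D) (shifted_free X D')"
    "\<And>a. h0 ` shifted_free_component X D a \<subseteq> shifted_free_component X D' a"
    "\<And>x. x \<in> carrier (shifted_free X D') \<Longrightarrow> d (h0 (d x)) = d x"
proof -
  let ?R = "mpoly_ring X :: ('v, 'k) mpoly ring"
  let ?N = "free_module ?R (length D')"
  let ?u = "unit_vec ?R"
  define y where "y k = hpart D' (D ! k) (h (?u k))" for k
  have uc: "?u k \<in> carrier (shifted_free X D)" if "k < length D" for k
    by (rule unit_vec_closed[OF mpoly_ring_cring that])
  have hu: "h (?u k) \<in> carrier ?N" if "k < length D" for k
    by (rule mod_homD(1)[OF h uc[OF that]])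
  have y: "y k \<in> shifted_free_component X D' (D ! k)" if "k < length D" for k
    unfolding y_def by (rule hpart_component[OF hu[OF that]])
  then have yc: "y k \<in> carrier ?N" if "k < length D" for k
    using that shifted_carrier by blast
  interpret N: Module.module ?R ?N by (rule shifted_module)
  define h0 where "h0 x = (\<Oplus>\<^bsub>?N\<^esub>k\<in>{..<length D}. x k \<odot>\<^bsub>?N\<^esub> y k)" for x
  have h0: "h0 \<in> mod_hom ?R (shifted_free X D) ?N"
    unfolding h0_def[abs_def] by (rule free_hom[OF mpoly_ring_cring shifted_module yc])
  have h0a: "h0 x = hpart D' a (h x)" if x: "x \<in> shifted_free_component X D a" for x a
  proof -
    have xc: "x \<in> carrier (shifted_free X D)" using x shifted_carrier by blast
    have xk: "x k \<in> carrier ?R" if "k < length D" for k using xc that by (simp add: free_module_def)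
    have "h0 x = (\<Sum>k<length D. (\<lambda>j. x k * y k j))"
      unfolding h0_def using N.smult_closed[OF xk yc] by (subst shifted_free_finsum) auto
    also have "\<dots> = (\<Sum>k<length D. hpart D' a (\<lambda>j. x k * h (?u k) j))"
    proof (rule sum.cong[OF refl])
      fix k assume k: "k \<in> {..<length D}"
      have xm: "m + D ! k = a" if "lookup (x k) m \<noteq> 0" for m
        using x k that by (simp add: shifted_iff)
      show "(\<lambda>j. x k * y k j) = hpart D' a (\<lambda>j. x k * h (?u k) j)"
      \<comment> \<open>All exponents \<open>m\<close> of \<open>x k\<close> satisfy
        \<open>m + D ! k = a\<close>, so a nonzero \<open>x k\<close> is a single term with exponent
        \<open>c\<close>; multiplying by it shifts degree \<open>D ! k\<close> to
        \<open>c + D ! k = a\<close>.\<close>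
      proof (cases "x k = 0")
        case True
        then show ?thesis by (auto simp: hpart_def fun_eq_iff)
      next
        case False
        then obtain c where c: "lookup (x k) c \<noteq> 0" by (auto simp: poly_mapping_eq_iff fun_eq_iff)
        have "m = c" if "lookup (x k) m \<noteq> 0" for m
          using xm[OF that] xm[OF c] by (metis add_right_cancel)
        then have "hpart D' (c + D ! k) (\<lambda>j. x k * h (?u k) j) = (\<lambda>j. x k * y k j)"
          unfolding y_def by (rule hpart_mult)
        then show ?thesis using xm[OF c] by simp
      qed
    qed
    also have "\<dots> = hpart D' a (\<Sum>k<length D. (\<lambda>j. x k * h (?u k) j))" by (simp add: hpart_sum)
    also have "(\<Sum>k<length D. (\<lambda>j. x k * h (?u k) j)) = h x"
      unfolding mod_hom_free_expand[OF mpoly_ring_cring shifted_module h xc]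
      using N.smult_closed[OF xk hu] by (subst shifted_free_finsum) auto
    finally show ?thesis .
  qed
  show ?thesis
  proof (rule that[OF h0])
    show "h0 ` shifted_free_component X D a \<subseteq> shifted_free_component X D' a" for a
      using h0a hpart_component[OF mod_homD(1)[OF h]] shifted_carrier by fastforce
    show "d (h0 (d x)) = d x" if "x \<in> carrier (shifted_free X D')" for x
    proof (rule component_hom_eqI[OF mod_hom_comp[OF d mod_hom_comp[OF h0 d]] d _ that])
      fix a and x :: "nat \<Rightarrow> ('v, 'k) mpoly"
      assume x: "x \<in> shifted_free_component X D' a"
      then have xc: "x \<in> carrier (shifted_free X D')" using shifted_carrier by blast
      have dx: "d x \<in> shifted_free_component X D a" using dc x by blast
      have "d (h0 (d x)) = hpart D a (d (h (d x)))"
        using h0a[OF dx] hpart_commute[OF d dc mod_homD(1)[OF h mod_homD(1)[OF d xc]]] by simp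
      also have "\<dots> = d x" using dhd[OF xc] hpart_of_component[OF dx] by simp
      finally show "d (h0 (d x)) = d x" .
    qed
  qed
qed

section \<open>Restriction to a subset of the variables\<close>

lemma multidegs_mono: "Y \<subseteq> X \<Longrightarrow> multidegs Y \<subseteq> multidegs X"
  by (auto simp: multidegs_def)

lemma mpoly_ring_mono: "Y \<subseteq> X \<Longrightarrow> f \<in> carrier (mpoly_ring Y) \<Longrightarrow> f \<in> carrier (mpoly_ring X)"
  using multidegs_mono[of Y X] by (auto simp: mpoly_ring_carrier)

text \<open>Basis elements with degree supported on \<open>Y\<close> form \<open>D\<close>, all
  others \<open>E\<close>. Because \<open>D\<close> comes first, a sequence over the smaller ring of
  length \<open>D\<close> is, with its trailing zeros, literally an element of the larger free
  module.\<close>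

locale free_restriction =
  fixes X Y :: "'v set" and D E :: "'v multideg list"
  assumes YX: "Y \<subseteq> X" and D: "set D \<subseteq> multidegs Y" and E: "set E \<inter> multidegs Y = {}"
begin

lemma carrier_subset:
  "carrier (shifted_free Y D :: (_, nat \<Rightarrow> ('v, 'k::field) mpoly) module) \<subseteq> carrier (shifted_free X (D @ E))"
proof
  fix f :: "nat \<Rightarrow> ('v, 'k) mpoly"
  assume f: "f \<in> carrier (shifted_free Y D)"
  have "m \<in> multidegs X" if "lookup (f k) m \<noteq> 0" for k m
    using f that multidegs_mono[OF YX] unfolding shifted_free_carrier
    by (cases "k < length D") auto
  then show "f \<in> carrier (shifted_free X (D @ E))"
    using f unfolding shifted_free_carrier by simp
qed

text \<open>If \<open>m + b\<close> is supported on \<open>Y\<close>, then so are \<open>m\<close>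
  and \<open>b\<close>, exponents being nonnegative. In such a degree the coordinates belonging to
  \<open>E\<close> vanish and the others involve only variables from \<open>Y\<close>.\<close>

lemma component_eq:
  assumes a: "a \<in> multidegs Y"
  shows "(shifted_free_component X (D @ E) a :: (nat \<Rightarrow> ('v, 'k::field) mpoly) set) = shifted_free_component Y D a"
proof (intro equalityI subsetI)
  fix f :: "nat \<Rightarrow> ('v, 'k) mpoly"
  assume f: "f \<in> shifted_free_component X (D @ E) a"
  have in_Y: "(D @ E) ! k \<in> multidegs Y \<and> m \<in> multidegs Y" if "k < length (D @ E)" "lookup (f k) m \<noteq> 0" for k m
  proof -
    have "m + (D @ E) ! k = a" using f that unfolding shifted_iff by blast
    then show ?thesis
      using a mdvd_add[of "(D @ E) ! k" m] mdvd_add[of m "(D @ E) ! k"] mdvd_multidegs add.commute by metis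
  qed
  have "f k = 0" if "k \<ge> length D" for k
  proof (cases "k < length (D @ E)")
    case True
    then have "(D @ E) ! k \<in> set E" using that by (simp add: nth_append)
    then have "(D @ E) ! k \<notin> multidegs Y" using E by blast
    then have "lookup (f k) m = 0" for m using in_Y[OF True] by blast
    then show ?thesis by (intro poly_mapping_eqI) simp
  next
    case False
    then show ?thesis using f unfolding shifted_iff shifted_free_carrier by simp
  qed
  moreover have "m \<in> multidegs Y \<and> m + D ! k = a" if "k < length D" "lookup (f k) m \<noteq> 0" for k m
  proof -
    have "m + (D @ E) ! k = a" using f that unfolding shifted_iff by simp
    then show ?thesis using in_Y[of k m] that by (simp add: nth_append)
  qed
  ultimately show "f \<in> shifted_free_component Y D a"
    by (simp add: shifted_iff shifted_free_carrier)
next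
  fix f :: "nat \<Rightarrow> ('v, 'k) mpoly"
  assume f: "f \<in> shifted_free_component Y D a"
  then have "f \<in> carrier (shifted_free X (D @ E))"
    using carrier_subset shifted_carrier by blast
  moreover have "m + (D @ E) ! k = a" if "k < length (D @ E)" "lookup (f k) m \<noteq> 0" for k m
    using f that by (cases "k < length D") (auto simp: shifted_iff shifted_free_carrier nth_append)
  ultimately show "f \<in> shifted_free_component X (D @ E) a"
    unfolding shifted_iff by blast
qed

lemma decomp:
  assumes f: "f \<in> carrier (shifted_free Y D)"
  obtains S where "finite S" "S \<subseteq> multidegs Y" "f = (\<Sum>a\<in>S. hpart D a f)"
proof -
  obtain S where S: "finite S" "f = (\<Sum>a\<in>S. hpart D a f)" by (rule hpart_decomp[OF f])
  have "hpart D a f = 0" if "a \<notin> multidegs Y" for a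
  proof (intro ext poly_mapping_eqI)
    fix k m
    have "m + D ! k \<noteq> a" if k: "k < length D" "lookup (f k) m \<noteq> 0"
    proof -
      have "D ! k \<in> multidegs Y" using D nth_mem[OF k(1)] by blast
      moreover have "m \<in> multidegs Y" using f k by (simp add: shifted_free_carrier)
      ultimately show ?thesis using multidegs_add[of m Y "D ! k"] \<open>a \<notin> multidegs Y\<close> by auto
    qed
    then show "lookup (hpart D a f k) m = lookup (0 k) m" by (auto simp: lookup_hpart)
  qed
  then have "(\<Sum>a\<in>S. hpart D a f) = (\<Sum>a\<in>S \<inter> multidegs Y. hpart D a f)"
    using S(1) by (intro sum.mono_neutral_right) auto
  then have "f = (\<Sum>a\<in>S \<inter> multidegs Y. hpart D a f)" using S(2) by simp
  then show ?thesis using that[of "S \<inter> multidegs Y"] S(1) by simp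
qed

end

lemma sum_in_carrier:
  assumes "\<And>i. i \<in> S \<Longrightarrow> f i \<in> carrier (shifted_free X D)"
  shows "sum f S \<in> carrier (shifted_free X D)"
  using assms
proof (induction S rule: infinite_finite_induct)
  case (insert i S)
  then show ?case unfolding sum.insert[OF insert.hyps] by (intro shifted_free_closed(2)) auto
next
  case (infinite S)
  show ?case unfolding sum.infinite[OF infinite(1)] by (rule shifted_free_closed(1))
next
  case empty
  show ?case unfolding sum.empty by (rule shifted_free_closed(1))
qed

text \<open>An element over \<open>Y\<close> is a sum of parts in degrees supported on
  \<open>Y\<close>; in these degrees the components over both rings coincide, so a degree-preserving
  \<open>\<phi>\<close> cannot leave the smaller module.\<close>

lemma graded_hom_restrict:
  fixes \<phi> :: "(nat \<Rightarrow> ('v, 'k::field) mpoly) \<Rightarrow> nat \<Rightarrow> ('v, 'k) mpoly"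
  assumes "free_restriction X Y D E" "free_restriction X Y D' E'"
    and \<phi>: "\<phi> \<in> mod_hom (mpoly_ring X) (shifted_free X (D @ E)) (shifted_free X (D' @ E'))"
    and c: "\<And>a. \<phi> ` shifted_free_component X (D @ E) a \<subseteq> shifted_free_component X (D' @ E') a"
  shows "\<phi> \<in> mod_hom (mpoly_ring Y) (shifted_free Y D) (shifted_free Y D')"
proof -
  interpret F: free_restriction X Y D E by fact
  interpret F': free_restriction X Y D' E' by fact
  show ?thesis
  proof (rule mod_homI)
    fix x :: "nat \<Rightarrow> ('v, 'k) mpoly"
    assume x: "x \<in> carrier (shifted_free Y D)"
    then have xX: "x \<in> carrier (shifted_free X (D @ E))" using F.carrier_subset by blast
    obtain S where S: "finite S" "S \<subseteq> multidegs Y" "x = (\<Sum>a\<in>S. hpart D a x)" by (rule F.decomp[OF x])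
    have hp: "hpart D a x \<in> shifted_free_component X (D @ E) a" if "a \<in> S" for a
      using hpart_component[OF x] F.component_eq S(2) that by blast
    then have "\<phi> (\<Sum>a\<in>S. hpart D a x) = (\<Sum>a\<in>S. \<phi> (hpart D a x))"
      using shifted_carrier by (intro mod_hom_sum[OF \<phi>]) blast
    moreover have "\<phi> (hpart D a x) \<in> carrier (shifted_free Y D')" if "a \<in> S" for a
      using c[of a] hp[OF that] F'.component_eq[of a] S(2) that shifted_carrier by blast
    ultimately show "\<phi> x \<in> carrier (shifted_free Y D')"
      using S(3) sum_in_carrier[of S "\<lambda>a. \<phi> (hpart D a x)"] by simp
    { fix y :: "nat \<Rightarrow> ('v, 'k) mpoly" assume "y \<in> carrier (shifted_free Y D)"
      then have "y \<in> carrier (shifted_free X (D @ E))" using F.carrier_subset by blast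
      then show "\<phi> (x \<oplus>\<^bsub>shifted_free Y D\<^esub> y) = \<phi> x \<oplus>\<^bsub>shifted_free Y D'\<^esub> \<phi> y"
        using mod_homD(2)[OF \<phi> xX, of y] by (simp only: shifted_free_simps) }
    { fix p :: "('v, 'k) mpoly" assume "p \<in> carrier (mpoly_ring Y)"
      then have "p \<in> carrier (mpoly_ring X)" by (rule mpoly_ring_mono[OF F.YX])
      then show "\<phi> (p \<odot>\<^bsub>shifted_free Y D\<^esub> x) = p \<odot>\<^bsub>shifted_free Y D'\<^esub> \<phi> x"
        using mod_homD(3)[OF \<phi> _ xX, of p] by (simp only: shifted_free_simps) }
  qed
qed

text \<open>
  The part of a multigraded resolution over \<open>S\<^sub>X\<close> in the multidegrees supported on \<open>Y\<close> is a
  resolution over \<open>S\<^sub>Y\<close>: the basis elements of all other degrees do not contribute to it.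
\<close>

locale resolution_restriction = monomial_quotient K X B
  for K :: "'k::field itself" and X :: "'v set" and B +
  fixes Y :: "'v set" and D E :: "nat \<Rightarrow> 'v multideg list"
    and d :: "nat \<Rightarrow> (nat \<Rightarrow> ('v, 'k) mpoly) \<Rightarrow> nat \<Rightarrow> ('v, 'k) mpoly"
  assumes fr: "free_restriction X Y (D i) (E i)" and D0: "D 0 = [0]" and E0: "E 0 = []"
    and res: "graded_free_resolution X (quot_module (mpoly_ring X) (monomial_ideal X B))
      (monomial_quotient_component X B) (\<lambda>i. D i @ E i) d (\<lambda>f. monomial_ideal X B +>\<^bsub>mpoly_ring X\<^esub> f 0)"
begin

definition BY where "BY = B \<inter> multidegs Y"

sublocale Y: monomial_quotient K Y BY
  by unfold_locales (simp add: BY_def)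

lemma YX: "Y \<subseteq> X"
  using fr[of 0] by (simp add: free_restriction_def)

abbreviation DX where "DX i \<equiv> D i @ E i"

lemmas rD = resolutionD[OF graded_free_resolutionD(2)[OF res]]
lemmas d_component = graded_free_resolutionD(4)[OF res]

lemma component_eq:
  "a \<in> multidegs Y \<Longrightarrow>
    (shifted_free_component X (DX i) a :: (nat \<Rightarrow> ('v, 'k) mpoly) set) = shifted_free_component Y (D i) a"
  by (rule free_restriction.component_eq[OF fr])

lemma carrier_subset:
  "carrier (shifted_free Y (D i) :: (_, nat \<Rightarrow> ('v, 'k) mpoly) module) \<subseteq> carrier (shifted_free X (DX i))"
  by (rule free_restriction.carrier_subset[OF fr])

lemma d_hom_Y: "d i \<in> mod_hom Y.SX (shifted_free Y (D (Suc i))) (shifted_free Y (D i))"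
  by (rule graded_hom_restrict[OF fr fr rD(3) d_component])

lemma d_component_Y: "d i ` shifted_free_component Y (D (Suc i)) a \<subseteq> shifted_free_component Y (D i) a"
proof (cases "a \<in> multidegs Y")
  case True
  then show ?thesis using d_component[of i a] component_eq by simp
next
  \<comment> \<open>All parts of an element over \<open>Y\<close> have degrees supported on
    \<open>Y\<close>, so a component in any other degree is zero.\<close>
  case False
  show ?thesis
  proof (rule image_subsetI)
    fix f :: "nat \<Rightarrow> ('v, 'k) mpoly"
    assume f: "f \<in> shifted_free_component Y (D (Suc i)) a"
    then have fc: "f \<in> carrier (shifted_free Y (D (Suc i)))" by (simp add: shifted_iff)
    obtain S where S: "finite S" "S \<subseteq> multidegs Y" "f = (\<Sum>b\<in>S. hpart (D (Suc i)) b f)"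
      by (rule free_restriction.decomp[OF fr fc])
    have "hpart (D (Suc i)) b f = 0" if "b \<in> S" for b
      using hpart_of_component[OF f, of b] S(2) False that by auto
    then have "f = 0" using S(3) by simp
    then show "d i f \<in> shifted_free_component Y (D i) a"
      using mod_hom_zero[OF d_hom_Y shifted_module shifted_module] shifted_zero by simp
  qed
qed

lemma ideal_Y: "f \<in> carrier Y.SX \<Longrightarrow> f \<in> Y.I \<longleftrightarrow> f \<in> I"
  unfolding monomial_ideal_iff[OF B] monomial_ideal_iff[OF Y.B]
  using mpoly_ring_mono[OF YX, of f] mdvd_multidegs by (auto simp: BY_def mpoly_ring_carrier) blast

text \<open>An element over \<open>Y\<close> has only finitely many nonzero parts, all in degrees
  supported on \<open>Y\<close>; preimages found degree by degree are added up.\<close>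

lemma exact_Y:
  assumes f: "f \<in> carrier (shifted_free Y (D i))"
    and ex: "\<And>a. a \<in> multidegs Y \<Longrightarrow> \<exists>y\<in>shifted_free_component Y (D (Suc i)) a. d i y = hpart (D i) a f"
  shows "f \<in> d i ` carrier (shifted_free Y (D (Suc i)))"
proof -
  obtain S where S: "finite S" "S \<subseteq> multidegs Y" "f = (\<Sum>b\<in>S. hpart (D i) b f)"
    by (rule free_restriction.decomp[OF fr f])
  obtain y where y: "\<And>a. a \<in> multidegs Y \<Longrightarrow> y a \<in> shifted_free_component Y (D (Suc i)) a"
    "\<And>a. a \<in> multidegs Y \<Longrightarrow> d i (y a) = hpart (D i) a f"
    using ex by metis
  have yc: "y a \<in> carrier (shifted_free Y (D (Suc i)))" if "a \<in> S" for a
    using y(1) S(2) that shifted_carrier by blast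
  have "d i (\<Sum>a\<in>S. y a) = (\<Sum>a\<in>S. d i (y a))" by (rule mod_hom_sum[OF d_hom_Y yc])
  also have "\<dots> = (\<Sum>a\<in>S. hpart (D i) a f)" using y(2) S(2) by (intro sum.cong) auto
  finally have "f = d i (\<Sum>a\<in>S. y a)" using S(3) by simp
  then show ?thesis by (intro image_eqI[where f="d i", OF _ sum_in_carrier[OF yc]])
qed

lemma resolution_Y:
  "graded_free_resolution Y Y.M Y.G D d (\<lambda>f. Y.I +>\<^bsub>Y.SX\<^esub> f 0)"
  unfolding graded_free_resolution_def resolution_def
proof (intro conjI allI shifted_module d_hom_Y d_component_Y)
  let ?e = "\<lambda>f. I +>\<^bsub>SX\<^esub> f 0" and ?eY = "\<lambda>f. Y.I +>\<^bsub>Y.SX\<^esub> f 0"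
  show "set (D i) \<subseteq> multidegs Y" for i using fr[of i] by (simp add: free_restriction_def)
  have c0: "f \<in> carrier (shifted_free Y (D 0)) \<longleftrightarrow> f 0 \<in> carrier Y.SX \<and> (\<forall>k\<ge>1. f k = 0)" for f
    by (simp add: D0 free_module_def)
  show "?eY \<in> mod_hom Y.SX (shifted_free Y (D 0)) Y.M"
    by (rule mod_homI) (auto simp: c0 Y.carrier_M Y.M_ops)
  show "?eY ` carrier (shifted_free Y (D 0)) = carrier Y.M"
  proof
    show "?eY ` carrier (shifted_free Y (D 0)) \<subseteq> carrier Y.M" by (auto simp: c0 Y.carrier_M)
    show "carrier Y.M \<subseteq> ?eY ` carrier (shifted_free Y (D 0))"
    proof
      fix x assume "x \<in> carrier Y.M"
      then obtain f where "f \<in> carrier Y.SX" "x = Y.I +>\<^bsub>Y.SX\<^esub> f" unfolding Y.carrier_M by blast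
      then show "x \<in> ?eY ` carrier (shifted_free Y (D 0))"
        by (intro image_eqI[of _ _ "\<lambda>k. if k = 0 then f else 0"]) (auto simp: c0)
    qed
  qed
  \<comment> \<open>For a polynomial in the variables of \<open>Y\<close>, membership in the two
    ideals is the same, so the two augmentations have the same kernel on the smaller module.\<close>
  have e_zero: "?e f = \<zero>\<^bsub>M\<^esub> \<longleftrightarrow> ?eY f = \<zero>\<^bsub>Y.M\<^esub>" if f: "f \<in> carrier (shifted_free Y (D 0))" for f
  proof -
    have "f 0 \<in> carrier Y.SX" using f by (simp add: c0)
    then show ?thesis
      using coset_zero_iff[of "f 0"] Y.coset_zero_iff[of "f 0"] ideal_Y[of "f 0"] mpoly_ring_mono[OF YX, of "f 0"]
      by simp
  qed
  show "?eY ` shifted_free_component Y (D 0) a \<subseteq> Y.G a" for a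
  proof (rule image_subsetI)
    fix f :: "nat \<Rightarrow> ('v, 'k) mpoly"
    assume "f \<in> shifted_free_component Y (D 0) a"
    then have "f 0 \<in> mpoly_component Y a"
      unfolding shifted_iff c0 by (auto simp: mpoly_component_iff D0)
    then show "?eY f \<in> Y.G a" unfolding monomial_quotient_component_def by blast
  qed
  have hpY: "hpart (D i) a f \<in> shifted_free_component X (DX i) a" if "f \<in> carrier (shifted_free Y (D i))" "a \<in> multidegs Y"
    for i a and f :: "nat \<Rightarrow> ('v, 'k) mpoly"
    unfolding component_eq[OF that(2)] by (rule hpart_component[OF that(1)])
  show "d 0 ` carrier (shifted_free Y (D 1)) = {x \<in> carrier (shifted_free Y (D 0)). ?eY x = \<zero>\<^bsub>Y.M\<^esub>}"
  proof (intro equalityI subsetI)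
    fix x assume "x \<in> d 0 ` carrier (shifted_free Y (D 1))"
    then obtain y where y: "y \<in> carrier (shifted_free Y (D 1))" "x = d 0 y" by blast
    have xc: "x \<in> carrier (shifted_free Y (D 0))" using mod_homD(1)[OF d_hom_Y[of 0]] y by simp
    have "x \<in> d 0 ` carrier (shifted_free X (DX 1))" using y carrier_subset by blast
    then have "?e x = \<zero>\<^bsub>M\<^esub>" unfolding rD(5) by simp
    then show "x \<in> {x \<in> carrier (shifted_free Y (D 0)). ?eY x = \<zero>\<^bsub>Y.M\<^esub>}" using e_zero xc by simp
  next
    fix x assume x: "x \<in> {x \<in> carrier (shifted_free Y (D 0)). ?eY x = \<zero>\<^bsub>Y.M\<^esub>}"
    then have xc: "x \<in> carrier (shifted_free Y (D 0))" by simp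
    have "x 0 \<in> I" using x e_zero[OF xc] coset_zero_iff[of "x 0"] mpoly_ring_mono[OF YX, of "x 0"] c0 by simp
    then have x0: "\<exists>b\<in>B. mdvd b a" if "lookup (x 0) a \<noteq> 0" for a
      using that unfolding monomial_ideal_iff[OF B] by blast
    have "x \<in> d 0 ` carrier (shifted_free Y (D (Suc 0)))"
    proof (rule exact_Y[OF xc])
      fix a assume a: "a \<in> multidegs Y"
      have hc: "hpart (D 0) a x \<in> carrier (shifted_free Y (D 0))"
        using hpart_component[OF xc] shifted_carrier by blast
      \<comment> \<open>Since the ideal is monomial, each homogeneous part of a member is again a
        member.\<close>
      then have "hpart (D 0) a x 0 \<in> I"
        unfolding monomial_ideal_iff[OF B] using x0 mpoly_ring_mono[OF YX, of "hpart (D 0) a x 0"] c0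
        by (auto simp: lookup_hpart split: if_splits)
      then have "?e (hpart (D 0) a x) = \<zero>\<^bsub>M\<^esub>"
        using coset_zero_iff[of "hpart (D 0) a x 0"] mpoly_ring_mono[OF YX, of "hpart (D 0) a x 0"] hc c0 by simp
      then show "\<exists>y\<in>shifted_free_component Y (D (Suc 0)) a. d 0 y = hpart (D 0) a x"
        using graded_exact(1)[OF res hpY[OF xc a]] component_eq[OF a] by simp
    qed
    then show "x \<in> d 0 ` carrier (shifted_free Y (D 1))" by simp
  qed
  show "d (Suc i) ` carrier (shifted_free Y (D (Suc (Suc i)))) =
      {x \<in> carrier (shifted_free Y (D (Suc i))). d i x = \<zero>\<^bsub>shifted_free Y (D i)\<^esub>}" for i
  proof (intro equalityI subsetI)
    fix x assume "x \<in> d (Suc i) ` carrier (shifted_free Y (D (Suc (Suc i))))"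
    then obtain y where y: "y \<in> carrier (shifted_free Y (D (Suc (Suc i))))" "x = d (Suc i) y" by blast
    have xc: "x \<in> carrier (shifted_free Y (D (Suc i)))" using mod_homD(1)[OF d_hom_Y y(1)] y by simp
    have "x \<in> d (Suc i) ` carrier (shifted_free X (DX (Suc (Suc i))))" using y carrier_subset by blast
    then have "d i x = 0" unfolding rD(6) shifted_free_simps by blast
    then show "x \<in> {x \<in> carrier (shifted_free Y (D (Suc i))). d i x = \<zero>\<^bsub>shifted_free Y (D i)\<^esub>}"
      using xc by simp
  next
    fix x assume "x \<in> {x \<in> carrier (shifted_free Y (D (Suc i))). d i x = \<zero>\<^bsub>shifted_free Y (D i)\<^esub>}"
    then have xc: "x \<in> carrier (shifted_free Y (D (Suc i)))" and dx: "d i x = 0" by simp_all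
    show "x \<in> d (Suc i) ` carrier (shifted_free Y (D (Suc (Suc i))))"
    proof (rule exact_Y[OF xc])
      fix a assume a: "a \<in> multidegs Y"
      have "d i (hpart (D (Suc i)) a x) = hpart (D i) a (d i x)"
        by (rule hpart_commute[OF d_hom_Y d_component_Y xc, symmetric])
      also have "\<dots> = \<zero>\<^bsub>shifted_free X (DX i)\<^esub>" unfolding dx shifted_free_simps by (auto simp: hpart_def fun_eq_iff)
      finally show "\<exists>y\<in>shifted_free_component Y (D (Suc (Suc i))) a. d (Suc i) y = hpart (D (Suc i)) a x"
        using graded_exact(2)[OF res hpY[OF xc a]] component_eq[OF a] by simp
    qed
  qed
qed

text \<open>Cycles and boundaries in degree \<open>a\<close> agree as sets. The witnesses
  \<open>g\<close> and \<open>h\<close> of a boundary over the larger ring may have parts in any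
  degree; their parts in degree \<open>a\<close> are witnesses as well, and these live over
  \<open>Y\<close>.\<close>

lemma tor_dim_Y:
  assumes a: "a \<in> multidegs Y"
  shows "tor_dim X DX d i a = tor_dim Y D d i a"
proof -
  have mF: "f \<in> mF X (DX j) \<longleftrightarrow> f \<in> mF Y (D j)" if "f \<in> shifted_free_component Y (D j) a"
    for j and f :: "nat \<Rightarrow> ('v, 'k) mpoly"
  proof -
    have f: "f \<in> carrier (shifted_free Y (D j))"
      using that by (simp add: shifted_iff)
    have "f \<in> carrier (shifted_free X (DX j))" by (rule subsetD[OF carrier_subset f])
    with f show ?thesis by (simp only: mF_iff)
  qed
  have "f \<in> tor_cycles X DX d i a \<longleftrightarrow> f \<in> tor_cycles Y D d i a" for f
    unfolding tor_cycles_iff component_eq[OF a] using mF d_component_Y by blast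
  then have cyc: "tor_cycles X DX d i a = tor_cycles Y D d i a" by blast
  have bd: "f \<in> tor_boundaries X DX d i a \<longleftrightarrow> f \<in> tor_boundaries Y D d i a" for f
  proof
    assume "f \<in> tor_boundaries X DX d i a"
    then obtain g h where f: "f \<in> shifted_free_component X (DX i) a"
      and g: "g \<in> carrier (shifted_free X (DX (Suc i)))" "h \<in> mF X (DX i)" "f = d i g + h"
      unfolding tor_boundaries_iff by blast
    have hc: "h \<in> carrier (shifted_free X (DX i))" using g(2) mF_closed(1) by blast
    have "f = hpart (DX i) a f" using hpart_of_component[OF f] by simp
    also have "\<dots> = hpart (DX i) a (d i g) + hpart (DX i) a h"
      unfolding g(3) by (intro ext poly_mapping_eqI) (simp add: lookup_hpart lookup_add)
    also have "hpart (DX i) a (d i g) = d i (hpart (DX (Suc i)) a g)"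
      by (rule hpart_commute[OF rD(3) d_component g(1)])
    finally have "f = d i (hpart (DX (Suc i)) a g) + hpart (DX i) a h" .
    moreover have "hpart (DX (Suc i)) a g \<in> carrier (shifted_free Y (D (Suc i)))"
      using hpart_component[OF g(1)] component_eq[OF a] shifted_carrier by blast
    moreover have "hpart (DX i) a h \<in> mF Y (D i)"
    proof -
      have h: "hpart (DX i) a h \<in> shifted_free_component X (DX i) a" by (rule hpart_component[OF hc])
      then have "hpart (DX i) a h \<in> mF X (DX i)"
        using g(2) shifted_carrier unfolding mF_iff lookup_hpart by (auto simp: shifted_iff)
      then show ?thesis using mF h component_eq[OF a] by blast
    qed
    ultimately show "f \<in> tor_boundaries Y D d i a"
      unfolding tor_boundaries_iff using f component_eq[OF a] by blast
  next
    assume "f \<in> tor_boundaries Y D d i a"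
    then obtain g h where f: "f \<in> shifted_free_component Y (D i) a"
      and g: "g \<in> carrier (shifted_free Y (D (Suc i)))" "h \<in> mF Y (D i)" "f = d i g + h"
      unfolding tor_boundaries_iff by blast
    have "h \<in> mF X (DX i)" using g(2) carrier_subset unfolding mF_iff by blast
    then show "f \<in> tor_boundaries X DX d i a"
      unfolding tor_boundaries_iff using f g component_eq[OF a] carrier_subset by blast
  qed
  have "tor_boundaries X DX d i a = tor_boundaries Y D d i a" using bd by blast
  then show ?thesis unfolding tor_dim_def using cyc by simp
qed

lemma betti_Y: "a \<in> multidegs Y \<Longrightarrow> multigraded_betti X M G i a = multigraded_betti Y Y.M Y.G i a"
  using betti_eq_tor_dim[OF res] Y.betti_eq_tor_dim[OF resolution_Y] tor_dim_Y by simp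

lemma projective_resolution_Y:
  assumes "has_projective_resolution_of_length_le SX M n"
  shows "has_projective_resolution_of_length_le Y.SX Y.M n"
proof -
  obtain h where h: "h \<in> mod_hom SX (shifted_free X (DX n)) (shifted_free X (DX (Suc n)))"
    "\<And>x. x \<in> carrier (shifted_free X (DX (Suc n))) \<Longrightarrow> d n (h (d n x)) = d n x"
    by (rule projective_resolution_syzygy_split[OF M_module graded_free_resolutionD(2)[OF res]
          projective_free_module[OF mpoly_ring_cring] assms]) blast+
  obtain h0 where h0: "h0 \<in> mod_hom SX (shifted_free X (DX n)) (shifted_free X (DX (Suc n)))"
    "\<And>a. h0 ` shifted_free_component X (DX n) a \<subseteq> shifted_free_component X (DX (Suc n)) a"
    "\<And>x. x \<in> carrier (shifted_free X (DX (Suc n))) \<Longrightarrow> d n (h0 (d n x)) = d n x"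
    by (rule homogeneous_splitting[OF rD(3) d_component h]) blast+
  have "h0 \<in> mod_hom Y.SX (shifted_free Y (D n)) (shifted_free Y (D (Suc n)))"
    by (rule graded_hom_restrict[OF fr fr h0(1,2)])
  then show ?thesis
    by (rule split_syzygy_projective_resolution[OF Y.M_module graded_free_resolutionD(2)[OF resolution_Y]
          projective_free_module[OF mpoly_ring_cring]])
      (use h0(3) carrier_subset in blast)
qed

end

section \<open>Nonvanishing Betti numbers\<close>

text \<open>If no basis element has degree \<open>a\<close>, then an element of degree
  \<open>a\<close> has no constant term in any coordinate; it lies in \<open>mF\<close> and is a
  boundary already.\<close>

lemma tor_dim_nonzero:
  assumes res: "graded_free_resolution X M G D d e" and nz: "tor_dim X D d i a \<noteq> 0"
  shows "a \<in> set (D i)"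
proof (rule ccontr)
  assume a: "a \<notin> set (D i)"
  note rD = resolutionD[OF graded_free_resolutionD(2)[OF res]]
  have d0: "d i 0 = 0"
    using mod_hom_zero[OF rD(3) shifted_module shifted_module] by simp
  have "tor_cycles X D d i a \<subseteq> tor_boundaries X D d i a"
  proof
    fix f assume "f \<in> tor_cycles X D d i a"
    then have f: "f \<in> shifted_free_component X (D i) a" by (simp add: tor_cycles_iff)
    have "lookup (f k) 0 = 0" for k
    proof (cases "k < length (D i)")
      case True
      then have "D i ! k \<noteq> a" using a nth_mem by blast
      then show ?thesis using f True unfolding shifted_iff by (metis add.left_neutral)
    next
      case False
      then show ?thesis using f by (simp add: shifted_iff shifted_free_carrier)
    qed
    then have "f \<in> mF X (D i)" using f by (simp add: mF_iff shifted_iff)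
    moreover have "f = d i 0 + f" by (simp add: d0)
    ultimately show "f \<in> tor_boundaries X D d i a"
      unfolding tor_boundaries_iff using f shifted_free_closed(1) by blast
  qed
  then have "tor_cycles X D d i a = tor_boundaries X D d i a" using tor_subspaces(3)[OF res] by blast
  then show False using nz by (simp add: tor_dim_def)
qed

text \<open>Each exponent is at most \<open>j\<close>. Finiteness matters since a sum over an
  infinite index set is 0 by convention, which would spoil the comparison of
  \<open>graded_betti\<close>.\<close>

lemma finite_multidegs_total_degree:
  assumes "finite X"
  shows "finite {a \<in> multidegs X. total_degree a = j}"
proof -
  have le: "lookup a v \<le> total_degree a" for a :: "'a multideg" and v
  proof (cases "v \<in> keys a")
    case True
    then show ?thesis unfolding total_degree_def by (intro member_le_sum) auto
  qed (simp add: in_keys_iff)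
  have "lookup ` {a \<in> multidegs X. total_degree a = j} \<subseteq>
      {f. \<forall>v. (v \<in> X \<longrightarrow> f v \<in> {..j}) \<and> (v \<notin> X \<longrightarrow> f v = 0)}"
    using le by (auto simp: multidegs_def in_keys_iff subset_iff)
  then have "finite (lookup ` {a \<in> multidegs X. total_degree a = j})"
    by (rule finite_subset) (rule finite_set_of_finite_funs[OF assms finite_atMost])
  then show ?thesis by (rule finite_imageD) (simp add: inj_on_def)
qed

lemma graded_betti_nonzeroE:
  assumes "graded_betti X M G i j \<noteq> 0"
  obtains a where "a \<in> multidegs X" "total_degree a = j" "multigraded_betti X M G i a \<noteq> 0"
  using assms unfolding graded_betti_def by (metis (mono_tags, lifting) mem_Collect_eq sum.neutral)

section \<open>Finitely many nonzero Betti numbers, and one that is nonzero\<close>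

context monomial_quotient
begin

text \<open>The regularity is a \<open>Max\<close>, hence meaningful for finite nonempty sets only.
  Nonzero Betti numbers occur only at degrees of basis elements, and a resolution of finite length
  has finitely many of these.\<close>

lemma finite_graded_betti:
  assumes res: "graded_free_resolution X M G D d e" and fin: "\<And>i. i > r \<Longrightarrow> D i = []"
  shows "finite {int j - int i |i j. graded_betti X M G i j \<noteq> 0}"
proof (rule finite_subset)
  let ?T = "\<Union>i\<le>r. total_degree ` set (D i)"
  show "{int j - int i |i j. graded_betti X M G i j \<noteq> 0} \<subseteq> (\<lambda>(i, j). int j - int i) ` ({..r} \<times> ?T)"
  proof
    fix x assume "x \<in> {int j - int i |i j. graded_betti X M G i j \<noteq> 0}"
    then obtain i j where ij: "x = int j - int i" "graded_betti X M G i j \<noteq> 0" by blast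
    obtain a where a: "total_degree a = j" "multigraded_betti X M G i a \<noteq> 0"
      by (rule graded_betti_nonzeroE[OF ij(2)])
    have "a \<in> set (D i)" using tor_dim_nonzero[OF res] a(2) betti_eq_tor_dim[OF res] by simp
    moreover from this have "i \<le> r" using fin[of i] by (cases "i > r") auto
    ultimately have "(i, j) \<in> {..r} \<times> ?T" using a(1) by auto
    then show "x \<in> (\<lambda>(i, j). int j - int i) ` ({..r} \<times> ?T)" using ij(1) by force
  qed
qed simp

text \<open>The class of 1 survives: the image of \<open>d 0\<close> lies in \<open>I\<close>, whose
  members have no constant term when 1 is not a generator. This makes the set in the definition of
  the regularity nonempty.\<close>

lemma betti_0_0:
  assumes res: "graded_free_resolution X M G D d (\<lambda>f. I +>\<^bsub>SX\<^esub> f 0)" and D0: "D 0 = [0]" and "0 \<notin> B"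
  shows "multigraded_betti X M G 0 0 \<noteq> 0"
proof -
  interpret kscale: vector_space "kscale :: 'k \<Rightarrow> (nat \<Rightarrow> ('v, 'k) mpoly) \<Rightarrow> _"
    by (rule kscale_vector_space)
  let ?Z = "tor_cycles X D d 0 0" and ?B = "tor_boundaries X D d 0 0"
  note rD = resolutionD[OF graded_free_resolutionD(2)[OF res]]
  have comp: "f \<in> shifted_free_component X (D 0) 0 \<longleftrightarrow> f 0 \<in> mpoly_component X 0 \<and> (\<forall>k\<ge>1. f k = 0)"
    for f :: "nat \<Rightarrow> ('v, 'k) mpoly"
    unfolding shifted_iff shifted_free_carrier
    by (auto simp: D0 mpoly_component_iff mpoly_ring_carrier)
  have "f = 0" if f: "f \<in> ?B" for f
  proof -
    obtain g h where fc: "f \<in> shifted_free_component X (D 0) 0"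
      and g: "g \<in> carrier (shifted_free X (D (Suc 0)))" "h \<in> mF X (D 0)" "f = d 0 g + h"
      using f unfolding tor_boundaries_iff by blast
    have "d 0 g \<in> d 0 ` carrier (shifted_free X (D 1))" using g by auto
    then have dg: "d 0 g \<in> carrier (shifted_free X (D 0))" "I +>\<^bsub>SX\<^esub> d 0 g 0 = \<zero>\<^bsub>M\<^esub>"
      unfolding rD(5) by blast+
    then have "d 0 g 0 \<in> carrier SX" by (simp add: D0 free_module_def)
    then have "d 0 g 0 \<in> I" using dg(2) coset_zero_iff by blast
    then have "lookup (d 0 g 0) 0 = 0"
      unfolding monomial_ideal_iff[OF B] using \<open>0 \<notin> B\<close>
      by (metis add.right_neutral add_eq_0_iff_both_eq_0 mdvd_iff_minus multideg_add_eq_0)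
    then have "lookup (f 0) 0 = 0" using g by (simp add: lookup_add mF_iff)
    then have "f k = 0" for k
      using fc unfolding comp mpoly_component_iff
      by (cases "k = 0") (auto intro!: poly_mapping_eqI)
    then show "f = 0" by (simp add: fun_eq_iff)
  qed
  then have "?B \<subseteq> kscale.span {}" by auto
  then have "kscale.dim ?B = 0" using kscale.dim_le_card[of ?B "{}"] by simp
  moreover have "kscale.dim ?Z \<noteq> 0"
  proof
    assume 0: "kscale.dim ?Z = 0"
    \<comment> \<open>Dimension 0 implies the zero space only in finite dimension, because an
      infinite basis also has cardinality 0 by convention.\<close>
    obtain W :: "(nat \<Rightarrow> ('v, 'k) mpoly) set"
      where W: "finite W" "shifted_free_component X (D 0) 0 \<subseteq> kscale.span W"
      by (rule component_finite_dim)
    obtain b where b: "b \<subseteq> ?Z" "kscale.independent b" "?Z \<subseteq> kscale.span b"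
      by (rule kscale.maximal_independent_subset)
    have "b \<subseteq> kscale.span W" using b(1) W(2) tor_cycles_iff by blast
    then have "finite b" using kscale.independent_span_bound[OF W(1) b(2)] by blast
    moreover have "card b = 0" using kscale.basis_card_eq_dim[OF b(1,3,2)] 0 by simp
    ultimately have "?Z \<subseteq> {0}" using b(3) by simp
    moreover have "unit_vec SX 0 \<in> ?Z"
      by (auto simp: tor_cycles_iff comp mpoly_component_iff mpoly_ring_carrier unit_vec_def lookup_one when_def
          multidegs_def split: if_splits)
    ultimately have "unit_vec SX 0 = 0" by blast
    then have "unit_vec SX 0 0 = 0" by simp
    then show False by (simp add: unit_vec_def)
  qed
  ultimately show ?thesis using betti_eq_tor_dim[OF res, of 0 0] by (simp add: tor_dim_def)
qed

text \<open>The Taylor complex leaves the order of the subsets of each size open. Listing those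
  whose lcm is supported on \<open>Y\<close> first yields the splitting into \<open>D\<close> and
  \<open>E\<close>; the bound \<open>r\<close> is the number of generators, beyond which no subsets
  exist.\<close>

lemma taylor_restriction_exists:
  assumes fin: "finite B" and YX: "Y \<subseteq> X"
  obtains D E r and d :: "nat \<Rightarrow> (nat \<Rightarrow> ('v, 'k) mpoly) \<Rightarrow> nat \<Rightarrow> ('v, 'k) mpoly"
  where "resolution_restriction X B Y D E d" "\<And>i. i > r \<Longrightarrow> D i @ E i = []"
proof -
  obtain m where m: "bij_betw m {0..<card B} B" using ex_bij_betw_nat_finite[OF fin] by blast
  define r where "r = card B"
  have mB: "m ` {..<r} = B" using m by (simp add: bij_betw_def r_def atLeast0LessThan)
  let ?L = "monomial_lcm m"
  let ?T = "\<lambda>i. {T. T \<subseteq> {..<r} \<and> card T = i}"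
  have finT: "finite (?T i)" for i by (rule finite_subset[of _ "Pow {..<r}"]) auto
  have "\<exists>ps. set ps = {T \<in> ?T i. ?L T \<in> multidegs Y} \<and> distinct ps" for i
    by (rule finite_distinct_list) (use finT in auto)
  then obtain ps where ps: "\<And>i. set (ps i) = {T \<in> ?T i. ?L T \<in> multidegs Y}" "\<And>i. distinct (ps i)" by metis
  have "\<exists>qs. set qs = {T \<in> ?T i. ?L T \<notin> multidegs Y} \<and> distinct qs" for i
    by (rule finite_distinct_list) (use finT in auto)
  then obtain qs where qs: "\<And>i. set (qs i) = {T \<in> ?T i. ?L T \<notin> multidegs Y}" "\<And>i. distinct (qs i)" by metis
  interpret T: taylor K X B m r "\<lambda>i. ps i @ qs i"
    by unfold_locales (use mB ps qs in auto)
  \<comment> \<open>The empty set is the only one of size 0, and its lcm 1 is supported on every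
    \<open>Y\<close>; so \<open>E 0\<close> is empty.\<close>
  have "{} \<in> set (ps 0)" by (simp add: ps multidegs_def)
  then have 0: "ps 0 = [{}]" "qs 0 = []"
    using T.xs_0 by (cases "ps 0"; simp)+
  have "resolution_restriction X B Y (\<lambda>i. map ?L (ps i)) (\<lambda>i. map ?L (qs i)) T.d"
  proof (intro resolution_restriction.intro resolution_restriction_axioms.intro monomial_quotient_axioms)
    show "free_restriction X Y (map ?L (ps i)) (map ?L (qs i))" for i
      by unfold_locales (use YX ps qs in auto)
    show "map ?L (ps 0) = [0]" "map ?L (qs 0) = []" by (simp_all add: 0)
    have "T.D = (\<lambda>i. map ?L (ps i) @ map ?L (qs i))" by (simp add: T.D_def fun_eq_iff)
    moreover have "T.e = (\<lambda>f. I +>\<^bsub>SX\<^esub> f 0)" by (simp add: T.e_def fun_eq_iff)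
    ultimately show "graded_free_resolution X M G (\<lambda>i. map ?L (ps i) @ map ?L (qs i)) T.d (\<lambda>f. I +>\<^bsub>SX\<^esub> f 0)"
      using T.taylor_resolution by simp
  qed
  moreover have "map ?L (ps i) @ map ?L (qs i) = []" if "i > r" for i
  proof -
    have "card T \<noteq> i" if "T \<subseteq> {..<r}" for T
      using card_mono[OF finite_lessThan that] \<open>i > r\<close> by simp
    then have "set (ps i) = {}" "set (qs i) = {}" unfolding ps qs by blast+
    then show ?thesis by simp
  qed
  ultimately show ?thesis by (rule that)
qed

end

section \<open>Monotonicity of Betti numbers, regularity and projective dimension\<close>

context resolution_restriction
begin

lemma graded_betti_mono:
  assumes "finite X"
  shows "graded_betti X M G i j \<ge> graded_betti Y Y.M Y.G i j"
proof -
  have "graded_betti Y Y.M Y.G i j = (\<Sum>a | a \<in> multidegs Y \<and> total_degree a = j. multigraded_betti X M G i a)"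
    unfolding graded_betti_def by (intro sum.cong) (auto simp: betti_Y)
  also have "\<dots> \<le> graded_betti X M G i j"
    unfolding graded_betti_def using multidegs_mono[OF YX]
    by (intro sum_mono2 finite_multidegs_total_degree[OF assms]) auto
  finally show ?thesis .
qed

lemma regularity_mono:
  assumes X: "finite X" and B: "0 \<notin> B" and fin: "\<And>i. i > r \<Longrightarrow> DX i = []"
  shows "regularity X M G \<ge> regularity Y Y.M Y.G"
  unfolding regularity_def
proof (rule Max_mono)
  show "finite {int j - int i |i j. graded_betti X M G i j \<noteq> 0}"
    by (rule finite_graded_betti[OF res fin])
  show "{int j - int i |i j. graded_betti Y Y.M Y.G i j \<noteq> 0} \<subseteq> {int j - int i |i j. graded_betti X M G i j \<noteq> 0}"
  proof
    fix x assume "x \<in> {int j - int i |i j. graded_betti Y Y.M Y.G i j \<noteq> 0}"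
    then obtain i j where "x = int j - int i" "graded_betti Y Y.M Y.G i j \<noteq> 0" by blast
    moreover from this have "graded_betti X M G i j \<noteq> 0" using graded_betti_mono[OF X, of i j] by simp
    ultimately show "x \<in> {int j - int i |i j. graded_betti X M G i j \<noteq> 0}" by blast
  qed
  have nz: "multigraded_betti Y Y.M Y.G 0 0 \<noteq> 0"
    by (rule Y.betti_0_0[OF resolution_Y D0]) (use B in \<open>simp add: BY_def\<close>)
  have "finite {a \<in> multidegs Y. total_degree a = 0}"
    using finite_multidegs_total_degree finite_subset[OF YX X] by blast
  then have "multigraded_betti Y Y.M Y.G 0 0 \<le> graded_betti Y Y.M Y.G 0 0"
    unfolding graded_betti_def by (intro member_le_sum) (auto simp: multidegs_def total_degree_def)
  then have "graded_betti Y Y.M Y.G 0 0 \<noteq> 0" using nz by simp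
  then show "{int j - int i |i j. graded_betti Y Y.M Y.G i j \<noteq> 0} \<noteq> {}" by blast
qed

text \<open>Every length that is possible over \<open>X\<close> is possible over \<open>Y\<close>,
  so the second infimum is over a larger set. With values in \<open>enat\<close> the empty set gives
  infinity and needs no separate case.\<close>

lemma projective_dimension_mono: "projective_dimension SX M \<ge> projective_dimension Y.SX Y.M"
  unfolding projective_dimension_def using projective_resolution_Y by (intro Inf_superset_mono) blast

end

section \<open>The ideals of order-preserving maps\<close>

definition hom_exponent :: "'p set \<Rightarrow> ('p \<Rightarrow> 'q) \<Rightarrow> ('p \<times> 'q) multideg" where
  "hom_exponent P \<phi> = (\<Sum>p\<in>P. single (p, \<phi> p) 1)"

lemma prod_Var: "finite P \<Longrightarrow> (\<Prod>p\<in>P. Var (p, \<phi> p)) = single (hom_exponent P \<phi>) 1"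
  by (induction P rule: finite_induct) (simp_all add: hom_exponent_def Var_def mult_single)

lemma lookup_hom_exponent:
  assumes "finite P"
  shows "lookup (hom_exponent P \<phi>) (p, q) = (if p \<in> P \<and> \<phi> p = q then 1 else 0)"
proof -
  have "lookup (hom_exponent P \<phi>) (p, q) = (\<Sum>p'\<in>P. if p' = p then (if \<phi> p = q then 1 else 0) else 0)"
    unfolding hom_exponent_def lookup_sum by (intro sum.cong) (auto simp: lookup_single when_def)
  then show ?thesis using assms by simp
qed

lemma hom_exponent_multidegs:
  "finite P \<Longrightarrow> hom_exponent P \<phi> \<in> multidegs (P \<times> Q) \<longleftrightarrow> (\<forall>p\<in>P. \<phi> p \<in> Q)"
  by (auto simp: multidegs_def subset_iff in_keys_iff lookup_hom_exponent)

lemma hom_ideal_eq: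
  "finite P \<Longrightarrow> hom_ideal K P Q = monomial_ideal (P \<times> Q) (hom_exponent P ` poset_hom P Q)"
  by (simp add: hom_ideal_def monomial_ideal_def image_image prod_Var)

lemma hom_quotient_eq:
  assumes "finite P"
  shows "hom_quotient K P Q = quot_module (mpoly_ring (P \<times> Q)) (monomial_ideal (P \<times> Q) (hom_exponent P ` poset_hom P Q))"
    and "hom_quotient_component K P Q = monomial_quotient_component (P \<times> Q) (hom_exponent P ` poset_hom P Q)"
  by (simp_all add: hom_quotient_def hom_quotient_component_def monomial_quotient_component_def
      hom_ideal_eq[OF assms] fun_eq_iff)

text \<open>The support of the exponent of \<open>\<phi>\<close> is its graph over \<open>P\<close>,
  so it lies in \<open>P \<times> Q'\<close> exactly if \<open>\<phi>\<close> maps into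
  \<open>Q'\<close>; as \<open>Q'\<close> carries the induced order, monotonicity means the same for
  both targets.\<close>

lemma hom_exponents_restrict:
  assumes "finite P" "Q' \<subseteq> Q"
  shows "hom_exponent P ` poset_hom P Q \<inter> multidegs (P \<times> Q') = hom_exponent P ` poset_hom P Q'"
proof -
  have "{\<phi> \<in> poset_hom P Q. \<forall>p\<in>P. \<phi> p \<in> Q'} = poset_hom P Q'"
    using assms(2) unfolding poset_hom_def PiE_def by (auto simp: Pi_def)
  then show ?thesis using hom_exponent_multidegs[OF assms(1), of _ Q'] by (auto simp: image_iff)
qed

theorem proposition3p9:
  fixes K :: "'k::field itself"
    and P :: "'p::order set" and Q Q' :: "'q::order set"
  assumes "finite P" and "P \<noteq> {}"
    and "finite Q" and "Q \<noteq> {}"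
    and "Q' \<subseteq> Q" and "Q' \<noteq> {}"
  shows "(\<forall>i. \<forall>a\<in>multidegs (P \<times> Q').
            hom_multigraded_betti K P Q i a = hom_multigraded_betti K P Q' i a)
       \<and> (\<forall>i j. hom_graded_betti K P Q i j \<ge> hom_graded_betti K P Q' i j)
       \<and> hom_reg K P Q \<ge> hom_reg K P Q'
       \<and> hom_pdim K P Q \<ge> hom_pdim K P Q'"
proof -
  let ?X = "P \<times> Q" and ?Y = "P \<times> Q'" and ?B = "hom_exponent P ` poset_hom P Q"
  have B: "?B \<subseteq> multidegs ?X"
    using hom_exponent_multidegs[OF assms(1), of _ Q] by (auto simp: poset_hom_def)
  interpret monomial_quotient K ?X ?B by unfold_locales (rule B)
  have "finite (P \<rightarrow>\<^sub>E Q)" using assms by (intro finite_PiE) auto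
  then have finB: "finite ?B" by (auto simp: poset_hom_def)
  have YX: "?Y \<subseteq> ?X" using assms(5) by auto
  obtain D E r and d :: "nat \<Rightarrow> (nat \<Rightarrow> ('p \<times> 'q, 'k) mpoly) \<Rightarrow> nat \<Rightarrow> ('p \<times> 'q, 'k) mpoly"
    where D: "resolution_restriction ?X ?B ?Y D E d" "\<And>i. i > r \<Longrightarrow> D i @ E i = []"
    by (rule taylor_restriction_exists[OF finB YX]) blast
  interpret R: resolution_restriction K ?X ?B ?Y D E d by (rule D(1))
  have BY: "R.BY = hom_exponent P ` poset_hom P Q'"
    unfolding R.BY_def by (rule hom_exponents_restrict[OF assms(1,5)])
  \<comment> \<open>Since \<open>P\<close> is nonempty, every generator contains a variable, and the
    quotient by the ideal is not zero.\<close>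
  have nz: "0 \<notin> ?B"
  proof
    assume "0 \<in> ?B"
    then obtain \<phi> :: "'p \<Rightarrow> 'q" where \<phi>: "0 = hom_exponent P \<phi>" by (rule imageE)
    obtain p where "p \<in> P" using assms(2) by blast
    then have "lookup (hom_exponent P \<phi>) (p, \<phi> p) = 1" by (simp add: lookup_hom_exponent[OF assms(1)])
    then show False by (simp add: \<phi>[symmetric])
  qed
  have X: "finite ?X" using assms by simp
  note eq = hom_quotient_eq[OF assms(1)]
  show ?thesis
    unfolding hom_multigraded_betti_def hom_graded_betti_def hom_reg_def hom_pdim_def eq BY[symmetric]
    using R.betti_Y R.graded_betti_mono[OF X] R.regularity_mono[OF X nz D(2)] R.projective_dimension_mono
    by blast
qed

end
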